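(* Let $H$ be a Hopf algebra over $\mathbb{C}$, let $K\subseteq H$ be a cocommutative Hopf subalgebra, let $V$ be a right-left SAYD module over $K$ and let $N$ be a right-left SAYD module over $H$. For $q\ge 0$ put $C^q_K(H,V,N)=\mathrm{Hom}_K(V,\,N\otimes_H H^{\otimes (q+1)})$. Then the morphisms $d_i:C^{q}_K(H,V,N)\to C^{q+1}_K(H,V,N)$ ($0\le i\le q+1$), $s_j:C^{q}_K(H,V,N)\to C^{q-1}_K(H,V,N)$ ($0\le j\le q-1$) and $t_q:C^{q}_K(H,V,N)\to C^{q}_K(H,V,N)$ given by $$d_i(\phi)(v)=\mathfrak{d}_i(\phi(v))\ (0\le i\le q),\qquad d_{q+1}(\phi)(v)=\mathfrak{d}_{q+1}(\phi(v_{<0>}))\triangleleft S(v_{<-1>}),$$ $$s_j(\phi)(v)=\mathfrak{s}_j(\phi(v))\ (0\le j\le q-1),\qquad t_q(\phi)(v)=\mathfrak{t}_q(\phi(v_{<0>}))\triangleleft S(v_{<-1>})$$ (are well defined and) define a cocyclic module structure on $\bigoplus_{q\ge0}C^q_K(H,V,N)$.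
   Context: All vector spaces and tensor products are over $\mathbb{C}$. Sweedler notation: $\Delta(h)=h_{(1)}\otimes h_{(2)}$, and a left coaction is written $v\mapsto v_{<-1>}\otimes v_{<0>}$; $S$ is the antipode. A right-left SAYD (stable anti-Yetter-Drinfeld) module over a Hopf algebra $H$ is a vector space $M$ that is a right $H$-module and a left $H$-comodule with $\nabla(m\cdot h)=S(h_{(3)})m_{<-1>}h_{(1)}\otimes m_{<0>}\cdot h_{(2)}$ and $m_{<0>}\cdot m_{<-1>}=m$ for all $m\in M$, $h\in H$. $N\otimes_H H^{\otimes(q+1)}$ uses the left diagonal action of $H$ on $H^{\otimes(q+1)}$ by multiplication. $K$ acts on it from the right diagonally: $(n\otimes_H h^0\otimes\cdots\otimes h^q)\cdot u=n\otimes_H h^0u_{(1)}\otimes\cdots\otimes h^qu_{(q+1)}$; $\mathrm{Hom}_K$ means linear maps with $\phi(v\cdot u)=\phi(v)\cdot u$ for $u\in K$. Also $(n\otimes_H h^0\otimes\cdots\otimes h^q)\triangleleft u=n\otimes_H h^0\otimes\cdots\otimes h^{q-1}\otimes h^qu$ for $u\in K$. The operators on $N\otimes_H H^{\otimes(q+1)}$ are $\mathfrak{d}_i(n\otimes_H h^0\otimes\cdots\otimes h^q)=n\otimes_H h^0\otimes\cdots\otimes\Delta(h^i)\otimes\cdots\otimes h^q$ for $0\le i\le q$; $\mathfrak{d}_{q+1}(n\otimes_H h^0\otimes\cdots\otimes h^q)=n_{<0>}\otimes_H h^0_{(2)}\otimes h^1\otimes\cdots\otimes h^q\otimes n_{<-1>}h^0_{(1)}$;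 $\mathfrak{s}_j(n\otimes_H h^0\otimes\cdots\otimes h^q)=n\otimes_H h^0\otimes\cdots\otimes\varepsilon(h^{j+1})\otimes\cdots\otimes h^q$ for $0\le j\le q-1$; $\mathfrak{t}_q(n\otimes_H h^0\otimes\cdots\otimes h^q)=n_{<0>}\otimes_H h^1\otimes\cdots\otimes h^q\otimes n_{<-1>}h^0$. Cocyclic module means the usual cosimplicial identities for $d_i,s_j$ together with $t_{q+1}d_i=d_{i-1}t_q$ ($1\le i\le q+1$), $t_{q+1}d_0=d_{q+1}$, $t_{q-1}s_i=s_{i-1}t_q$ ($1\le i\le q-1$), $t_{q-1}s_0=s_{q-1}t_q^2$, and $t_q^{q+1}=\mathrm{Id}$. *)

theory Defs
  imports Complex_Main "HOL-Library.Poly_Mapping" "HOL-Library.Set_Algebras"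
begin

section \<open>Complex vector spaces and unital algebras\<close>

class complex_vector = ab_group_add +
  fixes scaleC :: "complex \<Rightarrow> 'a \<Rightarrow> 'a"  (infixr \<open>*\<^sub>C\<close> 75)
  assumes scaleC_add_right: "c *\<^sub>C (x + y) = c *\<^sub>C x + c *\<^sub>C y"
    and scaleC_add_left: "(c + d) *\<^sub>C x = c *\<^sub>C x + d *\<^sub>C x"
    and scaleC_scaleC: "c *\<^sub>C d *\<^sub>C x = (c * d) *\<^sub>C x"
    and scaleC_one: "1 *\<^sub>C x = x"

global_interpretation complex_vector:
  vector_space "scaleC :: complex \<Rightarrow> 'a \<Rightarrow> 'a::complex_vector"
  by unfold_locales (simp_all add: scaleC_add_right scaleC_add_left scaleC_scaleC scaleC_one)

abbreviation clinear :: "('a::complex_vector \<Rightarrow> 'b::complex_vector) \<Rightarrow> bool"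
  where "clinear \<equiv> Vector_Spaces.linear scaleC scaleC"

abbreviation cspan :: "'a::complex_vector set \<Rightarrow> 'a set"
  where "cspan \<equiv> complex_vector.span"

abbreviation csubspace :: "'a::complex_vector set \<Rightarrow> bool"
  where "csubspace \<equiv> complex_vector.subspace"

text \<open>
  \<^class>\<open>ring_1\<close> demands \<open>0 \<noteq> 1\<close>. This excludes no Hopf algebra, because
  a counit sends \<open>1\<close> to \<open>1\<close>.
\<close>

class complex_algebra_1 = complex_vector + ring_1 +
  assumes mult_scaleC_left: "(c *\<^sub>C x) * y = c *\<^sub>C (x * y)"
    and mult_scaleC_right: "x * (c *\<^sub>C y) = c *\<^sub>C (x * y)"

instantiation complex :: complex_algebra_1
begin

definition scaleC_complex :: "complex \<Rightarrow> complex \<Rightarrow> complex"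
  where "scaleC_complex c x = c * x"

instance
  by standard (simp_all add: scaleC_complex_def algebra_simps)

end

instantiation poly_mapping :: (type, complex_vector) complex_vector
begin

definition scaleC_poly_mapping :: "complex \<Rightarrow> ('a \<Rightarrow>\<^sub>0 'b) \<Rightarrow> ('a \<Rightarrow>\<^sub>0 'b)"
  where "scaleC_poly_mapping c p = Poly_Mapping.map (scaleC c) p"

lemma lookup_scaleC: "Poly_Mapping.lookup (c *\<^sub>C p) k = c *\<^sub>C Poly_Mapping.lookup p k"
  for p :: "'a \<Rightarrow>\<^sub>0 'b"
  by (simp add: scaleC_poly_mapping_def Poly_Mapping.map.rep_eq Poly_Mapping.when_def)

instance
  by standard
    (simp_all add: poly_mapping_eq_iff fun_eq_iff lookup_scaleC lookup_add
      scaleC_add_right scaleC_add_left scaleC_scaleC scaleC_one)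

end


section \<open>Tensor products over the complex numbers\<close>

text \<open>\<open>'a \<Rightarrow>\<^sub>0 complex\<close> is the free vector space on \<open>'a\<close>; \<open>free_lift g\<close> extends \<open>g\<close> linearly to it.\<close>

definition free_lift :: "('a \<Rightarrow> 'c::complex_vector) \<Rightarrow> ('a \<Rightarrow>\<^sub>0 complex) \<Rightarrow> 'c"
  where "free_lift g p = (\<Sum>k\<in>Poly_Mapping.keys p. Poly_Mapping.lookup p k *\<^sub>C g k)"

lemma free_lift_superset:
  assumes "finite A" "Poly_Mapping.keys p \<subseteq> A"
  shows "free_lift g p = (\<Sum>k\<in>A. Poly_Mapping.lookup p k *\<^sub>C g k)"
  unfolding free_lift_def using assms
  by (intro sum.mono_neutral_left) (auto simp: in_keys_iff)

lemma free_lift_add: "free_lift g (p + q) = free_lift g p + free_lift g q"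
proof -
  let ?A = "Poly_Mapping.keys p \<union> Poly_Mapping.keys q"
  have "Poly_Mapping.keys (p + q) \<subseteq> ?A" by (rule Poly_Mapping.keys_add)
  then show ?thesis
    by (simp add: free_lift_superset[of ?A] lookup_add scaleC_add_left sum.distrib)
qed

lemma free_lift_scaleC: "free_lift g (c *\<^sub>C p) = c *\<^sub>C free_lift g p"
proof -
  have "Poly_Mapping.keys (c *\<^sub>C p) \<subseteq> Poly_Mapping.keys p"
    by (auto simp: in_keys_iff lookup_scaleC scaleC_complex_def)
  then show ?thesis
    by (simp add: free_lift_superset[of "Poly_Mapping.keys p"] lookup_scaleC scaleC_complex_def
        complex_vector.scale_sum_right scaleC_scaleC)
qed

lemma linear_free_lift: "clinear (free_lift g)"
  by unfold_locales (simp_all add: free_lift_add free_lift_scaleC)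

lemma free_lift_single [simp]: "free_lift g (Poly_Mapping.single k 1) = g k"
  by (simp add: free_lift_def scaleC_one)

subsection \<open>Binary tensor products\<close>

definition tensor_relators :: "('a::complex_vector \<times> 'b::complex_vector \<Rightarrow>\<^sub>0 complex) set"
  where "tensor_relators =
    {Poly_Mapping.single (a + a', b) 1 - Poly_Mapping.single (a, b) 1
       - Poly_Mapping.single (a', b) 1 |a a' b. True} \<union>
    {Poly_Mapping.single (a, b + b') 1 - Poly_Mapping.single (a, b) 1
       - Poly_Mapping.single (a, b') 1 |a b b'. True} \<union>
    {Poly_Mapping.single (c *\<^sub>C a, b) 1 - c *\<^sub>C Poly_Mapping.single (a, b) 1 |c a b. True} \<union>
    {Poly_Mapping.single (a, c *\<^sub>C b) 1 - c *\<^sub>C Poly_Mapping.single (a, b) 1 |c a b. True}"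

definition tensor_eq ::
  "('a::complex_vector \<times> 'b::complex_vector \<Rightarrow>\<^sub>0 complex) \<Rightarrow> ('a \<times> 'b \<Rightarrow>\<^sub>0 complex) \<Rightarrow> bool"
  where "tensor_eq p q \<longleftrightarrow> p - q \<in> cspan tensor_relators"

lemma equivp_span_eq:
  fixes R :: "'a::complex_vector set"
  shows "equivp (\<lambda>p q. p - q \<in> cspan R)"
proof (rule equivpI)
  show "reflp (\<lambda>p q. p - q \<in> cspan R)"
    by (simp add: reflp_def complex_vector.span_zero)
  show "symp (\<lambda>p q. p - q \<in> cspan R)"
    by (metis (no_types, lifting) symp_def minus_diff_eq complex_vector.span_neg)
  show "transp (\<lambda>p q. p - q \<in> cspan R)"
  proof (rule transpI)
    fix p q r assume "p - q \<in> cspan R" "q - r \<in> cspan R"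
    from complex_vector.span_add[OF this] show "p - r \<in> cspan R" by simp
  qed
qed

lemma span_eq_add:
  fixes p :: "'a::complex_vector"
  shows "p - p' \<in> cspan R \<Longrightarrow> q - q' \<in> cspan R \<Longrightarrow> (p + q) - (p' + q') \<in> cspan R"
  using complex_vector.span_add[of "p - p'" R "q - q'"] by (simp add: algebra_simps)

lemma span_eq_diff:
  fixes p :: "'a::complex_vector"
  shows "p - p' \<in> cspan R \<Longrightarrow> q - q' \<in> cspan R \<Longrightarrow> (p - q) - (p' - q') \<in> cspan R"
  using complex_vector.span_diff[of "p - p'" R "q - q'"] by (simp add: algebra_simps)

lemma span_eq_uminus:
  fixes p :: "'a::complex_vector"
  shows "p - p' \<in> cspan R \<Longrightarrow> (- p) - (- p') \<in> cspan R"
  using complex_vector.span_neg[of "p - p'" R] by (simp add: algebra_simps)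

lemma span_eq_scaleC:
  fixes p :: "'a::complex_vector"
  shows "p - p' \<in> cspan R \<Longrightarrow> c *\<^sub>C p - c *\<^sub>C p' \<in> cspan R"
  using complex_vector.span_scale[of "p - p'" R c]
  by (simp add: complex_vector.scale_right_diff_distrib)

quotient_type (overloaded) ('a, 'b) tensor =
  "'a::complex_vector \<times> 'b::complex_vector \<Rightarrow>\<^sub>0 complex" / tensor_eq
  unfolding tensor_eq_def by (rule equivp_span_eq)

instantiation tensor :: (complex_vector, complex_vector) complex_vector
begin

lift_definition zero_tensor :: "('a, 'b) tensor" is "0" .

lift_definition plus_tensor :: "('a, 'b) tensor \<Rightarrow> ('a, 'b) tensor \<Rightarrow> ('a, 'b) tensor"
  is "(+)" unfolding tensor_eq_def by (rule span_eq_add)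

lift_definition minus_tensor :: "('a, 'b) tensor \<Rightarrow> ('a, 'b) tensor \<Rightarrow> ('a, 'b) tensor"
  is "(-)" unfolding tensor_eq_def by (rule span_eq_diff)

lift_definition uminus_tensor :: "('a, 'b) tensor \<Rightarrow> ('a, 'b) tensor"
  is "uminus" unfolding tensor_eq_def by (rule span_eq_uminus)

lift_definition scaleC_tensor :: "complex \<Rightarrow> ('a, 'b) tensor \<Rightarrow> ('a, 'b) tensor"
  is "scaleC" unfolding tensor_eq_def by (rule span_eq_scaleC)

instance
  by standard
    (transfer; simp add: tensor_eq_def complex_vector.span_zero algebra_simps
      scaleC_add_right scaleC_add_left scaleC_scaleC scaleC_one)+

end

lift_definition tensor_pure :: "'a::complex_vector \<Rightarrow> 'b::complex_vector \<Rightarrow> ('a, 'b) tensor"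
    (infixr \<open>\<otimes>\<close> 72)
  is "\<lambda>a b. Poly_Mapping.single (a, b) 1" .

text \<open>
  For subspaces \<open>A\<close> and \<open>B\<close> the map from the tensor product of \<open>A\<close> and \<open>B\<close> to that
  of the ambient spaces is injective; \<open>tensor_space A B\<close> is its image.
\<close>

definition tensor_space ::
  "'a::complex_vector set \<Rightarrow> 'b::complex_vector set \<Rightarrow> ('a, 'b) tensor set"
  where "tensor_space A B = cspan {a \<otimes> b |a b. a \<in> A \<and> b \<in> B}"

text \<open>
  The linear map on \<open>tensor_space A B\<close> induced by a map \<open>f\<close> that is bilinear on
  \<open>A \<times> B\<close>. It renders Sweedler notation: \<open>f h\<^sub>(\<^sub>1\<^sub>) h\<^sub>(\<^sub>2\<^sub>)\<close> is
  \<open>tensor_lift f (\<Delta> h)\<close>. The relative form is for an \<open>f\<close> that is meaningful only on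
  \<open>A \<times> B\<close>; the value does not depend on the chosen representative.
\<close>

definition tensor_lift_on ::
  "'a::complex_vector set \<Rightarrow> 'b::complex_vector set \<Rightarrow> ('a \<Rightarrow> 'b \<Rightarrow> 'c::complex_vector)
    \<Rightarrow> ('a, 'b) tensor \<Rightarrow> 'c"
  where "tensor_lift_on A B f t =
    free_lift (\<lambda>(a, b). f a b)
      (SOME p. abs_tensor p = t \<and> Poly_Mapping.keys p \<subseteq> A \<times> B)"

abbreviation tensor_lift ::
  "('a::complex_vector \<Rightarrow> 'b::complex_vector \<Rightarrow> 'c::complex_vector) \<Rightarrow> ('a, 'b) tensor \<Rightarrow> 'c"
  where "tensor_lift \<equiv> tensor_lift_on UNIV UNIV"

definition bilinear_on ::
  "'a::complex_vector set \<Rightarrow> 'b::complex_vector set \<Rightarrow> ('a \<Rightarrow> 'b \<Rightarrow> 'c::complex_vector) \<Rightarrow> bool"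
  where "bilinear_on A B f \<longleftrightarrow>
    (\<forall>a\<in>A. \<forall>a'\<in>A. \<forall>b\<in>B. f (a + a') b = f a b + f a' b) \<and>
    (\<forall>a\<in>A. \<forall>b\<in>B. \<forall>b'\<in>B. f a (b + b') = f a b + f a b') \<and>
    (\<forall>c. \<forall>a\<in>A. \<forall>b\<in>B. f (c *\<^sub>C a) b = c *\<^sub>C f a b) \<and>
    (\<forall>c. \<forall>a\<in>A. \<forall>b\<in>B. f a (c *\<^sub>C b) = c *\<^sub>C f a b)"


lemma free_lift_zero_on_span:
  assumes "p \<in> cspan R" and "\<And>r. r \<in> R \<Longrightarrow> free_lift g r = 0"
  shows "free_lift g p = 0"
  using assms(1)
proof (induction rule: complex_vector.span_induct_alt)
  case base
  show ?case by (simp add: free_lift_def)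
next
  case (step c x y)
  then show ?case by (simp add: free_lift_add free_lift_scaleC assms(2))
qed

lemma free_lift_tensor_relators:
  assumes "bilinear_on UNIV UNIV f" and "r \<in> tensor_relators"
  shows "free_lift (\<lambda>(a, b). f a b) r = 0"
proof -
  interpret L: Vector_Spaces.linear scaleC scaleC "free_lift (\<lambda>(a, b). f a b)"
    by (rule linear_free_lift)
  show ?thesis
    using assms unfolding tensor_relators_def bilinear_on_def
    by (auto simp: L.diff free_lift_scaleC)
qed

lemma exists_projection:
  fixes A :: "'a::complex_vector set"
  assumes "csubspace A"
  obtains \<pi> where "clinear \<pi>" "\<And>x. \<pi> x \<in> A" "\<And>x. x \<in> A \<Longrightarrow> \<pi> x = x"
proof -
  interpret vector_space_pair "scaleC :: complex \<Rightarrow> 'a \<Rightarrow> 'a" "scaleC :: complex \<Rightarrow> 'a \<Rightarrow> 'a"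
    by unfold_locales
  have "clinear (id :: 'a \<Rightarrow> 'a)"
    by (rule complex_vector.linear_id)
  from linear_exists_left_inverse_on[OF this assms]
  obtain g where g: "range g \<subseteq> A" "clinear g" "\<forall>v\<in>A. g v = v" by auto
  show ?thesis by (rule that[OF g(2)]) (use g in auto)
qed

lemma free_lift_well_defined:
  assumes A: "csubspace A" and B: "csubspace B" and f: "bilinear_on A B f"
    and p: "Poly_Mapping.keys p \<subseteq> A \<times> B" and q: "Poly_Mapping.keys q \<subseteq> A \<times> B"
    and eq: "abs_tensor p = abs_tensor q"
  shows "free_lift (\<lambda>(a, b). f a b) p = free_lift (\<lambda>(a, b). f a b) q"
proof -
  obtain \<pi> where \<pi>: "clinear \<pi>" "\<And>x. \<pi> x \<in> A" "\<And>x. x \<in> A \<Longrightarrow> \<pi> x = x"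
    using exists_projection[OF A] by metis
  obtain \<rho> where \<rho>: "clinear \<rho>" "\<And>x. \<rho> x \<in> B" "\<And>x. x \<in> B \<Longrightarrow> \<rho> x = x"
    using exists_projection[OF B] by metis
  define F where "F a b = f (\<pi> a) (\<rho> b)" for a b
  interpret P: Vector_Spaces.linear scaleC scaleC \<pi> by (rule \<pi>(1))
  interpret Q: Vector_Spaces.linear scaleC scaleC \<rho> by (rule \<rho>(1))
  have F: "bilinear_on UNIV UNIV F"
    using f \<pi>(2) \<rho>(2) unfolding bilinear_on_def F_def
    by (simp add: P.add Q.add P.scale Q.scale)
  have same: "free_lift (\<lambda>(a, b). F a b) r = free_lift (\<lambda>(a, b). f a b) r"
    if "Poly_Mapping.keys r \<subseteq> A \<times> B" for r
    unfolding free_lift_def F_def using that \<pi>(3) \<rho>(3)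
    by (intro sum.cong) auto
  interpret L: Vector_Spaces.linear scaleC scaleC "free_lift (\<lambda>(a, b). F a b)"
    by (rule linear_free_lift)
  have "p - q \<in> cspan tensor_relators"
    using eq by (simp add: tensor.abs_eq_iff tensor_eq_def)
  then have "free_lift (\<lambda>(a, b). F a b) (p - q) = 0"
    by (rule free_lift_zero_on_span) (rule free_lift_tensor_relators[OF F])
  then show ?thesis
    using same[OF p] same[OF q] by (simp add: L.diff)
qed

lemma tensor_lift_on_abs:
  assumes "csubspace A" "csubspace B" "bilinear_on A B f" "Poly_Mapping.keys p \<subseteq> A \<times> B"
  shows "tensor_lift_on A B f (abs_tensor p) = free_lift (\<lambda>(a, b). f a b) p"
  unfolding tensor_lift_on_def
  using assms
    someI[of "\<lambda>q. abs_tensor q = abs_tensor p \<and> Poly_Mapping.keys q \<subseteq> A \<times> B" p]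
  by (intro free_lift_well_defined[OF assms(1,2,3)]) auto

lemma tensor_lift_on_pure:
  assumes "csubspace A" "csubspace B" "bilinear_on A B f" "a \<in> A" "b \<in> B"
  shows "tensor_lift_on A B f (a \<otimes> b) = f a b"
  using tensor_lift_on_abs[OF assms(1-3), of "Poly_Mapping.single (a, b) 1"] assms(4,5)
  by (simp add: tensor_pure.abs_eq)

subsection \<open>Tensor powers\<close>

text \<open>
  \<open>'a tpow\<close> is the direct sum of all tensor powers of \<open>'a\<close>. The pure tensor
  \<open>x\<^sub>1 \<otimes> \<dots> \<otimes> x\<^sub>n\<close> is \<open>tpow_pure [x\<^sub>1, \<dots>, x\<^sub>n]\<close>, and \<open>tpow_space n\<close> is the
  \<open>n\<close>-th tensor power.
\<close>

definition tpow_relators :: "('a::complex_vector list \<Rightarrow>\<^sub>0 complex) set"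
  where "tpow_relators =
    {Poly_Mapping.single (xs @ (a + b) # ys) 1 - Poly_Mapping.single (xs @ a # ys) 1
       - Poly_Mapping.single (xs @ b # ys) 1 |xs a b ys. True} \<union>
    {Poly_Mapping.single (xs @ (c *\<^sub>C a) # ys) 1
       - c *\<^sub>C Poly_Mapping.single (xs @ a # ys) 1 |xs c a ys. True}"

definition tpow_eq ::
  "('a::complex_vector list \<Rightarrow>\<^sub>0 complex) \<Rightarrow> ('a list \<Rightarrow>\<^sub>0 complex) \<Rightarrow> bool"
  where "tpow_eq p q \<longleftrightarrow> p - q \<in> cspan tpow_relators"

quotient_type (overloaded) 'a tpow = "'a::complex_vector list \<Rightarrow>\<^sub>0 complex" / tpow_eq
  unfolding tpow_eq_def by (rule equivp_span_eq)

instantiation tpow :: (complex_vector) complex_vector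
begin

lift_definition zero_tpow :: "'a tpow" is "0" .

lift_definition plus_tpow :: "'a tpow \<Rightarrow> 'a tpow \<Rightarrow> 'a tpow"
  is "(+)" unfolding tpow_eq_def by (rule span_eq_add)

lift_definition minus_tpow :: "'a tpow \<Rightarrow> 'a tpow \<Rightarrow> 'a tpow"
  is "(-)" unfolding tpow_eq_def by (rule span_eq_diff)

lift_definition uminus_tpow :: "'a tpow \<Rightarrow> 'a tpow"
  is "uminus" unfolding tpow_eq_def by (rule span_eq_uminus)

lift_definition scaleC_tpow :: "complex \<Rightarrow> 'a tpow \<Rightarrow> 'a tpow"
  is "scaleC" unfolding tpow_eq_def by (rule span_eq_scaleC)

instance
  by standard
    (transfer; simp add: tpow_eq_def complex_vector.span_zero algebra_simps
      scaleC_add_right scaleC_add_left scaleC_scaleC scaleC_one)+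

end

lift_definition tpow_pure :: "'a::complex_vector list \<Rightarrow> 'a tpow"
  is "\<lambda>xs. Poly_Mapping.single xs 1" .

definition tpow_space :: "nat \<Rightarrow> 'a::complex_vector tpow set"
  where "tpow_space n = cspan {tpow_pure xs |xs. length xs = n}"

definition multilinear :: "('a::complex_vector list \<Rightarrow> 'c::complex_vector) \<Rightarrow> bool"
  where "multilinear f \<longleftrightarrow>
    (\<forall>xs a b ys. f (xs @ (a + b) # ys) = f (xs @ a # ys) + f (xs @ b # ys)) \<and>
    (\<forall>xs c a ys. f (xs @ (c *\<^sub>C a) # ys) = c *\<^sub>C f (xs @ a # ys))"

definition tpow_lift :: "('a::complex_vector list \<Rightarrow> 'c::complex_vector) \<Rightarrow> 'a tpow \<Rightarrow> 'c"
  where "tpow_lift f t = free_lift f (rep_tpow t)"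

lemma tpow_lift_abs:
  assumes "multilinear f"
  shows "tpow_lift f (abs_tpow p) = free_lift f p"
proof -
  interpret L: Vector_Spaces.linear scaleC scaleC "free_lift f"
    by (rule linear_free_lift)
  have "abs_tpow (rep_tpow (abs_tpow p)) = abs_tpow p"
    by (rule Quotient3_abs_rep[OF Quotient3_tpow])
  then have "rep_tpow (abs_tpow p) - p \<in> cspan tpow_relators"
    by (simp add: tpow.abs_eq_iff tpow_eq_def)
  moreover have "free_lift f r = 0" if "r \<in> tpow_relators" for r
    using that assms unfolding tpow_relators_def multilinear_def
    by (auto simp: L.diff free_lift_scaleC)
  ultimately have "free_lift f (rep_tpow (abs_tpow p) - p) = 0"
    by (rule free_lift_zero_on_span)
  then show ?thesis by (simp add: tpow_lift_def L.diff)
qed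

lemma tpow_lift_pure: "multilinear f \<Longrightarrow> tpow_lift f (tpow_pure xs) = f xs"
  by (simp add: tpow_pure.abs_eq tpow_lift_abs)

definition tpow_cons :: "'a::complex_vector \<Rightarrow> 'a tpow \<Rightarrow> 'a tpow"
  where "tpow_cons a = tpow_lift (\<lambda>xs. tpow_pure (a # xs))"

text \<open>Factorwise multiplication; the products of tensors of distinct degrees are set to \<open>0\<close>.\<close>

definition tpow_mult :: "'a::complex_algebra_1 tpow \<Rightarrow> 'a tpow \<Rightarrow> 'a tpow"
  where "tpow_mult s t =
    tpow_lift (\<lambda>xs. tpow_lift (\<lambda>ys.
      if length xs = length ys then tpow_pure (map2 (*) xs ys) else 0) t) s"


section \<open>Hopf algebras\<close>

definition tensor_mult ::
  "('a::complex_algebra_1, 'b::complex_algebra_1) tensor \<Rightarrow> ('a, 'b) tensor \<Rightarrow> ('a, 'b) tensor"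
  where "tensor_mult s t =
    tensor_lift (\<lambda>a b. tensor_lift (\<lambda>a' b'. (a * a') \<otimes> (b * b')) t) s"

locale hopf_algebra =
  fixes \<Delta> :: "'h::complex_algebra_1 \<Rightarrow> ('h, 'h) tensor"
    and \<epsilon> :: "'h \<Rightarrow> complex"
    and S :: "'h \<Rightarrow> 'h"
  assumes linear_comult: "clinear \<Delta>"
    and linear_counit: "clinear \<epsilon>"
    and linear_antipode: "clinear S"
    and coassoc: "tensor_lift (\<lambda>a b. tensor_lift (\<lambda>a' a''. a' \<otimes> (a'' \<otimes> b)) (\<Delta> a)) (\<Delta> h)
      = tensor_lift (\<lambda>a b. a \<otimes> \<Delta> b) (\<Delta> h)"
    and counit_left: "tensor_lift (\<lambda>a b. \<epsilon> a *\<^sub>C b) (\<Delta> h) = h"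
    and counit_right: "tensor_lift (\<lambda>a b. \<epsilon> b *\<^sub>C a) (\<Delta> h) = h"
    and comult_one: "\<Delta> 1 = 1 \<otimes> 1"
    and comult_mult: "\<Delta> (g * h) = tensor_mult (\<Delta> g) (\<Delta> h)"
    and counit_one: "\<epsilon> 1 = 1"
    and counit_mult: "\<epsilon> (g * h) = \<epsilon> g * \<epsilon> h"
    and antipode_left: "tensor_lift (\<lambda>a b. S a * b) (\<Delta> h) = \<epsilon> h *\<^sub>C 1"
    and antipode_right: "tensor_lift (\<lambda>a b. a * S b) (\<Delta> h) = \<epsilon> h *\<^sub>C 1"

locale hopf_subalgebra = hopf_algebra \<Delta> \<epsilon> S
  for \<Delta> :: "'h::complex_algebra_1 \<Rightarrow> ('h, 'h) tensor"
    and \<epsilon> :: "'h \<Rightarrow> complex"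
    and S :: "'h \<Rightarrow> 'h" +
  fixes K :: "'h set"
  assumes subspace: "csubspace K"
    and one_closed: "1 \<in> K"
    and mult_closed: "g \<in> K \<Longrightarrow> h \<in> K \<Longrightarrow> g * h \<in> K"
    and comult_closed: "h \<in> K \<Longrightarrow> \<Delta> h \<in> tensor_space K K"
    and antipode_closed: "h \<in> K \<Longrightarrow> S h \<in> K"

definition cocommutative_on :: "('h::complex_vector \<Rightarrow> ('h, 'h) tensor) \<Rightarrow> 'h set \<Rightarrow> bool"
  where "cocommutative_on \<Delta> K \<longleftrightarrow> (\<forall>h\<in>K. tensor_lift (\<lambda>a b. b \<otimes> a) (\<Delta> h) = \<Delta> h)"


section \<open>Stable anti-Yetter-Drinfeld modules\<close>

text \<open>
  All notions are relative to a Hopf subalgebra \<open>K\<close> of the ambient Hopf algebra, so that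
  \<open>K = UNIV\<close> gives the notions over the ambient Hopf algebra. Only the values
  \<open>act m h\<close> with \<open>h \<in> K\<close> matter. A coaction of \<open>K\<close> takes its values in
  \<open>tensor_space K UNIV\<close>.
\<close>

definition right_module_on ::
  "'h::complex_algebra_1 set \<Rightarrow> ('m::complex_vector \<Rightarrow> 'h \<Rightarrow> 'm) \<Rightarrow> bool"
  where "right_module_on K act \<longleftrightarrow> bilinear_on UNIV K act \<and> (\<forall>m. act m 1 = m) \<and>
    (\<forall>m. \<forall>g\<in>K. \<forall>h\<in>K. act m (g * h) = act (act m g) h)"

definition left_comodule_on ::
  "'h::complex_vector set \<Rightarrow> ('h \<Rightarrow> ('h, 'h) tensor) \<Rightarrow> ('h \<Rightarrow> complex)
    \<Rightarrow> ('m::complex_vector \<Rightarrow> ('h, 'm) tensor) \<Rightarrow> bool"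
  where "left_comodule_on K \<Delta> \<epsilon> coact \<longleftrightarrow> clinear coact \<and>
    (\<forall>m. coact m \<in> tensor_space K UNIV) \<and>
    (\<forall>m. tensor_lift (\<lambda>h m'. tensor_lift (\<lambda>a b. a \<otimes> (b \<otimes> m')) (\<Delta> h)) (coact m)
      = tensor_lift (\<lambda>h m'. h \<otimes> coact m') (coact m)) \<and>
    (\<forall>m. tensor_lift (\<lambda>h m'. \<epsilon> h *\<^sub>C m') (coact m) = m)"

text \<open>
  In the third conjunct \<open>\<Delta> h = \<Sum> g \<otimes> h\<^sub>3\<close> and \<open>\<Delta> g = \<Sum> h\<^sub>1 \<otimes> h\<^sub>2\<close>, so \<open>h\<^sub>1\<close>, \<open>h\<^sub>2\<close>,
  \<open>h\<^sub>3\<close> are the three Sweedler components of \<open>h\<close>; \<open>x\<close> and \<open>m'\<close> are the components of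
  the coaction of \<open>m\<close>.
\<close>

definition sayd_module_on ::
  "'h::complex_algebra_1 set \<Rightarrow> ('h \<Rightarrow> ('h, 'h) tensor) \<Rightarrow> ('h \<Rightarrow> complex) \<Rightarrow> ('h \<Rightarrow> 'h)
    \<Rightarrow> ('m::complex_vector \<Rightarrow> 'h \<Rightarrow> 'm) \<Rightarrow> ('m \<Rightarrow> ('h, 'm) tensor) \<Rightarrow> bool"
  where "sayd_module_on K \<Delta> \<epsilon> S act coact \<longleftrightarrow>
    right_module_on K act \<and>
    left_comodule_on K \<Delta> \<epsilon> coact \<and>
    (\<forall>m. \<forall>h\<in>K. coact (act m h) =
      tensor_lift_on K K (\<lambda>g h\<^sub>3. tensor_lift_on K K (\<lambda>h\<^sub>1 h\<^sub>2.
        tensor_lift_on K UNIV (\<lambda>x m'. (S h\<^sub>3 * x * h\<^sub>1) \<otimes> act m' h\<^sub>2) (coact m)) (\<Delta> g)) (\<Delta> h)) \<and>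
    (\<forall>m. tensor_lift_on K UNIV (\<lambda>x m'. act m' x) (coact m) = m)"


section \<open>Quotient spaces\<close>

text \<open>
  Elements of a quotient by a subspace \<open>U\<close> are cosets \<open>x +o U\<close>, and their sum is the
  sum of sets. \<open>induced U' D\<close> is the map on cosets induced by \<open>D\<close>, with target the
  quotient by \<open>U'\<close>. If \<open>D\<close> does not map \<open>U\<close> into \<open>U'\<close>, then \<open>induced U' D U\<close> is not a
  coset of \<open>U'\<close>.
\<close>

definition quotient_space :: "'a::complex_vector set \<Rightarrow> 'a set \<Rightarrow> 'a set set"
  where "quotient_space A U = (\<lambda>x. x +o U) ` A"

definition induced ::
  "'b::complex_vector set \<Rightarrow> ('a::complex_vector \<Rightarrow> 'b) \<Rightarrow> 'a set \<Rightarrow> 'b set"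
  where "induced U' D X = D ` X + U'"

definition coset_scale :: "'a::complex_vector set \<Rightarrow> complex \<Rightarrow> 'a set \<Rightarrow> 'a set"
  where "coset_scale U c = induced U (scaleC c)"

text \<open>
  The extension of a bilinear coset-valued map \<open>f\<close> to a tensor \<open>t\<close>. The union runs over all
  ways to write \<open>t\<close> as a finite sum of pure tensors, so it is a coset only if they all
  give the same value.
\<close>

definition coset_tensor_lift ::
  "'c::complex_vector set \<Rightarrow> ('a::complex_vector \<Rightarrow> 'b::complex_vector \<Rightarrow> 'c set)
    \<Rightarrow> ('a, 'b) tensor \<Rightarrow> 'c set"
  where "coset_tensor_lift U f t =
    (\<Union>p\<in>{p. abs_tensor p = t}.
      (\<Sum>(a, b)\<in>Poly_Mapping.keys p. coset_scale U (Poly_Mapping.lookup p (a, b)) (f a b)) + U)"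


section \<open>The balanced tensor products and their operators\<close>

text \<open>
  The iterated coproduct \<open>h \<mapsto> h\<^sub>(\<^sub>1\<^sub>) \<otimes> \<dots> \<otimes> h\<^sub>(\<^sub>n\<^sub>)\<close> with values in the \<open>n\<close>-th tensor power;
  the case \<open>n = 1\<close> is the identity by the counit axiom.
\<close>

primrec iter_comult ::
  "('h::complex_vector \<Rightarrow> ('h, 'h) tensor) \<Rightarrow> ('h \<Rightarrow> complex) \<Rightarrow> nat \<Rightarrow> 'h \<Rightarrow> 'h tpow"
  where
    "iter_comult \<Delta> \<epsilon> 0 h = \<epsilon> h *\<^sub>C tpow_pure []"
  | "iter_comult \<Delta> \<epsilon> (Suc n) h = tensor_lift (\<lambda>a b. tpow_cons a (iter_comult \<Delta> \<epsilon> n b)) (\<Delta> h)"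

text \<open>
  The kernel of the projection from the tensor product over the complex numbers of \<open>N\<close> and
  the \<open>n\<close>-th tensor power of \<open>H\<close> onto the tensor product over \<open>H\<close>.
\<close>

definition balancing ::
  "('h::complex_algebra_1 \<Rightarrow> ('h, 'h) tensor) \<Rightarrow> ('h \<Rightarrow> complex)
    \<Rightarrow> ('n::complex_vector \<Rightarrow> 'h \<Rightarrow> 'n) \<Rightarrow> nat \<Rightarrow> ('n, 'h tpow) tensor set"
  where "balancing \<Delta> \<epsilon> act n =
    cspan {act m h \<otimes> w - m \<otimes> tpow_mult (iter_comult \<Delta> \<epsilon> n h) w |m h w. w \<in> tpow_space n}"

definition balanced_tensor ::
  "('h::complex_algebra_1 \<Rightarrow> ('h, 'h) tensor) \<Rightarrow> ('h \<Rightarrow> complex)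
    \<Rightarrow> ('n::complex_vector \<Rightarrow> 'h \<Rightarrow> 'n) \<Rightarrow> nat \<Rightarrow> ('n, 'h tpow) tensor set set"
  where "balanced_tensor \<Delta> \<epsilon> act n =
    quotient_space (tensor_space UNIV (tpow_space n)) (balancing \<Delta> \<epsilon> act n)"

text \<open>
  The linear map given by \<open>g\<close> on the pure tensors \<open>m \<otimes> h\<^sub>1 \<otimes> \<dots> \<otimes> h\<^sub>n\<close> of the fixed
  degree \<open>n\<close>, and by \<open>0\<close> in all other degrees.
\<close>

definition degree_lift ::
  "nat \<Rightarrow> ('n::complex_vector \<Rightarrow> 'h::complex_vector list \<Rightarrow> 'c::complex_vector)
    \<Rightarrow> ('n, 'h tpow) tensor \<Rightarrow> 'c"
  where "degree_lift n g =
    tensor_lift (\<lambda>m. tpow_lift (\<lambda>hs. if length hs = n then g m hs else 0))"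

text \<open>
  The maps \<open>_pre\<close> live on the tensor product over the complex numbers of \<open>N\<close> and the
  \<open>(q + 1)\<close>-st tensor power of \<open>H\<close>, with factors \<open>h\<^sup>0 \<otimes> \<dots> \<otimes> h\<^sup>q\<close>; the operators on the
  balanced tensor products are the maps that they induce on cosets.
\<close>

definition coface_pre ::
  "('h::complex_vector \<Rightarrow> ('h, 'h) tensor) \<Rightarrow> nat \<Rightarrow> nat
    \<Rightarrow> ('n::complex_vector, 'h tpow) tensor \<Rightarrow> ('n, 'h tpow) tensor"
  where "coface_pre \<Delta> q i = degree_lift (Suc q) (\<lambda>m hs.
    tensor_lift (\<lambda>a b. m \<otimes> tpow_pure (take i hs @ [a, b] @ drop (Suc i) hs)) (\<Delta> (hs ! i)))"

definition last_coface_pre ::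
  "('h::complex_algebra_1 \<Rightarrow> ('h, 'h) tensor) \<Rightarrow> ('n::complex_vector \<Rightarrow> ('h, 'n) tensor) \<Rightarrow> nat
    \<Rightarrow> ('n, 'h tpow) tensor \<Rightarrow> ('n, 'h tpow) tensor"
  where "last_coface_pre \<Delta> coact q = degree_lift (Suc q) (\<lambda>m hs.
    tensor_lift (\<lambda>a b. tensor_lift (\<lambda>x m'. m' \<otimes> tpow_pure (b # tl hs @ [x * a])) (coact m))
      (\<Delta> (hd hs)))"

definition codegeneracy_pre ::
  "('h::complex_vector \<Rightarrow> complex) \<Rightarrow> nat \<Rightarrow> nat
    \<Rightarrow> ('n::complex_vector, 'h tpow) tensor \<Rightarrow> ('n, 'h tpow) tensor"
  where "codegeneracy_pre \<epsilon> q j = degree_lift (Suc q) (\<lambda>m hs.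
    \<epsilon> (hs ! Suc j) *\<^sub>C (m \<otimes> tpow_pure (take (Suc j) hs @ drop (Suc (Suc j)) hs)))"

definition cyclic_pre ::
  "('n::complex_vector \<Rightarrow> ('h::complex_algebra_1, 'n) tensor) \<Rightarrow> nat
    \<Rightarrow> ('n, 'h tpow) tensor \<Rightarrow> ('n, 'h tpow) tensor"
  where "cyclic_pre coact q = degree_lift (Suc q) (\<lambda>m hs.
    tensor_lift (\<lambda>x m'. m' \<otimes> tpow_pure (tl hs @ [x * hd hs])) (coact m))"

definition diag_right_pre ::
  "('h::complex_algebra_1 \<Rightarrow> ('h, 'h) tensor) \<Rightarrow> ('h \<Rightarrow> complex) \<Rightarrow> nat \<Rightarrow> 'h
    \<Rightarrow> ('n::complex_vector, 'h tpow) tensor \<Rightarrow> ('n, 'h tpow) tensor"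
  where "diag_right_pre \<Delta> \<epsilon> q u = degree_lift (Suc q) (\<lambda>m hs.
    m \<otimes> tpow_mult (tpow_pure hs) (iter_comult \<Delta> \<epsilon> (Suc q) u))"

definition last_right_pre ::
  "nat \<Rightarrow> 'h::complex_algebra_1 \<Rightarrow> ('n::complex_vector, 'h tpow) tensor \<Rightarrow> ('n, 'h tpow) tensor"
  where "last_right_pre q u = degree_lift (Suc q) (\<lambda>m hs.
    m \<otimes> tpow_pure (butlast hs @ [last hs * u]))"


section \<open>The cochains and their cocyclic structure\<close>

definition cochains ::
  "('h::complex_algebra_1 \<Rightarrow> ('h, 'h) tensor) \<Rightarrow> ('h \<Rightarrow> complex) \<Rightarrow> 'h set
    \<Rightarrow> ('v::complex_vector \<Rightarrow> 'h \<Rightarrow> 'v) \<Rightarrow> ('n::complex_vector \<Rightarrow> 'h \<Rightarrow> 'n)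
    \<Rightarrow> nat \<Rightarrow> ('v \<Rightarrow> ('n, 'h tpow) tensor set) set"
  where "cochains \<Delta> \<epsilon> K actV actN q = {\<phi>.
    (\<forall>v. \<phi> v \<in> balanced_tensor \<Delta> \<epsilon> actN (Suc q)) \<and>
    (\<forall>v w. \<phi> (v + w) = \<phi> v + \<phi> w) \<and>
    (\<forall>c v. \<phi> (c *\<^sub>C v) = coset_scale (balancing \<Delta> \<epsilon> actN (Suc q)) c (\<phi> v)) \<and>
    (\<forall>v. \<forall>u\<in>K. \<phi> (actV v u) =
      induced (balancing \<Delta> \<epsilon> actN (Suc q)) (diag_right_pre \<Delta> \<epsilon> q u) (\<phi> v))}"

definition cochain_add :: "('v \<Rightarrow> 'a::complex_vector set) \<Rightarrow> ('v \<Rightarrow> 'a set) \<Rightarrow> ('v \<Rightarrow> 'a set)"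
  where "cochain_add \<phi> \<psi> = (\<lambda>v. \<phi> v + \<psi> v)"

definition cochain_scale ::
  "('h::complex_algebra_1 \<Rightarrow> ('h, 'h) tensor) \<Rightarrow> ('h \<Rightarrow> complex)
    \<Rightarrow> ('n::complex_vector \<Rightarrow> 'h \<Rightarrow> 'n) \<Rightarrow> nat \<Rightarrow> complex
    \<Rightarrow> ('v \<Rightarrow> ('n, 'h tpow) tensor set) \<Rightarrow> ('v \<Rightarrow> ('n, 'h tpow) tensor set)"
  where "cochain_scale \<Delta> \<epsilon> actN q c \<phi> =
    (\<lambda>v. coset_scale (balancing \<Delta> \<epsilon> actN (Suc q)) c (\<phi> v))"

definition coface ::
  "('h::complex_algebra_1 \<Rightarrow> ('h, 'h) tensor) \<Rightarrow> ('h \<Rightarrow> complex) \<Rightarrow> ('h \<Rightarrow> 'h)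
    \<Rightarrow> ('v::complex_vector \<Rightarrow> ('h, 'v) tensor)
    \<Rightarrow> ('n::complex_vector \<Rightarrow> 'h \<Rightarrow> 'n) \<Rightarrow> ('n \<Rightarrow> ('h, 'n) tensor) \<Rightarrow> nat \<Rightarrow> nat
    \<Rightarrow> ('v \<Rightarrow> ('n, 'h tpow) tensor set) \<Rightarrow> ('v \<Rightarrow> ('n, 'h tpow) tensor set)"
  where "coface \<Delta> \<epsilon> S coactV actN coactN q i \<phi> =
    (let U = balancing \<Delta> \<epsilon> actN (Suc (Suc q)) in
      if i \<le> q then (\<lambda>v. induced U (coface_pre \<Delta> q i) (\<phi> v))
      else (\<lambda>v. coset_tensor_lift U
        (\<lambda>k v'. induced U (last_right_pre (Suc q) (S k))
          (induced U (last_coface_pre \<Delta> coactN q) (\<phi> v'))) (coactV v)))"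

definition codegeneracy ::
  "('h::complex_algebra_1 \<Rightarrow> ('h, 'h) tensor) \<Rightarrow> ('h \<Rightarrow> complex)
    \<Rightarrow> ('n::complex_vector \<Rightarrow> 'h \<Rightarrow> 'n) \<Rightarrow> nat \<Rightarrow> nat
    \<Rightarrow> ('v \<Rightarrow> ('n, 'h tpow) tensor set) \<Rightarrow> ('v \<Rightarrow> ('n, 'h tpow) tensor set)"
  where "codegeneracy \<Delta> \<epsilon> actN q j \<phi> =
    (\<lambda>v. induced (balancing \<Delta> \<epsilon> actN q) (codegeneracy_pre \<epsilon> q j) (\<phi> v))"

definition cyclic_op ::
  "('h::complex_algebra_1 \<Rightarrow> ('h, 'h) tensor) \<Rightarrow> ('h \<Rightarrow> complex) \<Rightarrow> ('h \<Rightarrow> 'h)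
    \<Rightarrow> ('v::complex_vector \<Rightarrow> ('h, 'v) tensor)
    \<Rightarrow> ('n::complex_vector \<Rightarrow> 'h \<Rightarrow> 'n) \<Rightarrow> ('n \<Rightarrow> ('h, 'n) tensor) \<Rightarrow> nat
    \<Rightarrow> ('v \<Rightarrow> ('n, 'h tpow) tensor set) \<Rightarrow> ('v \<Rightarrow> ('n, 'h tpow) tensor set)"
  where "cyclic_op \<Delta> \<epsilon> S coactV actN coactN q \<phi> =
    (let U = balancing \<Delta> \<epsilon> actN (Suc q) in
      (\<lambda>v. coset_tensor_lift U
        (\<lambda>k v'. induced U (last_right_pre q (S k))
          (induced U (cyclic_pre coactN q) (\<phi> v'))) (coactV v)))"

text \<open>Vector spaces with an explicit carrier and operations.\<close>

definition complex_space ::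
  "'a set \<Rightarrow> ('a \<Rightarrow> 'a \<Rightarrow> 'a) \<Rightarrow> (complex \<Rightarrow> 'a \<Rightarrow> 'a) \<Rightarrow> bool"
  where "complex_space C add scl \<longleftrightarrow>
    (\<forall>x\<in>C. \<forall>y\<in>C. add x y \<in> C) \<and> (\<forall>c. \<forall>x\<in>C. scl c x \<in> C) \<and>
    (\<forall>x\<in>C. \<forall>y\<in>C. \<forall>z\<in>C. add (add x y) z = add x (add y z)) \<and>
    (\<forall>x\<in>C. \<forall>y\<in>C. add x y = add y x) \<and>
    (\<exists>z\<in>C. \<forall>x\<in>C. add z x = x \<and> (\<exists>y\<in>C. add x y = z)) \<and>
    (\<forall>c. \<forall>x\<in>C. \<forall>y\<in>C. scl c (add x y) = add (scl c x) (scl c y)) \<and>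
    (\<forall>c d. \<forall>x\<in>C. scl (c + d) x = add (scl c x) (scl d x)) \<and>
    (\<forall>c d. \<forall>x\<in>C. scl c (scl d x) = scl (c * d) x) \<and>
    (\<forall>x\<in>C. scl 1 x = x)"

definition complex_linear_map ::
  "'a set \<Rightarrow> ('a \<Rightarrow> 'a \<Rightarrow> 'a) \<Rightarrow> (complex \<Rightarrow> 'a \<Rightarrow> 'a)
    \<Rightarrow> 'b set \<Rightarrow> ('b \<Rightarrow> 'b \<Rightarrow> 'b) \<Rightarrow> (complex \<Rightarrow> 'b \<Rightarrow> 'b) \<Rightarrow> ('a \<Rightarrow> 'b) \<Rightarrow> bool"
  where "complex_linear_map C add scl C' add' scl' f \<longleftrightarrow>
    (\<forall>x\<in>C. f x \<in> C') \<and>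
    (\<forall>x\<in>C. \<forall>y\<in>C. f (add x y) = add' (f x) (f y)) \<and>
    (\<forall>c. \<forall>x\<in>C. f (scl c x) = scl' c (f x))"

text \<open>
  \<open>d q i\<close>, \<open>s q j\<close> and \<open>t q\<close> are the cofaces, codegeneracies and the cyclic operator with
  domain \<open>C q\<close>.
\<close>

locale cocyclic_module =
  fixes C :: "nat \<Rightarrow> 'a set"
    and add :: "nat \<Rightarrow> 'a \<Rightarrow> 'a \<Rightarrow> 'a"
    and scl :: "nat \<Rightarrow> complex \<Rightarrow> 'a \<Rightarrow> 'a"
    and d :: "nat \<Rightarrow> nat \<Rightarrow> 'a \<Rightarrow> 'a"
    and s :: "nat \<Rightarrow> nat \<Rightarrow> 'a \<Rightarrow> 'a"
    and t :: "nat \<Rightarrow> 'a \<Rightarrow> 'a"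
  assumes space: "complex_space (C q) (add q) (scl q)"
    and coface_map: "i \<le> q + 1 \<Longrightarrow> complex_linear_map (C q) (add q) (scl q)
      (C (q + 1)) (add (q + 1)) (scl (q + 1)) (d q i)"
    and codegeneracy_map: "j < q \<Longrightarrow> complex_linear_map (C q) (add q) (scl q)
      (C (q - 1)) (add (q - 1)) (scl (q - 1)) (s q j)"
    and cyclic_map: "complex_linear_map (C q) (add q) (scl q) (C q) (add q) (scl q) (t q)"
    and d_d: "x \<in> C q \<Longrightarrow> i < j \<Longrightarrow> j \<le> q + 2 \<Longrightarrow>
      d (q + 1) j (d q i x) = d (q + 1) i (d q (j - 1) x)"
    and s_s: "x \<in> C q \<Longrightarrow> i \<le> j \<Longrightarrow> j + 2 \<le> q \<Longrightarrow>
      s (q - 1) j (s q i x) = s (q - 1) i (s q (j + 1) x)"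
    and s_d_less: "x \<in> C q \<Longrightarrow> i < j \<Longrightarrow> j \<le> q \<Longrightarrow>
      s (q + 1) j (d q i x) = d (q - 1) i (s q (j - 1) x)"
    and s_d_id: "x \<in> C q \<Longrightarrow> j \<le> q \<Longrightarrow> i = j \<or> i = j + 1 \<Longrightarrow> s (q + 1) j (d q i x) = x"
    and s_d_greater: "x \<in> C q \<Longrightarrow> j + 1 < i \<Longrightarrow> i \<le> q + 1 \<Longrightarrow>
      s (q + 1) j (d q i x) = d (q - 1) (i - 1) (s q j x)"
    and t_d: "x \<in> C q \<Longrightarrow> 1 \<le> i \<Longrightarrow> i \<le> q + 1 \<Longrightarrow> t (q + 1) (d q i x) = d q (i - 1) (t q x)"
    and t_d_zero: "x \<in> C q \<Longrightarrow> t (q + 1) (d q 0 x) = d q (q + 1) x"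
    and t_s: "x \<in> C q \<Longrightarrow> 1 \<le> i \<Longrightarrow> i < q \<Longrightarrow> t (q - 1) (s q i x) = s q (i - 1) (t q x)"
    and t_s_zero: "x \<in> C q \<Longrightarrow> 1 \<le> q \<Longrightarrow> t (q - 1) (s q 0 x) = s q (q - 1) (t q (t q x))"
    and t_power: "x \<in> C q \<Longrightarrow> (t q ^^ (q + 1)) x = x"

end

theory Submission
  imports Defs
begin

text \<open>
  A cochain is represented by a linear map \<open>r\<close> from \<open>V\<close> to the tensor product over the complex
  numbers, and \<open>t\<close> becomes \<open>r \<mapsto> (v \<mapsto> w (v\<^bsub>(-1)\<^esub>) (r v\<^bsub>(0)\<^esub>))\<close>, where \<open>w k\<close> is the untwisted cyclic operator
  followed by right multiplication of the last factor by \<open>S k\<close>. Since \<open>d\<^sub>q\<^sub>+\<^sub>1 = t d\<^sub>0\<close>, all relations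
  follow from those between \<open>t\<close> and the \<open>d\<^sub>i\<close>, \<open>s\<^sub>j\<close> with \<open>i \<le> q\<close>, together with \<open>t\<^sup>2 d\<^sub>0 = d\<^sub>q t\<close>; apart from
  \<open>t\<^sup>q\<^sup>+\<^sup>1 = id\<close> they hold before passing to the quotient. The power \<open>t\<^sup>q\<^sup>+\<^sup>1\<close> multiplies by the iterated
  coproduct of the coaction of \<open>N\<close> on the left, which stability of \<open>N\<close> removes, and by that of
  \<open>S v\<^bsub>(-1)\<^esub>\<close> on the right, so that it sends \<open>\<phi>\<close> to \<open>v \<mapsto> \<phi> (v\<^bsub>(0)\<^esub> S v\<^bsub>(-1)\<^esub>)\<close>. Stability of \<open>V\<close> and
  cocommutativity of \<open>K\<close> give \<open>v\<^bsub>(0)\<^esub> S v\<^bsub>(-1)\<^esub> = v\<close>.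
\<close>

section \<open>Linear and multilinear maps\<close>

text \<open>The main obstacle is well-definedness. The untwisted operator descends to the quotient
  by the anti-Yetter-Drinfeld condition on N: the coaction of m h produces S(h_3) x h_1, and once
  h_2 is moved across the tensor, its last component cancels against S(h_3). Preservation of
  K-equivariance is a separate matter: rotating the factors rotates the components of u, which
  cocommutativity of K repairs, and the element S(u_3) x u_1 in the coaction of v u is absorbed with
  S^2 = id on K, again by cocommutativity. This concerns the whole sum over the coaction of V rather
  than one fixed k. These computations, and the powers of t, require S to reverse products and
  coproducts, so both facts are derived from the axioms. Linear representatives exist because a
  coset-valued linear map lifts along a complement of the balancing subspace. Composites of t with
  itself are controlled by coassociativity of the coaction of V, which joins successive twists into
  the components of one element.\<close>

lemma clinear_iff:
  "clinear f \<longleftrightarrow> (\<forall>x y. f (x + y) = f x + f y) \<and> (\<forall>c x. f (c *\<^sub>C x) = c *\<^sub>C f x)"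
proof
  assume "clinear f"
  then interpret Vector_Spaces.linear scaleC scaleC f .
  show "(\<forall>x y. f (x + y) = f x + f y) \<and> (\<forall>c x. f (c *\<^sub>C x) = c *\<^sub>C f x)"
    by (simp add: add scale)
next
  assume "(\<forall>x y. f (x + y) = f x + f y) \<and> (\<forall>c x. f (c *\<^sub>C x) = c *\<^sub>C f x)"
  then show "clinear f"
    by unfold_locales auto
qed

lemma clinear_add: "clinear f \<Longrightarrow> f (x + y) = f x + f y"
  and clinear_scaleC: "clinear f \<Longrightarrow> f (c *\<^sub>C x) = c *\<^sub>C f x"
  by (simp_all add: clinear_iff)

lemma clinear_0: "clinear f \<Longrightarrow> f 0 = 0"
  by (metis clinear_add add_cancel_right_left)

lemma clinear_uminus: "clinear f \<Longrightarrow> f (- x) = - f x"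
  by (metis clinear_add clinear_0 add.right_inverse minus_unique)

lemma clinear_diff: "clinear f \<Longrightarrow> f (x - y) = f x - f y"
  by (metis clinear_add clinear_uminus diff_conv_add_uminus)

lemma clinear_sum: "clinear f \<Longrightarrow> f (sum g A) = (\<Sum>x\<in>A. f (g x))"
  by (induction A rule: infinite_finite_induct) (simp_all add: clinear_0 clinear_add)

lemma clinear_eq_on_span:
  assumes "clinear f" "clinear g" "x \<in> cspan A" "\<And>a. a \<in> A \<Longrightarrow> f a = g a"
  shows "f x = g x"
  using assms(3)
  by (induction rule: complex_vector.span_induct_alt)
    (simp_all add: clinear_0[OF assms(1)] clinear_0[OF assms(2)] clinear_add[OF assms(1)]
      clinear_add[OF assms(2)] clinear_scaleC[OF assms(1)] clinear_scaleC[OF assms(2)] assms(4))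

lemma clinear_span_in_subspace:
  assumes "clinear f" "csubspace U" "x \<in> cspan A" "\<And>a. a \<in> A \<Longrightarrow> f a \<in> U"
  shows "f x \<in> U"
  using assms(3)
  by (induction rule: complex_vector.span_induct_alt)
    (auto simp: clinear_0[OF assms(1)] clinear_add[OF assms(1)] clinear_scaleC[OF assms(1)]
      assms(2,4) complex_vector.subspace_0 complex_vector.subspace_add
      complex_vector.subspace_scale)

text \<open>Linearity in one variable of a nested Sweedler expression is proved by
  \<open>intro\<close> with these rules, which follow the syntax of the expression down to the
  variable.\<close>

named_theorems linear_intros

lemma clinear_id [linear_intros]: "clinear (\<lambda>x. x)"
  by (simp add: clinear_iff)

lemma clinear_plus [linear_intros]:
  "clinear f \<Longrightarrow> clinear g \<Longrightarrow> clinear (\<lambda>x. f x + g x)"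
  by (simp add: clinear_iff scaleC_add_right algebra_simps)

lemma clinear_minus [linear_intros]:
  "clinear f \<Longrightarrow> clinear g \<Longrightarrow> clinear (\<lambda>x. f x - g x)"
  by (simp add: clinear_iff complex_vector.scale_right_diff_distrib algebra_simps)

lemma clinear_scale_right [linear_intros]: "clinear g \<Longrightarrow> clinear (\<lambda>x. c *\<^sub>C g x)"
  by (simp add: clinear_iff scaleC_add_right scaleC_scaleC mult.commute)

lemma clinear_scale_left [linear_intros]: "clinear g \<Longrightarrow> clinear (\<lambda>x. g x *\<^sub>C y)"
  by (simp add: clinear_iff scaleC_add_left scaleC_scaleC scaleC_complex_def)

lemma clinear_mult_right [linear_intros]: "clinear g \<Longrightarrow> clinear (\<lambda>x. b * g x)"
  for b :: "'a::complex_algebra_1"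
  by (simp add: clinear_iff distrib_left mult_scaleC_right)

lemma clinear_mult_left [linear_intros]: "clinear g \<Longrightarrow> clinear (\<lambda>x. g x * b)"
  for b :: "'a::complex_algebra_1"
  by (simp add: clinear_iff distrib_right mult_scaleC_left)

lemma clinear_compose: "clinear f \<Longrightarrow> clinear g \<Longrightarrow> clinear (\<lambda>x. f (g x))"
  by (simp add: clinear_iff)

abbreviation bilinear :: "('a::complex_vector \<Rightarrow> 'b::complex_vector \<Rightarrow> 'c::complex_vector) \<Rightarrow> bool"
  where "bilinear \<equiv> bilinear_on UNIV UNIV"

lemma bilinear_iff: "bilinear F \<longleftrightarrow> (\<forall>b. clinear (\<lambda>a. F a b)) \<and> (\<forall>a. clinear (F a))"
  by (auto simp: bilinear_on_def clinear_iff)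

lemma bilinearI [linear_intros]:
  "(\<And>b. clinear (\<lambda>a. F a b)) \<Longrightarrow> (\<And>a. clinear (\<lambda>b. F a b)) \<Longrightarrow> bilinear F"
  by (simp add: bilinear_iff)

text \<open>
  The representative of \<open>t\<close> that \<open>tensor_lift F t\<close> uses does not depend on \<open>F\<close>, so
  \<open>tensor_lift F t\<close> is linear in \<open>F\<close> without any hypothesis on \<open>F\<close>. The same holds for
  \<open>tpow_lift\<close>. This removes almost all bilinearity side conditions.
\<close>

definition tensor_rep :: "('a::complex_vector, 'b::complex_vector) tensor \<Rightarrow> 'a \<times> 'b \<Rightarrow>\<^sub>0 complex"
  where "tensor_rep t = (SOME p. abs_tensor p = t \<and> Poly_Mapping.keys p \<subseteq> UNIV \<times> UNIV)"

lemma tensor_lift_eq_sum: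
  "tensor_lift F t = (\<Sum>k\<in>Poly_Mapping.keys (tensor_rep t).
    Poly_Mapping.lookup (tensor_rep t) k *\<^sub>C F (fst k) (snd k))"
  by (simp add: tensor_lift_on_def tensor_rep_def free_lift_def case_prod_unfold)

lemma clinear_tensor_lift_commute:
  "clinear L \<Longrightarrow> L (tensor_lift F t) = tensor_lift (\<lambda>a b. L (F a b)) t"
  by (simp add: tensor_lift_eq_sum clinear_sum clinear_scaleC)

lemma clinear_tensor_lift_param [linear_intros]:
  assumes "\<And>a b. clinear (\<lambda>x. F x a b)"
  shows "clinear (\<lambda>x. tensor_lift (F x) t)"
  using assms unfolding clinear_iff tensor_lift_eq_sum
  by (auto simp: scaleC_add_right sum.distrib complex_vector.scale_sum_right
      scaleC_scaleC mult.commute)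

lemma tensor_lift_swap:
  "tensor_lift (\<lambda>a b. tensor_lift (\<lambda>c d. F a b c d) s) t
    = tensor_lift (\<lambda>c d. tensor_lift (\<lambda>a b. F a b c d) t) s"
proof -
  have "tensor_lift (\<lambda>a b. tensor_lift (\<lambda>c d. F a b c d) s) t
    = (\<Sum>k\<in>Poly_Mapping.keys (tensor_rep t). \<Sum>l\<in>Poly_Mapping.keys (tensor_rep s).
      Poly_Mapping.lookup (tensor_rep t) k *\<^sub>C Poly_Mapping.lookup (tensor_rep s) l *\<^sub>C
        F (fst k) (snd k) (fst l) (snd l))"
    by (simp add: tensor_lift_eq_sum complex_vector.scale_sum_right)
  also have "\<dots> = (\<Sum>l\<in>Poly_Mapping.keys (tensor_rep s). \<Sum>k\<in>Poly_Mapping.keys (tensor_rep t).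
      Poly_Mapping.lookup (tensor_rep s) l *\<^sub>C Poly_Mapping.lookup (tensor_rep t) k *\<^sub>C
        F (fst k) (snd k) (fst l) (snd l))"
    by (subst sum.swap) (simp add: scaleC_scaleC mult.commute)
  also have "\<dots> = tensor_lift (\<lambda>c d. tensor_lift (\<lambda>a b. F a b c d) t) s"
    by (simp add: tensor_lift_eq_sum complex_vector.scale_sum_right)
  finally show ?thesis .
qed

section \<open>Pure tensors and maps out of a tensor product\<close>

lemma tensor_cases:
  obtains p where "t = abs_tensor p"
  using Quotient3_abs_rep[OF Quotient3_tensor] by metis

lemma tpow_cases:
  obtains p where "t = abs_tpow p"
  using Quotient3_abs_rep[OF Quotient3_tpow] by metis

lemma bilinear_tensor_pure: "bilinear (\<otimes>)"
proof -
  have *: "r \<in> tensor_relators \<Longrightarrow> abs_tensor r = 0" for r :: "'a \<times> 'b \<Rightarrow>\<^sub>0 complex"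
    unfolding zero_tensor.abs_eq tensor.abs_eq_iff tensor_eq_def
    by (simp add: complex_vector.span_base)
  have minus: "abs_tensor (p - q) = abs_tensor p - abs_tensor q"
    and scale: "abs_tensor (c *\<^sub>C p) = c *\<^sub>C abs_tensor p" for c and p q :: "'a \<times> 'b \<Rightarrow>\<^sub>0 complex"
    by (simp_all add: minus_tensor.abs_eq scaleC_tensor.abs_eq)
  have "(a + a') \<otimes> b - a \<otimes> b - a' \<otimes> b = 0" "a \<otimes> (b + b') - a \<otimes> b - a \<otimes> b' = 0"
    "(c *\<^sub>C a) \<otimes> b - c *\<^sub>C (a \<otimes> b) = 0" "a \<otimes> (c *\<^sub>C b) - c *\<^sub>C (a \<otimes> b) = 0"
    for a a' :: 'a and b b' :: 'b and c
    unfolding tensor_pure.abs_eq minus[symmetric] scale[symmetric]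
    by (rule *; unfold tensor_relators_def; blast)+
  then show ?thesis
    by (simp add: bilinear_on_def algebra_simps)
qed

lemma clinear_tensor_pure_left [linear_intros]: "clinear g \<Longrightarrow> clinear (\<lambda>x. g x \<otimes> b)"
  and clinear_tensor_pure_right [linear_intros]: "clinear h \<Longrightarrow> clinear (\<lambda>x. a \<otimes> h x)"
  using bilinear_tensor_pure[unfolded bilinear_iff] clinear_compose by blast+

lemma tensor_lift_abs: "bilinear F \<Longrightarrow> tensor_lift F (abs_tensor p) = free_lift (\<lambda>(a, b). F a b) p"
  by (simp add: tensor_lift_on_abs)

lemma tensor_lift_pure: "bilinear F \<Longrightarrow> tensor_lift F (a \<otimes> b) = F a b"
  by (simp add: tensor_lift_on_pure)

lemma clinear_tensor_lift: "bilinear F \<Longrightarrow> clinear (tensor_lift F)"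
  unfolding clinear_iff
proof (intro conjI allI)
  fix s t :: "('a, 'b) tensor" and c
  assume F: "bilinear F"
  obtain p q where "s = abs_tensor p" "t = abs_tensor q"
    by (metis tensor_cases)
  then show "tensor_lift F (s + t) = tensor_lift F s + tensor_lift F t"
    "tensor_lift F (c *\<^sub>C t) = c *\<^sub>C tensor_lift F t"
    by (simp_all add: plus_tensor.abs_eq scaleC_tensor.abs_eq tensor_lift_abs[OF F]
        free_lift_add free_lift_scaleC)
qed

lemma clinear_tensor_lift_compose [linear_intros]:
  "bilinear F \<Longrightarrow> clinear g \<Longrightarrow> clinear (\<lambda>x. tensor_lift F (g x))"
  using clinear_compose[OF clinear_tensor_lift] .

lemma clinear_abs_tensor: "clinear abs_tensor"
  by (simp add: clinear_iff plus_tensor.abs_eq scaleC_tensor.abs_eq)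

lemma poly_mapping_eq_sum_single:
  "p = (\<Sum>k\<in>Poly_Mapping.keys p. Poly_Mapping.lookup p k *\<^sub>C Poly_Mapping.single k 1)"
  for p :: "'a \<Rightarrow>\<^sub>0 complex"
proof (rule poly_mapping_eqI)
  fix k
  show "Poly_Mapping.lookup p k = Poly_Mapping.lookup
    (\<Sum>k\<in>Poly_Mapping.keys p. Poly_Mapping.lookup p k *\<^sub>C Poly_Mapping.single k 1) k"
    by (auto simp: Poly_Mapping.lookup_sum lookup_scaleC scaleC_complex_def lookup_single
        when_def in_keys_iff if_distrib cong: if_cong)
qed

lemma abs_tensor_eq_free_lift: "abs_tensor p = free_lift (\<lambda>(a, b). a \<otimes> b) p"
proof -
  have "abs_tensor p = abs_tensor (\<Sum>k\<in>Poly_Mapping.keys p.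
      Poly_Mapping.lookup p k *\<^sub>C Poly_Mapping.single k 1)"
    by (rule arg_cong[OF poly_mapping_eq_sum_single])
  then show ?thesis
    by (simp add: free_lift_def clinear_sum[OF clinear_abs_tensor]
        clinear_scaleC[OF clinear_abs_tensor] tensor_pure.abs_eq case_prod_unfold)
qed

lemma tensor_lift_tensor_pure [simp]: "tensor_lift (\<otimes>) t = t"
  by (cases t rule: tensor_cases)
    (metis tensor_lift_abs[OF bilinear_tensor_pure] abs_tensor_eq_free_lift)

lemma tensor_space_UNIV: "t \<in> tensor_space UNIV UNIV"
proof (cases t rule: tensor_cases)
  case (1 p)
  have "a \<otimes> b \<in> tensor_space UNIV UNIV" for a :: 'a and b :: 'b
    unfolding tensor_space_def by (rule complex_vector.span_base) blast
  then show ?thesis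
    unfolding 1 abs_tensor_eq_free_lift free_lift_def tensor_space_def
    by (intro complex_vector.span_sum complex_vector.span_scale) (simp add: case_prod_unfold)
qed

lemma clinear_eq_on_tensor:
  assumes "clinear f" "clinear g" "\<And>a b. f (a \<otimes> b) = g (a \<otimes> b)"
  shows "f t = g t"
  using clinear_eq_on_span[OF assms(1,2) tensor_space_UNIV[unfolded tensor_space_def]] assms(3)
  by blast

lemma tensor_lift_cong: "(\<And>a b. F a b = G a b) \<Longrightarrow> tensor_lift F t = tensor_lift G t"
  by (simp add: tensor_lift_eq_sum)

lemma tensor_lift_scaleC: "tensor_lift (\<lambda>a b. c *\<^sub>C F a b) t = c *\<^sub>C tensor_lift F t"
  by (simp add: tensor_lift_eq_sum complex_vector.scale_sum_right scaleC_scaleC mult.commute)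

lemma tensor_lift_add:
  "tensor_lift (\<lambda>a b. F a b + G a b) t = tensor_lift F t + tensor_lift G t"
  by (simp add: tensor_lift_eq_sum scaleC_add_right sum.distrib)

lemma tensor_lift_diff:
  "tensor_lift (\<lambda>a b. F a b - G a b) t = tensor_lift F t - tensor_lift G t"
  by (simp add: tensor_lift_eq_sum complex_vector.scale_right_diff_distrib sum_subtractf)

lemma tensor_lift_in_subspace:
  "csubspace U \<Longrightarrow> (\<And>a b. F a b \<in> U) \<Longrightarrow> tensor_lift F t \<in> U"
  by (simp add: tensor_lift_eq_sum complex_vector.subspace_sum complex_vector.subspace_scale)

lemma tensor_lift_sub_in:
  assumes "csubspace U" "\<And>a b. F a b - G a b \<in> U"
  shows "tensor_lift F t - tensor_lift G t \<in> U"
  unfolding tensor_lift_diff[symmetric] by (rule tensor_lift_in_subspace[OF assms])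

text \<open>The representative chosen by \<open>tensor_lift\<close> may have entries outside A and
  B, so bilinearity is what carries the claim from the pure tensors of
  \<open>tensor_space A B\<close> to t. In this way properties that hold only on K enter Sweedler
  sums.\<close>

lemma tensor_lift_in_subspace_on:
  assumes "t \<in> tensor_space A B" "bilinear F" "csubspace U"
    "\<And>a b. a \<in> A \<Longrightarrow> b \<in> B \<Longrightarrow> F a b \<in> U"
  shows "tensor_lift F t \<in> U"
  by (rule clinear_span_in_subspace[OF clinear_tensor_lift[OF assms(2)] assms(3)
        assms(1)[unfolded tensor_space_def]])
    (use assms in \<open>auto simp: tensor_lift_pure\<close>)

lemma tensor_lift_cong_on:
  assumes "t \<in> tensor_space A B" "bilinear F" "bilinear G"
    "\<And>a b. a \<in> A \<Longrightarrow> b \<in> B \<Longrightarrow> F a b = G a b"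
  shows "tensor_lift F t = tensor_lift G t"
  by (rule clinear_eq_on_span[OF clinear_tensor_lift[OF assms(2)] clinear_tensor_lift[OF assms(3)]
        assms(1)[unfolded tensor_space_def]])
    (use assms in \<open>auto simp: tensor_lift_pure\<close>)

lemma tensor_space_rep:
  assumes "t \<in> tensor_space A B" "csubspace A"
  obtains p where "abs_tensor p = t" "Poly_Mapping.keys p \<subseteq> A \<times> B"
proof -
  have "\<exists>p. abs_tensor p = t \<and> Poly_Mapping.keys p \<subseteq> A \<times> B"
    using assms(1) unfolding tensor_space_def
  proof (induction rule: complex_vector.span_induct_alt)
    case base
    show ?case by (intro exI[of _ 0]) (simp add: zero_tensor.abs_eq)
  next
    case (step c x y)
    then obtain p a b where p: "abs_tensor p = y" "Poly_Mapping.keys p \<subseteq> A \<times> B"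
      and x: "x = a \<otimes> b" "a \<in> A" "b \<in> B" by auto
    let ?q = "c *\<^sub>C Poly_Mapping.single (a, b) (1::complex)"
    have "Poly_Mapping.keys ?q \<subseteq> A \<times> B"
      using x by (auto simp: in_keys_iff lookup_scaleC lookup_single when_def split: if_splits)
    then have "Poly_Mapping.keys (?q + p) \<subseteq> A \<times> B"
      using Poly_Mapping.keys_add[of ?q p] p by blast
    moreover have "abs_tensor (?q + p) = c *\<^sub>C x + y"
      by (simp add: p x plus_tensor.abs_eq[symmetric] scaleC_tensor.abs_eq[symmetric]
          tensor_pure.abs_eq)
    ultimately show ?case by blast
  qed
  then show ?thesis using that by blast
qed

text \<open>Turns the relative lifts in the definition of a module over K into absolute ones, for
  which the calculus above is available: f may be replaced by any globally bilinear F that agrees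
  with it on A and B.\<close>

lemma tensor_lift_on_eq_tensor_lift:
  assumes "csubspace A" "csubspace B" "t \<in> tensor_space A B" "bilinear F"
    and eq: "\<And>a b. a \<in> A \<Longrightarrow> b \<in> B \<Longrightarrow> f a b = F a b"
  shows "tensor_lift_on A B f t = tensor_lift F t"
proof -
  obtain p where p: "abs_tensor p = t" "Poly_Mapping.keys p \<subseteq> A \<times> B"
    using tensor_space_rep assms by metis
  have f: "bilinear_on A B f"
    using assms(1,2,4) eq unfolding bilinear_on_def
    by (simp add: complex_vector.subspace_add complex_vector.subspace_scale)
  have "tensor_lift_on A B f t = free_lift (\<lambda>(a, b). f a b) p"
    using tensor_lift_on_abs[OF assms(1,2) f p(2)] p(1) by simp
  also have "\<dots> = free_lift (\<lambda>(a, b). F a b) p"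
    unfolding free_lift_def using p(2) eq by (intro sum.cong) auto
  also have "\<dots> = tensor_lift F t"
    using tensor_lift_abs[OF assms(4), of p] p(1) by simp
  finally show ?thesis .
qed

text \<open>Lists carry no vector space structure, so \<open>clinear\<close> cannot be asked of a
  list-valued map. This predicate replaces it and is stable under cons and append, so that
  introduction rules can find the varying entry.\<close>

definition linear_in_slot :: "('x::complex_vector \<Rightarrow> 'a::complex_vector list) \<Rightarrow> bool"
  where "linear_in_slot L \<longleftrightarrow> (\<exists>xs g ys. clinear g \<and> L = (\<lambda>x. xs @ g x # ys))"

lemma linear_in_slot_Cons1 [linear_intros]:
  "clinear g \<Longrightarrow> linear_in_slot (\<lambda>x. g x # ys)"
  unfolding linear_in_slot_def by (metis append_Nil)

lemma linear_in_slot_Cons2 [linear_intros]: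
  "linear_in_slot L \<Longrightarrow> linear_in_slot (\<lambda>x. a # L x)"
  unfolding linear_in_slot_def by (metis append_Cons)

lemma linear_in_slot_append1 [linear_intros]:
  "linear_in_slot L \<Longrightarrow> linear_in_slot (\<lambda>x. L x @ ys)"
  unfolding linear_in_slot_def by (metis append_assoc append_Cons)

lemma linear_in_slot_append2 [linear_intros]:
  "linear_in_slot L \<Longrightarrow> linear_in_slot (\<lambda>x. xs @ L x)"
  unfolding linear_in_slot_def by (metis append_assoc)

text \<open>Restricted to one length because the operators read entries such as
  \<open>hs ! i\<close> and are meaningful in a single degree only; \<open>multilinear\<close>
  demands linearity in all lengths at once.\<close>

definition multilinear_upon :: "nat \<Rightarrow> ('a::complex_vector list \<Rightarrow> 'c::complex_vector) \<Rightarrow> bool"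
  where "multilinear_upon n F \<longleftrightarrow>
    (\<forall>xs ys. Suc (length xs + length ys) = n \<longrightarrow> clinear (\<lambda>a. F (xs @ a # ys)))"

lemma multilinear_uponI [linear_intros]:
  "(\<And>xs ys. Suc (length xs + length ys) = n \<Longrightarrow> clinear (\<lambda>a. F (xs @ a # ys))) \<Longrightarrow>
    multilinear_upon n F"
  by (simp add: multilinear_upon_def)

lemma multilinear_uponD:
  "multilinear_upon n F \<Longrightarrow> Suc (length xs + length ys) = n \<Longrightarrow> clinear (\<lambda>a. F (xs @ a # ys))"
  by (simp add: multilinear_upon_def)

lemma multilinear_upon_Cons_hd:
  "multilinear_upon (Suc n) F \<Longrightarrow> length xs = n \<Longrightarrow> clinear (\<lambda>a. F (a # xs))"
  using multilinear_uponD[of "Suc n" F "[]" xs] by simp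

lemma multilinear_upon_append:
  "multilinear_upon n F \<Longrightarrow> length xs + k = n \<Longrightarrow> multilinear_upon k (\<lambda>ys. F (xs @ ys))"
proof (rule multilinear_uponI)
  fix as bs :: "'a list"
  assume "multilinear_upon n F" "length xs + k = n" "Suc (length as + length bs) = k"
  then show "clinear (\<lambda>a. F (xs @ as @ a # bs))"
    using multilinear_uponD[of n F "xs @ as" bs] by simp
qed

lemma multilinear_upon_Cons:
  "multilinear_upon (Suc n) F \<Longrightarrow> multilinear_upon n (\<lambda>xs. F (a # xs))"
  using multilinear_upon_append[of "Suc n" F "[a]" n] by simp

text \<open>The value 0 in the other degrees is what \<open>degree_lift\<close> uses, and it makes a
  map of one degree acceptable to \<open>tpow_lift\<close>.\<close>

lemma multilinear_guard:
  assumes "multilinear_upon n F"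
  shows "multilinear (\<lambda>xs. if length xs = n then F xs else 0)"
  using assms unfolding multilinear_def multilinear_upon_def clinear_iff by simp

lemma multilinear_tpow_pure: "multilinear tpow_pure"
proof -
  have *: "r \<in> tpow_relators \<Longrightarrow> abs_tpow r = 0" for r :: "'a list \<Rightarrow>\<^sub>0 complex"
    unfolding zero_tpow.abs_eq tpow.abs_eq_iff tpow_eq_def
    by (simp add: complex_vector.span_base)
  have minus: "abs_tpow (p - q) = abs_tpow p - abs_tpow q"
    and scale: "abs_tpow (c *\<^sub>C p) = c *\<^sub>C abs_tpow p" for c and p q :: "'a list \<Rightarrow>\<^sub>0 complex"
    by (simp_all add: minus_tpow.abs_eq scaleC_tpow.abs_eq)
  have "tpow_pure (xs @ (a + b) # ys) - tpow_pure (xs @ a # ys) - tpow_pure (xs @ b # ys) = 0"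
    "tpow_pure (xs @ (c *\<^sub>C a) # ys) - c *\<^sub>C tpow_pure (xs @ a # ys) = 0"
    for xs ys and a b :: 'a and c
    unfolding tpow_pure.abs_eq minus[symmetric] scale[symmetric]
    by (rule *; unfold tpow_relators_def; blast)+
  then show ?thesis
    by (simp add: multilinear_def algebra_simps)
qed

lemma clinear_tpow_pure [linear_intros]:
  fixes L :: "'x::complex_vector \<Rightarrow> 'a::complex_vector list"
  shows "linear_in_slot L \<Longrightarrow> clinear (\<lambda>x. tpow_pure (L x))"
proof -
  assume "linear_in_slot L"
  then obtain xs g ys where "clinear g" "L = (\<lambda>x. xs @ g x # ys)"
    unfolding linear_in_slot_def by blast
  then show ?thesis
    using multilinear_tpow_pure[where 'a='a] by (simp add: multilinear_def clinear_iff)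
qed

lemma clinear_tpow_lift_param [linear_intros]:
  assumes "\<And>xs. clinear (\<lambda>x. F x xs)"
  shows "clinear (\<lambda>x. tpow_lift (F x) t)"
  using assms unfolding clinear_iff tpow_lift_def free_lift_def
  by (auto simp: scaleC_add_right sum.distrib complex_vector.scale_sum_right
      scaleC_scaleC mult.commute)

lemma clinear_tpow_lift:
  assumes "multilinear F"
  shows "clinear (tpow_lift F)"
  unfolding clinear_iff
proof (intro conjI allI)
  fix s t :: "'a tpow" and c
  obtain p q where "s = abs_tpow p" "t = abs_tpow q"
    by (metis tpow_cases)
  then show "tpow_lift F (s + t) = tpow_lift F s + tpow_lift F t"
    "tpow_lift F (c *\<^sub>C t) = c *\<^sub>C tpow_lift F t"
    by (simp_all add: plus_tpow.abs_eq scaleC_tpow.abs_eq tpow_lift_abs[OF assms]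
        free_lift_add free_lift_scaleC)
qed

lemma clinear_tpow_lift_compose [linear_intros]:
  "multilinear F \<Longrightarrow> clinear g \<Longrightarrow> clinear (\<lambda>x. tpow_lift F (g x))"
  using clinear_compose[OF clinear_tpow_lift] .

section \<open>Maps of fixed degree and generators of the chain spaces\<close>

lemma degree_lift_pure:
  assumes "\<And>hs. length hs = n \<Longrightarrow> clinear (\<lambda>m. g m hs)" "\<And>m. multilinear_upon n (g m)"
    "length hs = n"
  shows "degree_lift n g (m \<otimes> tpow_pure hs) = g m hs"
proof -
  have ml: "multilinear (\<lambda>hs. if length hs = n then g m hs else 0)" for m
    by (rule multilinear_guard[OF assms(2)])
  have "bilinear (\<lambda>m. tpow_lift (\<lambda>hs. if length hs = n then g m hs else 0))"
    using assms(1) by (intro linear_intros ml) (auto simp: clinear_iff)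
  then show ?thesis
    using assms(3) by (simp add: degree_lift_def tensor_lift_pure tpow_lift_pure[OF ml])
qed

lemma clinear_degree_lift:
  assumes "\<And>hs. length hs = n \<Longrightarrow> clinear (\<lambda>m. g m hs)" "\<And>m. multilinear_upon n (g m)"
  shows "clinear (degree_lift n g)"
proof -
  have ml: "multilinear (\<lambda>hs. if length hs = n then g m hs else 0)" for m
    by (rule multilinear_guard[OF assms(2)])
  have "bilinear (\<lambda>m. tpow_lift (\<lambda>hs. if length hs = n then g m hs else 0))"
    using assms(1) by (intro linear_intros ml) (auto simp: clinear_iff)
  then show ?thesis
    unfolding degree_lift_def by (rule clinear_tensor_lift)
qed

abbreviation chain_space :: "nat \<Rightarrow> ('n::complex_vector, 'h::complex_vector tpow) tensor set"
  where "chain_space n \<equiv> tensor_space UNIV (tpow_space n)"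

lemma csubspace_tensor_space: "csubspace (tensor_space A B)"
  by (simp add: tensor_space_def)

lemma chain_space_eq_span:
  "chain_space n = cspan {m \<otimes> tpow_pure hs |m hs. length hs = n}" (is "_ = ?R")
proof
  have "m \<otimes> w \<in> ?R" if "w \<in> tpow_space n" for m :: 'a and w :: "'b tpow"
    by (rule clinear_span_in_subspace[OF clinear_tensor_pure_right[OF clinear_id]
          complex_vector.subspace_span that[unfolded tpow_space_def]])
      (auto intro: complex_vector.span_base)
  then show "chain_space n \<subseteq> ?R"
    unfolding tensor_space_def by (intro complex_vector.span_minimal) auto
  show "?R \<subseteq> chain_space n"
    unfolding tensor_space_def
    by (intro complex_vector.span_mono) (force simp: tpow_space_def intro: complex_vector.span_base)
qed

lemma pure_in_chain_space: "length hs = n \<Longrightarrow> m \<otimes> tpow_pure hs \<in> chain_space n"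
  unfolding chain_space_eq_span by (rule complex_vector.span_base) blast

lemma chain_space_eqI:
  assumes "clinear f" "clinear g" "y \<in> chain_space n"
    "\<And>m hs. length hs = n \<Longrightarrow> f (m \<otimes> tpow_pure hs) = g (m \<otimes> tpow_pure hs)"
  shows "f y = g y"
  using clinear_eq_on_span[OF assms(1,2) assms(3)[unfolded chain_space_eq_span]] assms(4) by blast

lemma chain_space_in_subspaceI:
  assumes "clinear f" "csubspace U" "y \<in> chain_space n"
    "\<And>m hs. length hs = n \<Longrightarrow> f (m \<otimes> tpow_pure hs) \<in> U"
  shows "f y \<in> U"
  using clinear_span_in_subspace[OF assms(1,2) assms(3)[unfolded chain_space_eq_span]] assms(4)
  by blast

lemma clinear_multilinear:
  assumes "multilinear_upon n F" "linear_in_slot L" "\<And>x. length (L x) = n"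
  shows "clinear (\<lambda>x. F (L x))"
proof -
  obtain xs g ys where L: "clinear g" "L = (\<lambda>x. xs @ g x # ys)"
    using assms(2) unfolding linear_in_slot_def by blast
  have "clinear (\<lambda>a. F (xs @ a # ys))"
    using assms(3) by (intro multilinear_uponD[OF assms(1)]) (simp add: L)
  from clinear_compose[OF this L(1)] show ?thesis
    by (simp add: L)
qed

section \<open>Iterated Sweedler sums\<close>

text \<open>\<open>iter_sweedler \<Delta> \<epsilon> n F h\<close> is \<open>F [h\<^sub>(\<^sub>1\<^sub>), \<dots>, h\<^sub>(\<^sub>n\<^sub>)]\<close> in Sweedler notation.\<close>

primrec iter_sweedler ::
  "('h::complex_vector \<Rightarrow> ('h, 'h) tensor) \<Rightarrow> ('h \<Rightarrow> complex) \<Rightarrow> nat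
    \<Rightarrow> ('h list \<Rightarrow> 'c::complex_vector) \<Rightarrow> 'h \<Rightarrow> 'c"
  where
    "iter_sweedler \<Delta> \<epsilon> 0 F h = \<epsilon> h *\<^sub>C F []"
  | "iter_sweedler \<Delta> \<epsilon> (Suc n) F h =
      tensor_lift (\<lambda>a b. iter_sweedler \<Delta> \<epsilon> n (\<lambda>xs. F (a # xs)) b) (\<Delta> h)"

lemma iter_sweedler_cong:
  "(\<And>xs. length xs = n \<Longrightarrow> F xs = G xs) \<Longrightarrow> iter_sweedler \<Delta> \<epsilon> n F h = iter_sweedler \<Delta> \<epsilon> n G h"
proof (induction n arbitrary: F G h)
  case (Suc n)
  have "iter_sweedler \<Delta> \<epsilon> n (\<lambda>xs. F (a # xs)) b = iter_sweedler \<Delta> \<epsilon> n (\<lambda>xs. G (a # xs)) b" for a b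
    by (intro Suc.IH Suc.prems) simp
  then show ?case by simp
qed simp

lemma clinear_iter_sweedler_commute:
  assumes L: "clinear L"
  shows "L (iter_sweedler \<Delta> \<epsilon> n F h) = iter_sweedler \<Delta> \<epsilon> n (\<lambda>xs. L (F xs)) h"
  by (induction n arbitrary: F h)
    (simp_all add: clinear_scaleC[OF L] clinear_tensor_lift_commute[OF L])

lemma clinear_iter_sweedler_param [linear_intros]:
  "(\<And>xs. length xs = n \<Longrightarrow> clinear (\<lambda>x. F x xs)) \<Longrightarrow> clinear (\<lambda>x. iter_sweedler \<Delta> \<epsilon> n (F x) h)"
proof (induction n arbitrary: F h)
  case (Suc n)
  then show ?case
    by (auto intro!: clinear_tensor_lift_param)
qed (auto intro!: linear_intros)

lemma tensor_lift_iter_sweedler_swap: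
  "tensor_lift (\<lambda>a b. iter_sweedler \<Delta> \<epsilon> n (F a b) h) t
    = iter_sweedler \<Delta> \<epsilon> n (\<lambda>xs. tensor_lift (\<lambda>a b. F a b xs) t) h"
proof (induction n arbitrary: F h)
  case 0
  show ?case by (simp add: tensor_lift_scaleC)
next
  case (Suc n)
  show ?case by (simp add: Suc.IH[symmetric]) (rule tensor_lift_swap)
qed

lemma iter_sweedler_scaleC:
  "iter_sweedler \<Delta> \<epsilon> n (\<lambda>xs. c *\<^sub>C F xs) h = c *\<^sub>C iter_sweedler \<Delta> \<epsilon> n F h"
  by (rule clinear_iter_sweedler_commute[symmetric]) (intro linear_intros)

lemma iter_sweedler_swap:
  "iter_sweedler \<Delta> \<epsilon> m (\<lambda>xs. iter_sweedler \<Delta>' \<epsilon>' n (F xs) k) h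
    = iter_sweedler \<Delta>' \<epsilon>' n (\<lambda>ys. iter_sweedler \<Delta> \<epsilon> m (\<lambda>xs. F xs ys) h) k"
proof (induction m arbitrary: F h)
  case 0
  show ?case by (simp add: iter_sweedler_scaleC)
next
  case (Suc m)
  then show ?case by (simp add: tensor_lift_iter_sweedler_swap)
qed

lemma iter_sweedler_diff:
  "iter_sweedler \<Delta> \<epsilon> n (\<lambda>xs. F xs - G xs) h = iter_sweedler \<Delta> \<epsilon> n F h - iter_sweedler \<Delta> \<epsilon> n G h"
  by (induction n arbitrary: F G h)
    (simp_all add: complex_vector.scale_right_diff_distrib tensor_lift_diff)

lemma iter_sweedler_in_subspace:
  "csubspace U \<Longrightarrow> (\<And>xs. length xs = n \<Longrightarrow> F xs \<in> U) \<Longrightarrow> iter_sweedler \<Delta> \<epsilon> n F h \<in> U"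
proof (induction n arbitrary: F h)
  case (Suc n)
  then show ?case by (auto intro!: tensor_lift_in_subspace)
qed (simp add: complex_vector.subspace_scale)

context hopf_algebra
begin

abbreviation sw :: "nat \<Rightarrow> ('h list \<Rightarrow> 'c::complex_vector) \<Rightarrow> 'h \<Rightarrow> 'c"
  where "sw \<equiv> iter_sweedler \<Delta> \<epsilon>"

lemma clinear_comult_compose [linear_intros]: "clinear g \<Longrightarrow> clinear (\<lambda>x. \<Delta> (g x))"
  and clinear_counit_compose [linear_intros]: "clinear g' \<Longrightarrow> clinear (\<lambda>x. \<epsilon> (g' x))"
  and clinear_antipode_compose [linear_intros]: "clinear g \<Longrightarrow> clinear (\<lambda>x. S (g x))"
  using clinear_compose linear_comult linear_counit linear_antipode by blast+

lemma clinear_sw_compose [linear_intros]: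
  assumes "multilinear_upon n F" "clinear g"
  shows "clinear (\<lambda>x. sw n F (g x))"
proof -
  have "clinear (sw n F)"
    using assms(1)
  proof (induction n arbitrary: F)
    case 0
    show ?case by (simp, intro linear_intros)
  next
    case (Suc n)
    show ?case
      by (simp, intro linear_intros Suc.IH multilinear_upon_Cons[OF Suc.prems]
          multilinear_upon_Cons_hd[OF Suc.prems])
  qed
  then show ?thesis using assms(2) by (rule clinear_compose)
qed

text \<open>The axiom \<open>coassoc\<close> equates two elements of a nested tensor product.
  Applying the linear map induced by F gives the Sweedler form; linearity of F in each variable is
  what allows this map to be evaluated on pure tensors.\<close>

lemma comult_coassoc:
  assumes "\<And>b c. clinear (\<lambda>a. F a b c)" "\<And>a c. clinear (\<lambda>b. F a b c)" "\<And>a b. clinear (F a b)"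
  shows "tensor_lift (\<lambda>a b. tensor_lift (\<lambda>c d. F c d b) (\<Delta> a)) (\<Delta> h)
    = tensor_lift (\<lambda>a b. tensor_lift (\<lambda>c d. F a c d) (\<Delta> b)) (\<Delta> h)"
proof -
  have bil: "bilinear (F a)" for a
    using assms by (intro linear_intros)
  have L: "bilinear (\<lambda>a t. tensor_lift (F a) t)"
    by (intro linear_intros assms bil)
  show ?thesis
    using arg_cong[OF coassoc[of h], of "tensor_lift (\<lambda>a t. tensor_lift (F a) t)"]
    by (simp add: clinear_tensor_lift_commute[OF clinear_tensor_lift[OF L]] tensor_lift_pure[OF L]
        tensor_lift_pure[OF bil])
qed

lemma comult_counit_left: "clinear F \<Longrightarrow> tensor_lift (\<lambda>a b. \<epsilon> a *\<^sub>C F b) (\<Delta> h) = F h"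
  and comult_counit_right: "clinear F \<Longrightarrow> tensor_lift (\<lambda>a b. \<epsilon> b *\<^sub>C F a) (\<Delta> h) = F h"
  using arg_cong[OF counit_left[of h], of F] arg_cong[OF counit_right[of h], of F]
  by (simp_all add: clinear_tensor_lift_commute clinear_scaleC)

lemma comult_mult_lift:
  assumes F: "bilinear F"
  shows "tensor_lift F (\<Delta> (g * h))
    = tensor_lift (\<lambda>a b. tensor_lift (\<lambda>c d. F (a * c) (b * d)) (\<Delta> h)) (\<Delta> g)"
  by (simp add: comult_mult tensor_mult_def clinear_tensor_lift_commute[OF clinear_tensor_lift[OF F]]
      tensor_lift_pure[OF F])

text \<open>Generalised coassociativity, by induction on m. For m = 0 the left component carries
  \<epsilon> and the counit axiom removes it; in the step the induction hypothesis splits the tail,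
  and one use of coassociativity regroups the split around the head.\<close>

lemma sw_split:
  "multilinear_upon (m + n) F \<Longrightarrow>
    sw (m + n) F h = tensor_lift (\<lambda>a b. sw m (\<lambda>xs. sw n (\<lambda>ys. F (xs @ ys)) b) a) (\<Delta> h)"
proof (induction m arbitrary: F h)
  case 0
  have "clinear (sw n F)" using clinear_sw_compose[OF _ clinear_id] 0 by simp
  then show ?case by (simp add: comult_counit_left)
next
  case (Suc m)
  define G where "G a c d = sw m (\<lambda>xs. sw n (\<lambda>ys. F (a # xs @ ys)) d) c" for a c d
  have ml: "multilinear_upon (m + n) (\<lambda>xs. F (a # xs))" for a
    using Suc.prems by (intro multilinear_upon_Cons) simp
  have "sw (Suc m + n) F h = tensor_lift (\<lambda>a b. tensor_lift (\<lambda>c d. G a c d) (\<Delta> b)) (\<Delta> h)"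
    by (simp add: Suc.IH[OF ml] G_def)
  also have "\<dots> = tensor_lift (\<lambda>a b. tensor_lift (\<lambda>c d. G c d b) (\<Delta> a)) (\<Delta> h)"
    unfolding G_def
    by (rule comult_coassoc[symmetric];
        intro linear_intros clinear_multilinear[OF Suc.prems]; simp)
  finally show ?case by (simp add: G_def)
qed

text \<open>Here i components precede the one that is split and j follow it. The recursion of
  \<open>sw\<close> peels the i leading components off, which leaves coassociativity at the
  front.\<close>

lemma sw_comult_nth:
  "multilinear_upon (Suc (Suc (i + j))) F \<Longrightarrow>
    sw (Suc (i + j)) (\<lambda>zs. tensor_lift (\<lambda>a b. F (take i zs @ a # b # drop (Suc i) zs)) (\<Delta> (zs ! i))) h
      = sw (Suc (Suc (i + j))) F h"
proof (induction i arbitrary: F h)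
  case 0
  show ?case
    by (simp add: tensor_lift_iter_sweedler_swap[symmetric])
      (rule comult_coassoc; intro linear_intros clinear_multilinear[OF 0]; simp)
next
  case (Suc i)
  have "multilinear_upon (Suc (Suc (i + j))) (\<lambda>xs. F (a # xs))" for a
    using Suc.prems by (intro multilinear_upon_Cons) simp
  from Suc.IH[OF this] show ?case by (simp del: iter_sweedler.simps(2) add: iter_sweedler.simps(2)[of _ _ "Suc _"])
qed

text \<open>As for \<open>sw_comult_nth\<close>: peeling off the i leading components leaves the
  left counit axiom.\<close>

lemma sw_counit_nth:
  "multilinear_upon (i + j) F \<Longrightarrow>
    sw (Suc (i + j)) (\<lambda>zs. \<epsilon> (zs ! i) *\<^sub>C F (take i zs @ drop (Suc i) zs)) h = sw (i + j) F h"
proof (induction i arbitrary: F h)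
  case 0
  have "clinear (sw j F)" using clinear_sw_compose[OF _ clinear_id] 0 by simp
  then show ?case
    by (simp add: iter_sweedler_scaleC comult_counit_left)
next
  case (Suc i)
  have "multilinear_upon (i + j) (\<lambda>xs. F (a # xs))" for a
    using Suc.prems by (intro multilinear_upon_Cons) simp
  from Suc.IH[OF this] show ?case by (simp del: iter_sweedler.simps(2) add: iter_sweedler.simps(2)[of _ _ "Suc (_ + _)"] iter_sweedler.simps(2)[of _ _ "(_ + _)"])
qed

lemma iter_comult_eq_sw: "iter_comult \<Delta> \<epsilon> n h = sw n tpow_pure h"
proof (induction n arbitrary: h)
  case (Suc n)
  have ml: "multilinear (\<lambda>xs. tpow_pure (a # xs))" for a :: 'h
    unfolding multilinear_def using multilinear_tpow_pure[unfolded multilinear_def]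
    by (metis append_Cons)
  have "tpow_cons a (sw n tpow_pure b) = sw n (\<lambda>xs. tpow_pure (a # xs)) b" for a b
    unfolding tpow_cons_def
    by (simp add: clinear_iter_sweedler_commute[OF clinear_tpow_lift[OF ml]] tpow_lift_pure[OF ml])
  then show ?case by (simp add: Suc.IH)
qed simp

subsection \<open>The antipode\<close>

lemma comult_antipode_left:
  assumes "clinear F"
  shows "tensor_lift (\<lambda>a b. F (S a * b)) (\<Delta> h) = \<epsilon> h *\<^sub>C F 1"
  using arg_cong[OF antipode_left[of h], of F] assms
  by (simp add: clinear_tensor_lift_commute clinear_scaleC)

lemma comult_antipode_right:
  assumes "clinear F"
  shows "tensor_lift (\<lambda>a b. F (a * S b)) (\<Delta> h) = \<epsilon> h *\<^sub>C F 1"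
  using arg_cong[OF antipode_right[of h], of F] assms
  by (simp add: clinear_tensor_lift_commute clinear_scaleC)

lemma antipode_one: "S 1 = 1"
proof -
  have "bilinear (\<lambda>a b. S a * b)" by (intro linear_intros)
  then show ?thesis
    using antipode_left[of 1] by (simp add: comult_one tensor_lift_pure counit_one scaleC_one)
qed

text \<open>Applying \<epsilon> to the antipode axiom gives \<epsilon>(S h_1) \<epsilon>(h_2) =
  \<epsilon>(h), and the right counit axiom contracts the left side to \<epsilon>(S h).\<close>

lemma counit_antipode: "\<epsilon> (S h) = \<epsilon> h"
proof -
  have "tensor_lift (\<lambda>a b. \<epsilon> b *\<^sub>C \<epsilon> (S a)) (\<Delta> h) = \<epsilon> h *\<^sub>C \<epsilon> 1"
    using comult_antipode_left[OF linear_counit, of h]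
    by (simp add: counit_mult scaleC_complex_def mult.commute)
  moreover have "tensor_lift (\<lambda>a b. \<epsilon> b *\<^sub>C \<epsilon> (S a)) (\<Delta> h) = \<epsilon> (S h)"
    by (rule comult_counit_right) (intro linear_intros)
  ultimately show ?thesis
    by (simp add: counit_one scaleC_complex_def)
qed

text \<open>
  Both sides equal \<open>S (a\<^sub>(\<^sub>1\<^sub>) b\<^sub>(\<^sub>1\<^sub>)) a\<^sub>(\<^sub>2\<^sub>) b\<^sub>(\<^sub>2\<^sub>) S b\<^sub>(\<^sub>3\<^sub>) S a\<^sub>(\<^sub>3\<^sub>)\<close>.
\<close>

lemma antipode_mult: "S (a * b) = S b * S a"
proof -
  define G where "G a1 a2 a3 b1 b2 b3 = S (a1 * b1) * (a2 * b2 * S b3 * S a3)"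
    for a1 a2 a3 b1 b2 b3
  have "tensor_lift (\<lambda>a1 a'. tensor_lift (\<lambda>a2 a3. tensor_lift (\<lambda>b1 b'. tensor_lift (\<lambda>b2 b3.
      G a1 a2 a3 b1 b2 b3) (\<Delta> b')) (\<Delta> b)) (\<Delta> a')) (\<Delta> a) = S (a * b)"
  proof -
    have 1: "tensor_lift (\<lambda>b2 b3. G a1 a2 a3 b1 b2 b3) (\<Delta> b')
        = \<epsilon> b' *\<^sub>C (S (a1 * b1) * (a2 * S a3))" for a1 a2 a3 b1 b'
    proof -
      have "clinear (\<lambda>y. S (a1 * b1) * (a2 * y * S a3))" by (intro linear_intros)
      from comult_antipode_right[OF this] show ?thesis by (simp add: G_def mult.assoc)
    qed
    have 2: "tensor_lift (\<lambda>b1 b'. \<epsilon> b' *\<^sub>C (S (a1 * b1) * (a2 * S a3))) (\<Delta> b)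
        = S (a1 * b) * (a2 * S a3)" for a1 a2 a3
      by (rule comult_counit_right) (intro linear_intros)
    have 3: "tensor_lift (\<lambda>a2 a3. S (a1 * b) * (a2 * S a3)) (\<Delta> a') = \<epsilon> a' *\<^sub>C S (a1 * b)" for a1 a'
      using comult_antipode_right[of "\<lambda>y. S (a1 * b) * y" a'] by (simp add: linear_intros)
    have 4: "tensor_lift (\<lambda>a1 a'. \<epsilon> a' *\<^sub>C S (a1 * b)) (\<Delta> a) = S (a * b)"
      by (rule comult_counit_right) (intro linear_intros)
    show ?thesis by (simp only: 1 2 3 4)
  qed
  moreover have "tensor_lift (\<lambda>a1 a'. tensor_lift (\<lambda>a2 a3. tensor_lift (\<lambda>b1 b'. tensor_lift (\<lambda>b2 b3.
      G a1 a2 a3 b1 b2 b3) (\<Delta> b')) (\<Delta> b)) (\<Delta> a')) (\<Delta> a) = S b * S a"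
  proof -
    have 1: "tensor_lift (\<lambda>b1 b'. tensor_lift (\<lambda>b2 b3. G a1 a2 a3 b1 b2 b3) (\<Delta> b')) (\<Delta> b)
      = tensor_lift (\<lambda>b' b3. tensor_lift (\<lambda>b1 b2. G a1 a2 a3 b1 b2 b3) (\<Delta> b')) (\<Delta> b)" for a1 a2 a3
      unfolding G_def by (rule comult_coassoc[symmetric]; intro linear_intros)
    have 2: "tensor_lift (\<lambda>a1 a'. tensor_lift (\<lambda>a2 a3.
        tensor_lift (\<lambda>b' b3. tensor_lift (\<lambda>b1 b2. G a1 a2 a3 b1 b2 b3) (\<Delta> b')) (\<Delta> b)) (\<Delta> a')) (\<Delta> a)
      = tensor_lift (\<lambda>a' a3. tensor_lift (\<lambda>a1 a2.
        tensor_lift (\<lambda>b' b3. tensor_lift (\<lambda>b1 b2. G a1 a2 a3 b1 b2 b3) (\<Delta> b')) (\<Delta> b)) (\<Delta> a')) (\<Delta> a)"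
      unfolding G_def by (rule comult_coassoc[symmetric]; intro linear_intros)
    \<comment> \<open>By \<open>comult_mult_lift\<close> the pairs (a1, b1) and (a2, b2) supply the
      two components of \<open>a' * b'\<close>, so S(a1 b1) a2 b2 collapses to \<epsilon>(a'
      b').\<close>
    have 3: "tensor_lift (\<lambda>a1 a2.
        tensor_lift (\<lambda>b' b3. tensor_lift (\<lambda>b1 b2. G a1 a2 a3 b1 b2 b3) (\<Delta> b')) (\<Delta> b)) (\<Delta> a')
      = tensor_lift (\<lambda>b' b3. \<epsilon> b' *\<^sub>C (\<epsilon> a' *\<^sub>C (S b3 * S a3))) (\<Delta> b)" for a3 a'
    proof -
      have bil: "bilinear (\<lambda>x y. S x * (y * (S b3 * S a3)))" for b3 by (intro linear_intros)
      have lin: "clinear (\<lambda>y. y * (S b3 * S a3))" for b3 by (intro linear_intros)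
      have "tensor_lift (\<lambda>a1 a2. tensor_lift (\<lambda>b1 b2. G a1 a2 a3 b1 b2 b3) (\<Delta> b')) (\<Delta> a')
        = \<epsilon> b' *\<^sub>C (\<epsilon> a' *\<^sub>C (S b3 * S a3))" for b' b3
        using comult_mult_lift[OF bil, of b3 a' b'] comult_antipode_left[OF lin, of b3 "a' * b'"]
        by (simp add: G_def mult.assoc counit_mult scaleC_scaleC mult.commute)
      then show ?thesis by (subst tensor_lift_swap) simp
    qed
    have 4: "tensor_lift (\<lambda>b' b3. \<epsilon> b' *\<^sub>C (\<epsilon> a' *\<^sub>C (S b3 * S a3))) (\<Delta> b)
      = \<epsilon> a' *\<^sub>C (S b * S a3)" for a' a3
      by (rule comult_counit_left) (intro linear_intros)
    have 5: "tensor_lift (\<lambda>a' a3. \<epsilon> a' *\<^sub>C (S b * S a3)) (\<Delta> a) = S b * S a"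
      by (rule comult_counit_left) (intro linear_intros)
    show ?thesis by (simp only: 1 2 3 4 5)
  qed
  ultimately show ?thesis by simp
qed

end

section \<open>The tensor product of two algebras as an algebra\<close>

lemma bilinear_tensor_mult: "bilinear tensor_mult"
  unfolding tensor_mult_def by (intro linear_intros)

lemma clinear_tensor_mult_left [linear_intros]: "clinear g \<Longrightarrow> clinear (\<lambda>x. tensor_mult (g x) t)"
  and clinear_tensor_mult_right [linear_intros]: "clinear g \<Longrightarrow> clinear (\<lambda>x. tensor_mult s (g x))"
  using bilinear_tensor_mult clinear_compose unfolding bilinear_iff by blast+

lemma tensor_mult_pure: "tensor_mult (a \<otimes> b) (a' \<otimes> b') = (a * a') \<otimes> (b * b')"
  unfolding tensor_mult_def by (simp add: tensor_lift_pure linear_intros)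

lemma tensor_mult_assoc: "tensor_mult (tensor_mult s t) u = tensor_mult s (tensor_mult t u)"
proof -
  have 1: "tensor_mult (tensor_mult (a \<otimes> b) (a' \<otimes> b')) u
    = tensor_mult (a \<otimes> b) (tensor_mult (a' \<otimes> b') u)" for a b a' b'
    by (rule clinear_eq_on_tensor[where t = u]; (intro linear_intros)?)
      (simp add: tensor_mult_pure mult.assoc)
  have 2: "tensor_mult (tensor_mult (a \<otimes> b) t) u = tensor_mult (a \<otimes> b) (tensor_mult t u)" for a b
    by (rule clinear_eq_on_tensor[where t = t]; (intro linear_intros)?) (rule 1)
  show ?thesis
    by (rule clinear_eq_on_tensor[where t = s]; (intro linear_intros)?) (rule 2)
qed

lemma tensor_mult_one_left: "tensor_mult (1 \<otimes> 1) t = t"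
  by (rule clinear_eq_on_tensor[where t = t]; (intro linear_intros)?) (simp add: tensor_mult_pure)

lemma tensor_mult_one_right: "tensor_mult t (1 \<otimes> 1) = t"
  by (rule clinear_eq_on_tensor[where t = t]; (intro linear_intros)?) (simp add: tensor_mult_pure)

context hopf_algebra
begin

text \<open>Uniqueness of convolution inverses among linear maps from H to the tensor square of H:
  the composite of S and \<Delta> is a left inverse of \<Delta> because \<Delta> is multiplicative,
  the right side \<sigma> is a right inverse by \<open>Y\<close>, and associativity of convolution
  makes the two agree.\<close>

lemma comult_antipode: "\<Delta> (S h) = tensor_lift (\<lambda>a b. S b \<otimes> S a) (\<Delta> h)"
proof -
  define \<sigma> where "\<sigma> h = tensor_lift (\<lambda>a b. S b \<otimes> S a) (\<Delta> h)" for h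
  have \<sigma> [linear_intros]: "clinear (\<lambda>x. \<sigma> (g x))" if "clinear g" for g :: "'h \<Rightarrow> 'h"
    unfolding \<sigma>_def using that by (intro linear_intros)
  \<comment> \<open>The sum is h_1 S(h_4) \<otimes> h_2 S(h_3). The inner pair cancels, after which
    the outer two components become adjacent and cancel as well.\<close>
  have Y: "tensor_lift (\<lambda>p r. tensor_mult (\<Delta> p) (\<sigma> r)) (\<Delta> h) = \<epsilon> h *\<^sub>C (1 \<otimes> 1)" for h
  proof -
    define G where "G c d a b = (c * S b) \<otimes> (d * S a)" for a b c d
    have G: "clinear (\<lambda>a. G a b c d)" "clinear (\<lambda>b. G a b c d)" "clinear (\<lambda>c. G a b c d)"
      "clinear (\<lambda>d. G a b c d)" for a b c d
      unfolding G_def by (intro linear_intros)+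
    have mult: "tensor_mult (c \<otimes> d) (\<sigma> r) = tensor_lift (\<lambda>a b. G c d a b) (\<Delta> r)" for c d r
      unfolding \<sigma>_def G_def
      by (subst clinear_tensor_lift_commute) (intro linear_intros, simp add: tensor_mult_pure)
    have "tensor_mult (\<Delta> p) (\<sigma> r)
      = tensor_lift (\<lambda>c d. tensor_lift (\<lambda>a b. G c d a b) (\<Delta> r)) (\<Delta> p)" for p r
      using clinear_tensor_lift_commute[of "\<lambda>s. tensor_mult s (\<sigma> r)" "(\<otimes>)" "\<Delta> p"]
      by (simp add: mult clinear_tensor_mult_left[OF clinear_id])
    then have "tensor_lift (\<lambda>p r. tensor_mult (\<Delta> p) (\<sigma> r)) (\<Delta> h)
      = tensor_lift (\<lambda>p r. tensor_lift (\<lambda>c d. tensor_lift (\<lambda>a b. G c d a b) (\<Delta> r)) (\<Delta> p)) (\<Delta> h)"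
      by simp
    also have "\<dots> = tensor_lift (\<lambda>c z. tensor_lift (\<lambda>d r. tensor_lift (\<lambda>a b. G c d a b) (\<Delta> r)) (\<Delta> z)) (\<Delta> h)"
      by (rule comult_coassoc; intro linear_intros G)
    also have "\<dots> = tensor_lift (\<lambda>c z. tensor_lift (\<lambda>y b. tensor_lift (\<lambda>d a. G c d a b) (\<Delta> y)) (\<Delta> z)) (\<Delta> h)"
      by (intro tensor_lift_cong comult_coassoc[symmetric] G)
    also have "\<dots> = tensor_lift (\<lambda>c z. tensor_lift (\<lambda>y b. \<epsilon> y *\<^sub>C ((c * S b) \<otimes> 1)) (\<Delta> z)) (\<Delta> h)"
      unfolding G_def by (intro tensor_lift_cong comult_antipode_right linear_intros)
    also have "\<dots> = tensor_lift (\<lambda>c z. (c * S z) \<otimes> 1) (\<Delta> h)"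
      by (intro tensor_lift_cong comult_counit_left linear_intros)
    also have "\<dots> = \<epsilon> h *\<^sub>C (1 \<otimes> 1)"
      by (rule comult_antipode_right) (intro linear_intros)
    finally show ?thesis .
  qed
  have "tensor_lift (\<lambda>p r. \<epsilon> r *\<^sub>C \<Delta> (S p)) (\<Delta> h)
    = tensor_lift (\<lambda>p z. tensor_lift (\<lambda>q r. tensor_mult (\<Delta> (S p)) (tensor_mult (\<Delta> q) (\<sigma> r))) (\<Delta> z)) (\<Delta> h)"
  proof (rule tensor_lift_cong)
    fix p z
    have "clinear (tensor_mult (\<Delta> (S p)))" by (intro linear_intros)
    from clinear_tensor_lift_commute[OF this, of "\<lambda>q r. tensor_mult (\<Delta> q) (\<sigma> r)" "\<Delta> z"]
    show "\<epsilon> z *\<^sub>C \<Delta> (S p)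
      = tensor_lift (\<lambda>q r. tensor_mult (\<Delta> (S p)) (tensor_mult (\<Delta> q) (\<sigma> r))) (\<Delta> z)"
      by (simp add: Y clinear_scaleC[OF \<open>clinear (tensor_mult (\<Delta> (S p)))\<close>] tensor_mult_one_right)
  qed
  also have "\<dots> = tensor_lift (\<lambda>z r. tensor_lift (\<lambda>p q.
      tensor_mult (\<Delta> (S p)) (tensor_mult (\<Delta> q) (\<sigma> r))) (\<Delta> z)) (\<Delta> h)"
    by (rule comult_coassoc[symmetric]; intro linear_intros)
  also have "\<dots> = tensor_lift (\<lambda>z r. tensor_lift (\<lambda>p q. tensor_mult (\<Delta> (S p * q)) (\<sigma> r)) (\<Delta> z)) (\<Delta> h)"
    by (simp add: comult_mult tensor_mult_assoc)
  also have "\<dots> = tensor_lift (\<lambda>z r. \<epsilon> z *\<^sub>C tensor_mult (\<Delta> 1) (\<sigma> r)) (\<Delta> h)"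
    by (intro tensor_lift_cong comult_antipode_left linear_intros)
  also have "\<dots> = tensor_mult (\<Delta> 1) (\<sigma> h)"
    by (intro comult_counit_left linear_intros)
  also have "tensor_lift (\<lambda>p r. \<epsilon> r *\<^sub>C \<Delta> (S p)) (\<Delta> h) = \<Delta> (S h)"
    by (intro comult_counit_right linear_intros)
  finally show ?thesis
    by (simp add: comult_one tensor_mult_one_left \<sigma>_def)
qed

lemma comult_antipode_lift:
  assumes F: "bilinear F"
  shows "tensor_lift F (\<Delta> (S h)) = tensor_lift (\<lambda>a b. F (S b) (S a)) (\<Delta> h)"
  by (simp add: comult_antipode clinear_tensor_lift_commute[OF clinear_tensor_lift[OF F]]
      tensor_lift_pure[OF F])

text \<open>The recursion of \<open>sw\<close> exposes the first component, whereas rotation and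
  \<open>lastr\<close> act at the end of the list. This form exposes the last component.\<close>

lemma sw_snoc:
  assumes F: "multilinear_upon (Suc n) F"
  shows "sw (Suc n) F h = tensor_lift (\<lambda>a b. sw n (\<lambda>xs. F (xs @ [b])) a) (\<Delta> h)"
proof -
  \<comment> \<open>The recursion ends in \<epsilon>, so a Sweedler sum with one component is an
    evaluation only by the counit axiom.\<close>
  have "sw (Suc 0) (\<lambda>ys. F (xs @ ys)) b = F (xs @ [b])" if "length xs = n" for xs b
  proof -
    have "clinear (\<lambda>a. F (xs @ [a]))" using multilinear_uponD[OF F, of xs "[]"] that by simp
    then show ?thesis by (simp add: comult_counit_right)
  qed
  then show ?thesis
    using sw_split[of n "Suc 0" F h, unfolded add_Suc_right add_0_right] F
    by (simp del: iter_sweedler.simps cong: iter_sweedler_cong)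
qed

text \<open>S reverses coproducts, so the first component of S k comes from the last component of k.
  The recursion on the left side is therefore matched with \<open>sw_snoc\<close> on the right
  side.\<close>

lemma sw_antipode:
  "multilinear_upon n F \<Longrightarrow> sw n F (S k) = sw n (\<lambda>ks. F (map S (rev ks))) k"
proof (induction n arbitrary: F k)
  case 0
  show ?case by (simp add: counit_antipode)
next
  case (Suc n)
  have ml: "multilinear_upon n (\<lambda>xs. F (a # xs))" for a
    by (rule multilinear_upon_Cons[OF Suc.prems])
  have ml': "multilinear_upon (Suc n) (\<lambda>ks. F (map S (rev ks)))"
    by (intro multilinear_uponI)
      (simp, intro clinear_multilinear[OF Suc.prems] linear_intros, simp)
  have bil: "bilinear (\<lambda>a b. sw n (\<lambda>xs. F (a # xs)) b)"
    by (intro linear_intros clinear_multilinear[OF Suc.prems]; simp)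
  show ?case
    unfolding sw_snoc[OF ml'] by (simp add: comult_antipode_lift[OF bil] Suc.IH[OF ml])
qed

end

section \<open>Positions in lists and factorwise products\<close>

lemma multilinear_upon_cong:
  "multilinear_upon n G \<Longrightarrow> (\<And>hs. length hs = n \<Longrightarrow> F hs = G hs) \<Longrightarrow> multilinear_upon n F"
  by (simp add: multilinear_upon_def)

text \<open>The operators cut the list at a fixed position i, while multilinearity varies an
  arbitrary entry. That entry lies before, at or after the cut; the hypotheses \<open>left\<close>,
  \<open>nth\<close> and \<open>right\<close> treat the three cases.\<close>

lemma multilinear_upon_nth:
  assumes i: "i < n"
    and nth: "\<And>xs ys. length xs = i \<Longrightarrow> Suc (i + length ys) = n \<Longrightarrow> clinear (\<lambda>a. G xs a ys)"
    and left: "\<And>as bs a ys. Suc (length as + length bs) = i \<Longrightarrow> Suc (i + length ys) = n \<Longrightarrow>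
      clinear (\<lambda>x. G (as @ x # bs) a ys)"
    and right: "\<And>xs a as bs. length xs = i \<Longrightarrow> Suc (Suc (i + length as + length bs)) = n \<Longrightarrow>
      clinear (\<lambda>x. G xs a (as @ x # bs))"
  shows "multilinear_upon n (\<lambda>hs. G (take i hs) (hs ! i) (drop (Suc i) hs))"
proof (rule multilinear_uponI)
  fix as bs :: "'a list"
  assume len: "Suc (length as + length bs) = n"
  consider "length as < i" | "length as = i" | "length as > i" by linarith
  then show "clinear (\<lambda>x. G (take i (as @ x # bs)) ((as @ x # bs) ! i) (drop (Suc i) (as @ x # bs)))"
  proof cases
    case 1
    then obtain k where k: "i = Suc (length as + k)"
      using less_imp_Suc_add by blast
    have "clinear (\<lambda>x. G (as @ x # take k bs) (bs ! k) (drop (Suc k) bs))"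
      using len i by (intro left) (simp_all add: k)
    moreover have "Suc (Suc (length as + k)) - length as = Suc (Suc k)" by simp
    ultimately show ?thesis by (simp add: k nth_append)
  next
    case 2
    then show ?thesis using nth[of as bs] len by (simp add: nth_append)
  next
    case 3
    have "clinear (\<lambda>x. G (take i as) (as ! i) (drop (Suc i) as @ x # bs))"
      using len 3 by (intro right) simp_all
    then show ?thesis using 3 by (simp add: nth_append)
  qed
qed

lemma split_at_nth:
  assumes "i < length hs"
  obtains xs h ys where "hs = xs @ h # ys" "length xs = i"
  using id_take_nth_drop[OF assms] assms by (metis length_take min.absorb4)

lemma linear_in_slot_map2_left [linear_intros]:
  fixes L :: "'x::complex_vector \<Rightarrow> 'a::complex_vector list" and g :: "'a \<Rightarrow> 'b \<Rightarrow> 'c::complex_vector"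
  assumes "\<And>b. clinear (\<lambda>a. g a b)" "linear_in_slot L" "\<And>x. length (L x) = length ys"
  shows "linear_in_slot (\<lambda>x. map2 g (L x) ys)"
proof -
  obtain as f bs where L: "clinear f" "L = (\<lambda>x. as @ f x # bs)"
    using assms(2) unfolding linear_in_slot_def by blast
  have len: "length ys = Suc (length as + length bs)" using assms(3)[of 0] L by simp
  then obtain cs b ds where ys: "ys = cs @ b # ds" "length cs = length as"
    using split_at_nth[of "length as" ys] by auto
  have "map2 g (L x) ys = map2 g as cs @ g (f x) b # map2 g bs ds" for x
    using ys by (simp add: L(2))
  then show ?thesis
    unfolding linear_in_slot_def using clinear_compose[OF assms(1) L(1)] by blast
qed

lemma map2_flip: "map2 g xs ys = map2 (\<lambda>y x. g x y) ys xs"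
  by (induction xs ys rule: list_induct2') simp_all

lemma linear_in_slot_map2_right [linear_intros]:
  fixes L :: "'x::complex_vector \<Rightarrow> 'b::complex_vector list" and g :: "'a \<Rightarrow> 'b \<Rightarrow> 'c::complex_vector"
  assumes "\<And>a. clinear (g a)" "linear_in_slot L" "\<And>x. length (L x) = length xs"
  shows "linear_in_slot (\<lambda>x. map2 g xs (L x))"
  by (subst map2_flip) (rule linear_in_slot_map2_left[OF assms])

lemma bilinear_tpow_mult: "bilinear tpow_mult"
proof -
  have *: "multilinear (\<lambda>ys. if length xs = length ys then tpow_pure (map2 (*) xs ys) else 0)"
    for xs :: "'a list"
    using multilinear_guard[of "length xs" "\<lambda>ys. tpow_pure (map2 (*) xs ys)"]
    by (simp add: eq_commute[of "length xs"] linear_intros)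
  have "multilinear (\<lambda>xs. tpow_lift (\<lambda>ys. if length xs = length ys
      then tpow_pure (map2 (*) xs ys) else 0) t)" for t :: "'a tpow"
  proof -
    have "clinear (\<lambda>a. tpow_lift (\<lambda>ys. if length (as @ a # bs) = length ys
        then tpow_pure (map2 (*) (as @ a # bs) ys) else 0) t)" for as bs :: "'a list"
    proof (rule clinear_tpow_lift_param)
      fix ys :: "'a list"
      show "clinear (\<lambda>a. if length (as @ a # bs) = length ys
        then tpow_pure (map2 (*) (as @ a # bs) ys) else 0)"
      proof (cases "Suc (length as + length bs) = length ys")
        case True
        then have "clinear (\<lambda>a. tpow_pure (map2 (*) (as @ a # bs) ys))"
          by (intro linear_intros) simp
        with True show ?thesis by simp
      next
        case False
        then show ?thesis by (simp add: clinear_iff)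
      qed
    qed
    then show ?thesis unfolding multilinear_def clinear_iff by blast
  qed
  with * show ?thesis
    unfolding tpow_mult_def by (intro linear_intros)
qed

lemma clinear_tpow_mult_left [linear_intros]: "clinear g \<Longrightarrow> clinear (\<lambda>x. tpow_mult (g x) t)"
  and clinear_tpow_mult_right [linear_intros]: "clinear g \<Longrightarrow> clinear (\<lambda>x. tpow_mult s (g x))"
  using bilinear_tpow_mult clinear_compose unfolding bilinear_iff by blast+

lemma tpow_mult_pure:
  assumes "length xs = length ys"
  shows "tpow_mult (tpow_pure xs) (tpow_pure ys) = tpow_pure (map2 (*) xs ys)"
proof -
  have "multilinear (\<lambda>xs. if length xs = length ys then tpow_pure (map2 (*) xs ys) else 0)"
    by (rule multilinear_guard) (intro linear_intros, simp)
  moreover have ml: "multilinear (\<lambda>ys. if length xs = length ys then tpow_pure (map2 (*) xs ys) else 0)"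
    for xs :: "'a list"
    using multilinear_guard[of "length xs" "\<lambda>ys. tpow_pure (map2 (*) xs ys)"]
    by (simp add: eq_commute[of "length xs"] linear_intros)
  ultimately show ?thesis
    using assms by (simp add: tpow_mult_def tpow_lift_pure[OF ml] tpow_lift_pure)
qed

section \<open>The operators on pure tensors\<close>

locale hopf_sayd_module = hopf_algebra \<Delta> \<epsilon> S
  for \<Delta> :: "'h::complex_algebra_1 \<Rightarrow> ('h, 'h) tensor"
    and \<epsilon> :: "'h \<Rightarrow> complex"
    and S :: "'h \<Rightarrow> 'h" +
  fixes act :: "'n::complex_vector \<Rightarrow> 'h \<Rightarrow> 'n"
    and coact :: "'n \<Rightarrow> ('h, 'n) tensor"
  assumes sayd: "sayd_module_on UNIV \<Delta> \<epsilon> S act coact"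
begin

abbreviation coface_op :: "nat \<Rightarrow> nat \<Rightarrow> ('n, 'h tpow) tensor \<Rightarrow> ('n, 'h tpow) tensor"
  where "coface_op \<equiv> coface_pre \<Delta>"

abbreviation codeg_op :: "nat \<Rightarrow> nat \<Rightarrow> ('n, 'h tpow) tensor \<Rightarrow> ('n, 'h tpow) tensor"
  where "codeg_op \<equiv> codegeneracy_pre \<epsilon>"

abbreviation cyc :: "nat \<Rightarrow> ('n, 'h tpow) tensor \<Rightarrow> ('n, 'h tpow) tensor"
  where "cyc \<equiv> cyclic_pre coact"

abbreviation diag :: "nat \<Rightarrow> 'h \<Rightarrow> ('n, 'h tpow) tensor \<Rightarrow> ('n, 'h tpow) tensor"
  where "diag \<equiv> diag_right_pre \<Delta> \<epsilon>"

abbreviation lastr :: "nat \<Rightarrow> 'h \<Rightarrow> ('n, 'h tpow) tensor \<Rightarrow> ('n, 'h tpow) tensor"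
  where "lastr \<equiv> last_right_pre"

definition twisted_cyc :: "nat \<Rightarrow> 'h \<Rightarrow> ('n, 'h tpow) tensor \<Rightarrow> ('n, 'h tpow) tensor"
  where "twisted_cyc q k y = lastr q (S k) (cyc q y)"

abbreviation bal :: "nat \<Rightarrow> ('n, 'h tpow) tensor set"
  where "bal \<equiv> balancing \<Delta> \<epsilon> act"

lemma clinear_coact_compose [linear_intros]: "clinear g \<Longrightarrow> clinear (\<lambda>x. coact (g x))"
  using sayd clinear_compose[of coact g] by (simp add: sayd_module_on_def left_comodule_on_def)

lemma coact_coassoc:
  assumes "\<And>b c. clinear (\<lambda>a. F a b c)" "\<And>a c. clinear (\<lambda>b. F a b c)" "\<And>a b. clinear (F a b)"
  shows "tensor_lift (\<lambda>x m'. tensor_lift (\<lambda>a b. F a b m') (\<Delta> x)) (coact m)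
    = tensor_lift (\<lambda>x m'. tensor_lift (\<lambda>y m''. F x y m'') (coact m')) (coact m)"
proof -
  have bil: "bilinear (F a)" for a
    using assms by (intro linear_intros)
  have L: "bilinear (\<lambda>a t. tensor_lift (F a) t)"
    by (intro linear_intros assms bil)
  have "tensor_lift (\<lambda>h m'. tensor_lift (\<lambda>a b. a \<otimes> (b \<otimes> m')) (\<Delta> h)) (coact m)
      = tensor_lift (\<lambda>h m'. h \<otimes> coact m') (coact m)"
    using sayd by (simp add: sayd_module_on_def left_comodule_on_def)
  from arg_cong[OF this, of "tensor_lift (\<lambda>a t. tensor_lift (F a) t)"]
  show ?thesis
    by (simp add: clinear_tensor_lift_commute[OF clinear_tensor_lift[OF L]] tensor_lift_pure[OF L]
        tensor_lift_pure[OF bil])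
qed

lemma coact_counit: "clinear F \<Longrightarrow> tensor_lift (\<lambda>x m'. \<epsilon> x *\<^sub>C F m') (coact m) = F m"
proof -
  assume F: "clinear F"
  have "tensor_lift (\<lambda>x m'. \<epsilon> x *\<^sub>C m') (coact m) = m"
    using sayd by (simp add: sayd_module_on_def left_comodule_on_def)
  from arg_cong[OF this, of F] show ?thesis
    by (simp add: clinear_tensor_lift_commute[OF F] clinear_scaleC[OF F])
qed

lemma coact_stable: "clinear F \<Longrightarrow> tensor_lift (\<lambda>x m'. F (act m' x)) (coact m) = F m"
proof -
  assume F: "clinear F"
  have "tensor_lift (\<lambda>x m'. act m' x) (coact m) = m"
    using sayd by (simp add: sayd_module_on_def)
  from arg_cong[OF this, of F] show ?thesis
    by (simp add: clinear_tensor_lift_commute[OF F])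
qed

lemma coact_act:
  assumes F: "bilinear F"
  shows "tensor_lift F (coact (act m h)) = tensor_lift (\<lambda>g h3. tensor_lift (\<lambda>h1 h2.
    tensor_lift (\<lambda>x m'. F (S h3 * x * h1) (act m' h2)) (coact m)) (\<Delta> g)) (\<Delta> h)"
proof -
  have "coact (act m h) = tensor_lift (\<lambda>g h3. tensor_lift (\<lambda>h1 h2.
    tensor_lift (\<lambda>x m'. (S h3 * x * h1) \<otimes> act m' h2) (coact m)) (\<Delta> g)) (\<Delta> h)"
    using sayd by (simp add: sayd_module_on_def)
  then show ?thesis
    by (simp add: clinear_tensor_lift_commute[OF clinear_tensor_lift[OF F]] tensor_lift_pure[OF F])
qed

lemma csubspace_bal: "csubspace (bal n)"
  by (simp add: balancing_def)

lemma tpow_mult_iter_comult: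
  assumes "length hs = n"
  shows "tpow_mult (iter_comult \<Delta> \<epsilon> n h) (tpow_pure hs) = sw n (\<lambda>xs. tpow_pure (map2 (*) xs hs)) h"
    and "tpow_mult (tpow_pure hs) (iter_comult \<Delta> \<epsilon> n h) = sw n (\<lambda>xs. tpow_pure (map2 (*) hs xs)) h"
proof -
  have 1: "clinear (\<lambda>t. tpow_mult t (tpow_pure hs))" and 2: "clinear (tpow_mult (tpow_pure hs))"
    by (intro linear_intros)+
  show "tpow_mult (iter_comult \<Delta> \<epsilon> n h) (tpow_pure hs)
      = sw n (\<lambda>xs. tpow_pure (map2 (*) xs hs)) h"
    unfolding iter_comult_eq_sw clinear_iter_sweedler_commute[OF 1]
    by (rule iter_sweedler_cong) (simp add: tpow_mult_pure assms)
  show "tpow_mult (tpow_pure hs) (iter_comult \<Delta> \<epsilon> n h) = sw n (\<lambda>xs. tpow_pure (map2 (*) hs xs)) h"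
    unfolding iter_comult_eq_sw clinear_iter_sweedler_commute[OF 2]
    by (rule iter_sweedler_cong) (simp add: tpow_mult_pure assms)
qed

lemma pure_sw: "m \<otimes> sw n F h = sw n (\<lambda>xs. m \<otimes> F xs) h"
  by (rule clinear_iter_sweedler_commute) (intro linear_intros)

lemma balancing_pure:
  assumes "length hs = n"
  shows "act m h \<otimes> tpow_pure hs - sw n (\<lambda>xs. m \<otimes> tpow_pure (map2 (*) xs hs)) h \<in> bal n"
proof -
  have "tpow_pure hs \<in> tpow_space n"
    using assms unfolding tpow_space_def by (intro complex_vector.span_base) blast
  then have "act m h \<otimes> tpow_pure hs - m \<otimes> tpow_mult (iter_comult \<Delta> \<epsilon> n h) (tpow_pure hs) \<in> bal n"
    unfolding balancing_def by (intro complex_vector.span_base) blast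
  then show ?thesis by (simp add: tpow_mult_iter_comult(1)[OF assms] pure_sw)
qed

text \<open>Criterion for an operator to descend to the quotient. The generators of
  \<open>bal n\<close> depend linearly on w, so w may be taken pure, and the iterated coproduct then
  becomes a Sweedler sum that L passes through.\<close>

lemma balancing_map_into:
  assumes L: "clinear L" and U: "csubspace U" and y: "y \<in> bal n"
    and pure: "\<And>m h hs. length hs = n \<Longrightarrow>
      L (act m h \<otimes> tpow_pure hs) - sw n (\<lambda>xs. L (m \<otimes> tpow_pure (map2 (*) xs hs))) h \<in> U"
  shows "L y \<in> U"
proof (rule clinear_span_in_subspace[OF L U y[unfolded balancing_def]], safe)
  fix m h and w :: "'h tpow" assume w: "w \<in> tpow_space n"
  let ?f = "\<lambda>w. L (act m h \<otimes> w - m \<otimes> tpow_mult (iter_comult \<Delta> \<epsilon> n h) w)"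
  have "clinear ?f" by (intro clinear_compose[OF L] linear_intros)
  then show "?f w \<in> U"
  proof (rule clinear_span_in_subspace[OF _ U w[unfolded tpow_space_def]])
    fix a :: "'h tpow" assume "a \<in> {tpow_pure xs |xs. length xs = n}"
    then obtain hs where "a = tpow_pure hs" "length hs = n" by blast
    then show "?f a \<in> U"
      using pure[of hs m h]
      by (simp add: clinear_diff[OF L] tpow_mult_iter_comult(1) pure_sw
          clinear_iter_sweedler_commute[OF L])
  qed
qed

subsection \<open>Evaluation\<close>

lemma
  assumes i: "i \<le> q"
  shows clinear_coface_op: "clinear (coface_op q i)"
    and coface_op_nth: "length hs = Suc q \<Longrightarrow> coface_op q i (m \<otimes> tpow_pure hs)
      = tensor_lift (\<lambda>a b. m \<otimes> tpow_pure (take i hs @ a # b # drop (Suc i) hs)) (\<Delta> (hs ! i))"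
proof -
  have "multilinear_upon (Suc q) (\<lambda>hs. tensor_lift (\<lambda>a b.
      m \<otimes> tpow_pure (take i hs @ [a, b] @ drop (Suc i) hs)) (\<Delta> (hs ! i)))" for m :: 'n
    using i by (intro multilinear_upon_nth[where G = "\<lambda>xs h ys. tensor_lift (\<lambda>a b.
      m \<otimes> tpow_pure (xs @ [a, b] @ ys)) (\<Delta> h)"] linear_intros) simp_all
  note ml = this
  show "clinear (coface_op q i)"
    unfolding coface_pre_def by (rule clinear_degree_lift, intro linear_intros, rule ml)
  show "length hs = Suc q \<Longrightarrow> coface_op q i (m \<otimes> tpow_pure hs)
      = tensor_lift (\<lambda>a b. m \<otimes> tpow_pure (take i hs @ a # b # drop (Suc i) hs)) (\<Delta> (hs ! i))"
    unfolding coface_pre_def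
    by (subst degree_lift_pure, intro linear_intros, rule ml, simp_all)
qed

lemma coface_op_pure:
  "length xs = i \<Longrightarrow> i + length ys = q \<Longrightarrow> coface_op q i (m \<otimes> tpow_pure (xs @ h # ys))
    = tensor_lift (\<lambda>a b. m \<otimes> tpow_pure (xs @ a # b # ys)) (\<Delta> h)"
  by (subst coface_op_nth) (auto simp: nth_append)

lemma
  assumes j: "j < q"
  shows clinear_codeg_op: "clinear (codeg_op q j)"
    and codeg_op_nth: "length hs = Suc q \<Longrightarrow> codeg_op q j (m \<otimes> tpow_pure hs)
      = \<epsilon> (hs ! Suc j) *\<^sub>C (m \<otimes> tpow_pure (take (Suc j) hs @ drop (Suc (Suc j)) hs))"
proof -
  have "multilinear_upon (Suc q) (\<lambda>hs.
      \<epsilon> (hs ! Suc j) *\<^sub>C (m \<otimes> tpow_pure (take (Suc j) hs @ drop (Suc (Suc j)) hs)))" for m :: 'n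
    using j by (intro multilinear_upon_nth[where G = "\<lambda>xs h ys.
      \<epsilon> h *\<^sub>C (m \<otimes> tpow_pure (xs @ ys))"] linear_intros) simp_all
  note ml = this
  show "clinear (codeg_op q j)"
    unfolding codegeneracy_pre_def by (rule clinear_degree_lift, intro linear_intros, rule ml)
  show "length hs = Suc q \<Longrightarrow> codeg_op q j (m \<otimes> tpow_pure hs)
      = \<epsilon> (hs ! Suc j) *\<^sub>C (m \<otimes> tpow_pure (take (Suc j) hs @ drop (Suc (Suc j)) hs))"
    unfolding codegeneracy_pre_def
    by (subst degree_lift_pure, intro linear_intros, rule ml, simp_all)
qed

lemma codeg_op_pure:
  "length xs = Suc j \<Longrightarrow> Suc j + length ys = q \<Longrightarrow> codeg_op q j (m \<otimes> tpow_pure (xs @ h # ys))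
    = \<epsilon> h *\<^sub>C (m \<otimes> tpow_pure (xs @ ys))"
  by (subst codeg_op_nth) (auto simp: nth_append)

lemma clinear_cyc: "clinear (cyc q)"
  and cyc_pure: "length hs = q \<Longrightarrow> cyc q (m \<otimes> tpow_pure (h # hs))
      = tensor_lift (\<lambda>x m'. m' \<otimes> tpow_pure (hs @ [x * h])) (coact m)"
proof -
  have 1: "multilinear_upon (Suc q) (\<lambda>hs. tensor_lift (\<lambda>x m'.
      m' \<otimes> tpow_pure (drop (Suc 0) hs @ [x * (hs ! 0)])) (coact m))" for m :: 'n
    using multilinear_upon_nth[where i = 0 and n = "Suc q" and G = "\<lambda>xs h ys. tensor_lift (\<lambda>x m'.
      m' \<otimes> tpow_pure (ys @ [x * h])) (coact m)"] by (simp add: linear_intros)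
  have "multilinear_upon (Suc q) (\<lambda>hs. tensor_lift (\<lambda>x m'.
      m' \<otimes> tpow_pure (tl hs @ [x * hd hs])) (coact m))" for m :: 'n
    by (rule multilinear_upon_cong[OF 1[of m]]) (auto simp: length_Suc_conv)
  note ml = this
  show "clinear (cyc q)"
    unfolding cyclic_pre_def by (rule clinear_degree_lift, intro linear_intros, rule ml)
  show "length hs = q \<Longrightarrow> cyc q (m \<otimes> tpow_pure (h # hs))
      = tensor_lift (\<lambda>x m'. m' \<otimes> tpow_pure (hs @ [x * h])) (coact m)"
    unfolding cyclic_pre_def
    by (subst degree_lift_pure, intro linear_intros, rule ml, simp_all)
qed

lemma clinear_lastr: "clinear (lastr q u)"
  and lastr_pure: "length hs = q \<Longrightarrow>
    lastr q u (m \<otimes> tpow_pure (hs @ [h])) = m \<otimes> tpow_pure (hs @ [h * u])"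
proof -
  have 1: "multilinear_upon (Suc q) (\<lambda>hs. m \<otimes> tpow_pure (take q hs @ [hs ! q * u]))" for m :: 'n
    using multilinear_upon_nth[where i = q and n = "Suc q" and G = "\<lambda>xs h ys.
      m \<otimes> tpow_pure (xs @ [h * u])"] by (simp add: linear_intros)
  have "multilinear_upon (Suc q) (\<lambda>hs. m \<otimes> tpow_pure (butlast hs @ [last hs * u]))" for m :: 'n
    by (rule multilinear_upon_cong[OF 1[of m]]) (auto simp: butlast_conv_take last_conv_nth simp flip: length_greater_0_conv)
  note ml = this
  show "clinear (lastr q u)"
    unfolding last_right_pre_def by (rule clinear_degree_lift, intro linear_intros, rule ml)
  show "length hs = q \<Longrightarrow>
    lastr q u (m \<otimes> tpow_pure (hs @ [h])) = m \<otimes> tpow_pure (hs @ [h * u])"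
    unfolding last_right_pre_def
    by (subst degree_lift_pure, intro linear_intros, rule ml, simp_all)
qed

lemma clinear_lastr_param [linear_intros]: "clinear g \<Longrightarrow> clinear (\<lambda>x. lastr q (g x) y)"
proof -
  have "clinear (\<lambda>a. if length hs = Suc q then m \<otimes> tpow_pure (butlast hs @ [last hs * a]) else 0)"
    for m :: 'n and hs :: "'h list"
  proof (cases "length hs = Suc q")
    case True
    then show ?thesis by (simp add: linear_intros)
  qed (simp add: clinear_iff)
  then have "clinear (\<lambda>a. lastr q a y)"
    unfolding last_right_pre_def degree_lift_def by (intro linear_intros)
  then show "clinear g \<Longrightarrow> clinear (\<lambda>x. lastr q (g x) y)" by (rule clinear_compose)
qed

lemma clinear_diag: "clinear (diag q u)"
  and diag_pure: "length hs = Suc q \<Longrightarrow>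
    diag q u (m \<otimes> tpow_pure hs) = sw (Suc q) (\<lambda>xs. m \<otimes> tpow_pure (map2 (*) hs xs)) u"
proof -
  have "multilinear_upon (Suc q) (\<lambda>hs. m \<otimes> tpow_mult (tpow_pure hs) (iter_comult \<Delta> \<epsilon> (Suc q) u))"
    for m :: 'n
    by (intro linear_intros)
  note ml = this
  show "clinear (diag q u)"
    unfolding diag_right_pre_def by (rule clinear_degree_lift, intro linear_intros, rule ml)
  show "length hs = Suc q \<Longrightarrow>
    diag q u (m \<otimes> tpow_pure hs) = sw (Suc q) (\<lambda>xs. m \<otimes> tpow_pure (map2 (*) hs xs)) u"
    unfolding diag_right_pre_def
    by (subst degree_lift_pure, intro linear_intros, rule ml) (simp_all only: tpow_mult_iter_comult(2) pure_sw)
qed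

lemma clinear_twisted_cyc: "clinear (twisted_cyc q k)"
  unfolding twisted_cyc_def by (intro clinear_compose[OF clinear_lastr] clinear_cyc)

lemma clinear_ops_compose [linear_intros]:
  "i \<le> q \<Longrightarrow> clinear g \<Longrightarrow> clinear (\<lambda>x. coface_op q i (g x))"
  "j < q \<Longrightarrow> clinear g \<Longrightarrow> clinear (\<lambda>x. codeg_op q j (g x))"
  "clinear g \<Longrightarrow> clinear (\<lambda>x. cyc q (g x))"
  "clinear g \<Longrightarrow> clinear (\<lambda>x. lastr q u (g x))"
  "clinear g \<Longrightarrow> clinear (\<lambda>x. diag q u (g x))"
  "clinear g \<Longrightarrow> clinear (\<lambda>x. twisted_cyc q k (g x))"
  by (auto intro: clinear_compose clinear_coface_op clinear_codeg_op clinear_cyc clinear_lastr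
      clinear_diag clinear_twisted_cyc)

lemma clinear_twisted_cyc_param [linear_intros]:
  "clinear g \<Longrightarrow> clinear (\<lambda>x. twisted_cyc q (g x) y)"
  unfolding twisted_cyc_def by (intro linear_intros)

lemma twisted_cyc_pure:
  "length hs = q \<Longrightarrow> twisted_cyc q k (m \<otimes> tpow_pure (h # hs))
    = tensor_lift (\<lambda>x m'. m' \<otimes> tpow_pure (hs @ [x * h * S k])) (coact m)"
  by (simp add: twisted_cyc_def cyc_pure clinear_tensor_lift_commute[OF clinear_lastr] lastr_pure)

subsection \<open>Compatibility with the balancing relations and the diagonal actions\<close>

text \<open>
  The map \<open>g\<close> is multiplication in either order, so that the next two lemmas serve both the
  left diagonal action that defines the balancing and the right diagonal action.
\<close>

lemma coface_op_sw:
  fixes g :: "'h \<Rightarrow> 'h \<Rightarrow> 'h"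
  assumes g: "bilinear g" and i: "i \<le> q" and hs: "length hs = Suc q"
    and comult_g: "\<And>x b. \<Delta> (g x b)
      = tensor_lift (\<lambda>b1 b2. tensor_lift (\<lambda>c d. g c b1 \<otimes> g d b2) (\<Delta> x)) (\<Delta> b)"
  shows "sw (Suc q) (\<lambda>xs. coface_op q i (m \<otimes> tpow_pure (map2 g xs hs))) h
    = tensor_lift (\<lambda>b1 b2. sw (Suc (Suc q)) (\<lambda>zs.
        m \<otimes> tpow_pure (map2 g zs (take i hs @ b1 # b2 # drop (Suc i) hs))) h) (\<Delta> (hs ! i))"
proof -
  have gl: "clinear (\<lambda>a. g a b)" "clinear (g a)" for a b
    using g by (simp_all add: bilinear_iff)
  define F where "F b1 b2 zs = m \<otimes> tpow_pure (map2 g zs (take i hs @ b1 # b2 # drop (Suc i) hs))"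
    for b1 b2 zs
  have ml: "multilinear_upon (Suc (Suc (i + (q - i)))) (F b1 b2)" for b1 b2
    unfolding F_def using hs i by (intro linear_intros gl) simp_all
  have "sw (Suc q) (\<lambda>xs. coface_op q i (m \<otimes> tpow_pure (map2 g xs hs))) h
    = sw (Suc q) (\<lambda>xs. tensor_lift (\<lambda>b1 b2.
        tensor_lift (\<lambda>c d. F b1 b2 (take i xs @ c # d # drop (Suc i) xs)) (\<Delta> (xs ! i))) (\<Delta> (hs ! i))) h"
  proof (rule iter_sweedler_cong)
    fix xs :: "'h list" assume xs: "length xs = Suc q"
    have "coface_op q i (m \<otimes> tpow_pure (map2 g xs hs))
      = tensor_lift (\<lambda>c d. m \<otimes> tpow_pure (take i (map2 g xs hs) @ c # d # drop (Suc i) (map2 g xs hs)))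
        (\<Delta> (g (xs ! i) (hs ! i)))"
      using i hs xs by (simp add: coface_op_nth)
    also have "\<dots> = tensor_lift (\<lambda>b1 b2. tensor_lift (\<lambda>c d. m \<otimes> tpow_pure
        (take i (map2 g xs hs) @ g c b1 # g d b2 # drop (Suc i) (map2 g xs hs)))
        (\<Delta> (xs ! i))) (\<Delta> (hs ! i))"
    proof -
      have bil: "bilinear (\<lambda>c d. m \<otimes> tpow_pure
          (take i (map2 g xs hs) @ c # d # drop (Suc i) (map2 g xs hs)))"
        by (intro linear_intros)
      show ?thesis
        by (simp add: comult_g clinear_tensor_lift_commute[OF clinear_tensor_lift[OF bil]]
            tensor_lift_pure[OF bil])
    qed
    also have "\<dots> = tensor_lift (\<lambda>b1 b2.
        tensor_lift (\<lambda>c d. F b1 b2 (take i xs @ c # d # drop (Suc i) xs)) (\<Delta> (xs ! i))) (\<Delta> (hs ! i))"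
      using i hs xs by (simp add: F_def take_map drop_map take_zip drop_zip)
    finally show "coface_op q i (m \<otimes> tpow_pure (map2 g xs hs)) = \<dots>" .
  qed
  also have "\<dots> = tensor_lift (\<lambda>b1 b2. sw (Suc q) (\<lambda>xs.
      tensor_lift (\<lambda>c d. F b1 b2 (take i xs @ c # d # drop (Suc i) xs)) (\<Delta> (xs ! i))) h) (\<Delta> (hs ! i))"
    by (rule tensor_lift_iter_sweedler_swap[symmetric])
  also have "\<dots> = tensor_lift (\<lambda>b1 b2. sw (Suc (Suc q)) (F b1 b2) h) (\<Delta> (hs ! i))"
  proof (rule tensor_lift_cong)
    fix b1 b2
    show "sw (Suc q) (\<lambda>xs. tensor_lift
        (\<lambda>c d. F b1 b2 (take i xs @ c # d # drop (Suc i) xs)) (\<Delta> (xs ! i))) h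
      = sw (Suc (Suc q)) (F b1 b2) h"
      using sw_comult_nth[OF ml, of b1 b2 h] i by (simp del: iter_sweedler.simps)
  qed
  finally show ?thesis by (simp only: F_def[abs_def])
qed

lemma codeg_op_sw:
  fixes g :: "'h \<Rightarrow> 'h \<Rightarrow> 'h"
  assumes g: "bilinear g" and j: "j < q" and hs: "length hs = Suc q"
    and counit_g: "\<And>x b. \<epsilon> (g x b) = \<epsilon> x * \<epsilon> b"
  shows "sw (Suc q) (\<lambda>xs. codeg_op q j (m \<otimes> tpow_pure (map2 g xs hs))) h
    = \<epsilon> (hs ! Suc j) *\<^sub>C sw q (\<lambda>zs.
        m \<otimes> tpow_pure (map2 g zs (take (Suc j) hs @ drop (Suc (Suc j)) hs))) h"
proof -
  have gl: "clinear (\<lambda>a. g a b)" "clinear (g a)" for a b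
    using g by (simp_all add: bilinear_iff)
  define F where "F zs = m \<otimes> tpow_pure (map2 g zs (take (Suc j) hs @ drop (Suc (Suc j)) hs))" for zs
  have ml: "multilinear_upon (Suc j + (q - Suc j)) F"
    unfolding F_def using hs j by (intro linear_intros gl) simp_all
  have "sw (Suc q) (\<lambda>xs. codeg_op q j (m \<otimes> tpow_pure (map2 g xs hs))) h
    = sw (Suc q) (\<lambda>xs. \<epsilon> (hs ! Suc j) *\<^sub>C \<epsilon> (xs ! Suc j) *\<^sub>C
        F (take (Suc j) xs @ drop (Suc (Suc j)) xs)) h"
    using j hs
    by (intro iter_sweedler_cong)
      (simp add: codeg_op_nth F_def take_map drop_map take_zip drop_zip counit_g scaleC_scaleC mult.commute)
  also have "\<dots> = \<epsilon> (hs ! Suc j) *\<^sub>C sw q F h"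
  proof -
    have "sw (Suc q) (\<lambda>xs. \<epsilon> (xs ! Suc j) *\<^sub>C F (take (Suc j) xs @ drop (Suc (Suc j)) xs)) h
      = sw q F h"
      using sw_counit_nth[OF ml, of h] j by (simp del: iter_sweedler.simps)
    then show ?thesis by (simp only: iter_sweedler_scaleC)
  qed
  finally show ?thesis by (simp only: F_def[abs_def])
qed

lemma comult_mult_pure:
  "\<Delta> (b * x) = tensor_lift (\<lambda>b1 b2. tensor_lift (\<lambda>c d. (b1 * c) \<otimes> (b2 * d)) (\<Delta> x)) (\<Delta> b)"
  using comult_mult_lift[OF bilinear_tensor_pure, of b x] by simp

text \<open>The outer sum runs over the right factor, as \<open>coface_op_sw\<close> requires for
  the left action, where that factor is the entry of the chain and x is a component of the acting
  element.\<close>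

lemma comult_mult_pure':
  "\<Delta> (x * b) = tensor_lift (\<lambda>b1 b2. tensor_lift (\<lambda>c d. (c * b1) \<otimes> (d * b2)) (\<Delta> x)) (\<Delta> b)"
  by (subst tensor_lift_swap) (rule comult_mult_pure)

lemma bilinear_mult: "bilinear ((*) :: 'h \<Rightarrow> 'h \<Rightarrow> 'h)" "bilinear (\<lambda>x y :: 'h. y * x)"
  by (intro linear_intros)+

lemma coface_op_balancing:
  assumes i: "i \<le> q" and y: "y \<in> bal (Suc q)"
  shows "coface_op q i y \<in> bal (Suc (Suc q))"
proof (rule balancing_map_into[OF clinear_coface_op[OF i] csubspace_bal y])
  fix m h and hs :: "'h list"
  assume hs: "length hs = Suc q"
  show "coface_op q i (act m h \<otimes> tpow_pure hs)
    - sw (Suc q) (\<lambda>xs. coface_op q i (m \<otimes> tpow_pure (map2 (*) xs hs))) h \<in> bal (Suc (Suc q))"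
    unfolding coface_op_nth[OF i hs] coface_op_sw[OF bilinear_mult(1) i hs comult_mult_pure']
    using i hs by (intro tensor_lift_sub_in csubspace_bal balancing_pure) simp
qed

lemma codeg_op_balancing:
  assumes j: "j < q" and y: "y \<in> bal (Suc q)"
  shows "codeg_op q j y \<in> bal q"
proof (rule balancing_map_into[OF clinear_codeg_op[OF j] csubspace_bal y])
  fix m h and hs :: "'h list"
  assume hs: "length hs = Suc q"
  show "codeg_op q j (act m h \<otimes> tpow_pure hs)
    - sw (Suc q) (\<lambda>xs. codeg_op q j (m \<otimes> tpow_pure (map2 (*) xs hs))) h \<in> bal q"
    unfolding codeg_op_nth[OF j hs] codeg_op_sw[OF bilinear_mult(1) j hs counit_mult]
      complex_vector.scale_right_diff_distrib[symmetric]
    using j hs by (intro complex_vector.subspace_scale csubspace_bal balancing_pure) simp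
qed

text \<open>Left multiplication by the balancing element and right multiplication by u commute by
  associativity.\<close>

lemma lastr_balancing:
  assumes y: "y \<in> bal (Suc q)"
  shows "lastr q u y \<in> bal (Suc q)"
proof (rule balancing_map_into[OF clinear_lastr csubspace_bal y])
  fix m h and hs :: "'h list"
  assume "length hs = Suc q"
  then obtain as a where hs: "hs = as @ [a]" "length as = q"
    by (metis length_Suc_conv_rev)
  have "sw (Suc q) (\<lambda>xs. lastr q u (m \<otimes> tpow_pure (map2 (*) xs hs))) h
    = sw (Suc q) (\<lambda>xs. m \<otimes> tpow_pure (map2 (*) xs (as @ [a * u]))) h"
  proof (rule iter_sweedler_cong)
    fix xs :: "'h list" assume "length xs = Suc q"
    then obtain ys b where "xs = ys @ [b]" "length ys = q"
      by (metis length_Suc_conv_rev)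
    then show "lastr q u (m \<otimes> tpow_pure (map2 (*) xs hs)) = m \<otimes> tpow_pure (map2 (*) xs (as @ [a * u]))"
      by (simp add: hs lastr_pure mult.assoc)
  qed
  then show "lastr q u (act m h \<otimes> tpow_pure hs)
    - sw (Suc q) (\<lambda>xs. lastr q u (m \<otimes> tpow_pure (map2 (*) xs hs))) h \<in> bal (Suc q)"
    using balancing_pure[of "as @ [a * u]" "Suc q" m h] by (simp add: hs lastr_pure del: iter_sweedler.simps)
qed

lemma map2_mult_assoc: "map2 (*) (map2 (*) xs ys) zs = map2 (*) xs (map2 (*) ys zs)"
  for xs :: "'h list"
proof (induction xs arbitrary: ys zs)
  case (Cons x xs)
  then show ?case by (cases ys; cases zs) (simp_all add: mult.assoc)
qed simp

lemma diag_balancing: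
  assumes y: "y \<in> bal (Suc q)"
  shows "diag q u y \<in> bal (Suc q)"
proof (rule balancing_map_into[OF clinear_diag csubspace_bal y])
  fix m h and hs :: "'h list"
  assume hs: "length hs = Suc q"
  have 1: "diag q u (act m h \<otimes> tpow_pure hs) = sw (Suc q) (\<lambda>us. act m h \<otimes> tpow_pure (map2 (*) hs us)) u"
    by (rule diag_pure[OF hs])
  have "sw (Suc q) (\<lambda>xs. diag q u (m \<otimes> tpow_pure (map2 (*) xs hs))) h
    = sw (Suc q) (\<lambda>xs. sw (Suc q) (\<lambda>us. m \<otimes> tpow_pure (map2 (*) xs (map2 (*) hs us))) u) h"
    using hs by (intro iter_sweedler_cong) (simp add: diag_pure map2_mult_assoc del: iter_sweedler.simps)
  also have "\<dots> = sw (Suc q) (\<lambda>us. sw (Suc q) (\<lambda>xs. m \<otimes> tpow_pure (map2 (*) xs (map2 (*) hs us))) h) u"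
    by (rule iter_sweedler_swap)
  finally show "diag q u (act m h \<otimes> tpow_pure hs)
    - sw (Suc q) (\<lambda>xs. diag q u (m \<otimes> tpow_pure (map2 (*) xs hs))) h \<in> bal (Suc q)"
    unfolding 1 iter_sweedler_diff[symmetric] using hs
    by (simp only: iter_sweedler_diff[symmetric])
      (intro iter_sweedler_in_subspace csubspace_bal balancing_pure, simp)
qed

text \<open>The anti-Yetter-Drinfeld condition turns the last factor into S(h_3) x h_1 h_0 and the
  module element into m' h_2. Balancing moves h_2 onto all factors, its last component cancels
  against S(h_3), and what remains is the rotation of the left diagonal action: h_1 has acted on h_0
  and the other components on the remaining factors.\<close>

lemma cyc_balancing:
  assumes y: "y \<in> bal (Suc q)"
  shows "cyc q y \<in> bal (Suc q)"
proof (rule balancing_map_into[OF clinear_cyc csubspace_bal y])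
  fix m h and hs' :: "'h list"
  assume "length hs' = Suc q"
  then obtain h0 hs where hs': "hs' = h0 # hs" and hs: "length hs = q"
    by (auto simp: length_Suc_conv)
  \<comment> \<open>The summand after h2 has been moved from \<open>m'\<close> to the factors. Only
    this move is modulo \<open>bal\<close>; everything after it is an equality.\<close>
  define P where "P h1 h2 h3 = tensor_lift (\<lambda>x m'. sw (Suc q) (\<lambda>ys.
    m' \<otimes> tpow_pure (map2 (*) ys (hs @ [S h3 * x * h1 * h0]))) h2) (coact m)" for h1 h2 h3
  have P: "clinear (\<lambda>x. P x b c)" "clinear (\<lambda>x. P a x c)" "clinear (\<lambda>x. P a b x)" for a b c
    unfolding P_def using hs by (intro linear_intros; simp)+
  have "cyc q (act m h \<otimes> tpow_pure hs') = tensor_lift (\<lambda>g h3. tensor_lift (\<lambda>h1 h2.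
      tensor_lift (\<lambda>x m'. act m' h2 \<otimes> tpow_pure (hs @ [S h3 * x * h1 * h0])) (coact m)) (\<Delta> g)) (\<Delta> h)"
    unfolding hs' cyc_pure[OF hs] by (rule coact_act) (intro linear_intros)
  then have 1: "cyc q (act m h \<otimes> tpow_pure hs') - tensor_lift (\<lambda>g h3. tensor_lift (\<lambda>h1 h2.
      P h1 h2 h3) (\<Delta> g)) (\<Delta> h) \<in> bal (Suc q)"
    unfolding P_def using hs
    by (simp only:) (intro tensor_lift_sub_in csubspace_bal balancing_pure, simp)
  have collapse: "tensor_lift (\<lambda>h2 h3. P h1 h2 h3) (\<Delta> h')
    = tensor_lift (\<lambda>x m'. sw q (\<lambda>xs. m' \<otimes> tpow_pure (map2 (*) xs hs @ [x * (h1 * h0)])) h') (coact m)" for h1 h'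
  proof -
    \<comment> \<open>The argument c isolates what stands in front of x in the last factor. It is b
      S(h3), with b the last component of h2, and contracts to 1.\<close>
    define Q where "Q a c = tensor_lift (\<lambda>x m'. sw q (\<lambda>xs.
      m' \<otimes> tpow_pure (map2 (*) xs hs @ [c * (x * (h1 * h0))])) a) (coact m)" for a c
    have Q: "clinear (\<lambda>a. Q a c)" "clinear (Q a)" for a c
      unfolding Q_def using hs by (intro linear_intros; simp)+
    have "P h1 h2 h3 = tensor_lift (\<lambda>a b. Q a (b * S h3)) (\<Delta> h2)" for h2 h3
    proof -
      have "sw (Suc q) (\<lambda>ys. m' \<otimes> tpow_pure (map2 (*) ys (hs @ [S h3 * x * h1 * h0]))) h2
        = tensor_lift (\<lambda>a b. sw q (\<lambda>xs. m' \<otimes> tpow_pure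
            (map2 (*) xs hs @ [b * S h3 * (x * (h1 * h0))])) a) (\<Delta> h2)" for x m'
      proof -
        have "multilinear_upon (Suc q) (\<lambda>ys. m' \<otimes> tpow_pure (map2 (*) ys (hs @ [S h3 * x * h1 * h0])))"
          using hs by (intro linear_intros) simp
        from sw_snoc[OF this, of h2] show ?thesis
          using hs by (simp add: mult.assoc cong: iter_sweedler_cong)
      qed
      note eq = this
      show ?thesis
        unfolding P_def Q_def eq by (rule tensor_lift_swap)
    qed
    then have "tensor_lift (\<lambda>h2 h3. P h1 h2 h3) (\<Delta> h')
      = tensor_lift (\<lambda>h2 h3. tensor_lift (\<lambda>a b. Q a (b * S h3)) (\<Delta> h2)) (\<Delta> h')"
      by simp
    also have "\<dots> = tensor_lift (\<lambda>a z. tensor_lift (\<lambda>b h3. Q a (b * S h3)) (\<Delta> z)) (\<Delta> h')"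
      by (rule comult_coassoc; intro Q clinear_compose[OF Q(2)] linear_intros)
    also have "\<dots> = tensor_lift (\<lambda>a z. \<epsilon> z *\<^sub>C Q a 1) (\<Delta> h')"
      by (intro tensor_lift_cong comult_antipode_right Q)
    also have "\<dots> = Q h' 1"
      by (intro comult_counit_right Q)
    finally show ?thesis by (simp add: Q_def)
  qed
  have "tensor_lift (\<lambda>g h3. tensor_lift (\<lambda>h1 h2. P h1 h2 h3) (\<Delta> g)) (\<Delta> h)
    = tensor_lift (\<lambda>h1 h'. tensor_lift (\<lambda>h2 h3. P h1 h2 h3) (\<Delta> h')) (\<Delta> h)"
    by (rule comult_coassoc; intro P)
  also have "\<dots> = sw (Suc q) (\<lambda>xs. cyc q (m \<otimes> tpow_pure (map2 (*) xs hs'))) h"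
    unfolding collapse using hs
    by (simp add: hs' cyc_pure tensor_lift_iter_sweedler_swap mult.assoc cong: iter_sweedler_cong)
  finally show "cyc q (act m h \<otimes> tpow_pure hs')
    - sw (Suc q) (\<lambda>xs. cyc q (m \<otimes> tpow_pure (map2 (*) xs hs'))) h \<in> bal (Suc q)"
    using 1 by simp
qed

lemma coface_op_diag:
  assumes i: "i \<le> q" and y: "y \<in> chain_space (Suc q)"
  shows "coface_op q i (diag q u y) = diag (Suc q) u (coface_op q i y)"
proof (rule chain_space_eqI[OF _ _ y])
  fix m :: 'n and hs :: "'h list"
  assume hs: "length hs = Suc q"
  have flip: "map2 (*) as bs = map2 (\<lambda>x y. y * x) bs as" for as bs :: "'h list"
    by (rule map2_flip)
  show "coface_op q i (diag q u (m \<otimes> tpow_pure hs)) = diag (Suc q) u (coface_op q i (m \<otimes> tpow_pure hs))"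
    unfolding diag_pure[OF hs] clinear_iter_sweedler_commute[OF clinear_coface_op[OF i]]
      coface_op_nth[OF i hs] clinear_tensor_lift_commute[OF clinear_diag] flip[of hs]
    using i hs
    by (subst coface_op_sw[OF bilinear_mult(2) i hs comult_mult_pure])
      (simp add: diag_pure flip[of "take i hs @ _"] del: iter_sweedler.simps)
qed (use i in \<open>intro linear_intros; assumption\<close>)+

lemma codeg_op_diag:
  assumes j: "j < q" and y: "y \<in> chain_space (Suc q)"
  shows "codeg_op q j (diag q u y) = diag (q - 1) u (codeg_op q j y)"
proof (rule chain_space_eqI[OF _ _ y])
  fix m :: 'n and hs :: "'h list"
  assume hs: "length hs = Suc q"
  have flip: "map2 (*) as bs = map2 (\<lambda>x y. y * x) bs as" for as bs :: "'h list"
    by (rule map2_flip)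
  have q: "Suc (q - 1) = q" using j by simp
  show "codeg_op q j (diag q u (m \<otimes> tpow_pure hs)) = diag (q - 1) u (codeg_op q j (m \<otimes> tpow_pure hs))"
    unfolding diag_pure[OF hs] clinear_iter_sweedler_commute[OF clinear_codeg_op[OF j]]
      codeg_op_nth[OF j hs] clinear_scaleC[OF clinear_diag] flip[of hs]
    using j hs
    by (subst codeg_op_sw[OF bilinear_mult(2) j hs])
      (simp_all add: diag_pure flip[of "take (Suc j) hs @ _"] counit_mult mult.commute q
        del: iter_sweedler.simps One_nat_def)
qed (use j in \<open>intro linear_intros; assumption\<close>)+

subsection \<open>Cocyclic identities on chains\<close>

text \<open>For j = i + 1 both sides split one factor into three, so this is coassociativity.
  Otherwise two different factors are split and the sums are interchanged.\<close>

lemma coface_coface: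
  assumes ij: "i < j" "j \<le> Suc q" and y: "y \<in> chain_space (Suc q)"
  shows "coface_op (Suc q) j (coface_op q i y) = coface_op (Suc q) i (coface_op q (j - 1) y)"
proof (rule chain_space_eqI[OF _ _ y])
  fix m :: 'n and hs :: "'h list"
  assume hs: "length hs = Suc q"
  obtain xs h ys where 1: "hs = xs @ h # ys" "length xs = i"
    using split_at_nth[of i hs] ij hs by auto
  show "coface_op (Suc q) j (coface_op q i (m \<otimes> tpow_pure hs))
    = coface_op (Suc q) i (coface_op q (j - 1) (m \<otimes> tpow_pure hs))"
  proof (cases "j = Suc i")
    case True
    have len: "i + length ys = q" using 1 hs by simp
    have A: "coface_op (Suc q) (Suc i) (m \<otimes> tpow_pure (xs @ a # b # ys))
      = tensor_lift (\<lambda>c d. m \<otimes> tpow_pure (xs @ a # c # d # ys)) (\<Delta> b)" for a b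
      using coface_op_pure[of "xs @ [a]" "Suc i" ys "Suc q" m b] 1 len by simp
    have B: "coface_op (Suc q) i (m \<otimes> tpow_pure (xs @ a # b # ys))
      = tensor_lift (\<lambda>c d. m \<otimes> tpow_pure (xs @ c # d # b # ys)) (\<Delta> a)" for a b
      using coface_op_pure[of xs i "b # ys" "Suc q" m a] 1 len by simp
    have lin: "clinear (coface_op (Suc q) (Suc i))" "clinear (coface_op (Suc q) i)"
      using len by (intro clinear_coface_op; simp)+
    show ?thesis
      unfolding True 1(1)
      using 1 len
      by (simp add: coface_op_pure clinear_tensor_lift_commute[OF lin(1)]
          clinear_tensor_lift_commute[OF lin(2)] A B)
        (rule comult_coassoc[symmetric]; intro linear_intros)
  next
    case False
    \<comment> \<open>The factor at position j after the first coface is the one at position j - 1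
      of \<open>hs\<close>, hence at index j - (i + 2) of \<open>ys\<close>, which starts at
      position i + 1.\<close>
    obtain zs k ws where 2: "ys = zs @ k # ws" "length zs = j - Suc (Suc i)"
      by (rule split_at_nth[of "j - Suc (Suc i)" ys]) (use ij hs 1 False that in auto)
    have len: "j = Suc (Suc (i + length zs))" "q = Suc (i + length zs + length ws)"
      using 1 2 ij False hs by auto
    have A: "coface_op (Suc q) j (m \<otimes> tpow_pure (xs @ a # b # zs @ k # ws))
      = tensor_lift (\<lambda>c d. m \<otimes> tpow_pure (xs @ a # b # zs @ c # d # ws)) (\<Delta> k)" for a b
      using coface_op_pure[of "xs @ a # b # zs" j ws "Suc q" m k] 1 len by simp
    have B: "coface_op q (j - 1) (m \<otimes> tpow_pure (xs @ h # zs @ k # ws))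
      = tensor_lift (\<lambda>c d. m \<otimes> tpow_pure (xs @ h # zs @ c # d # ws)) (\<Delta> k)"
      using coface_op_pure[of "xs @ h # zs" "j - 1" ws q m k] 1 len by simp
    have C: "coface_op (Suc q) i (m \<otimes> tpow_pure (xs @ h # zs @ c # d # ws))
      = tensor_lift (\<lambda>a b. m \<otimes> tpow_pure (xs @ a # b # zs @ c # d # ws)) (\<Delta> h)" for c d
      using coface_op_pure[of xs i "zs @ c # d # ws" "Suc q" m h] 1 len by simp
    have E: "coface_op q i (m \<otimes> tpow_pure (xs @ h # zs @ k # ws))
      = tensor_lift (\<lambda>a b. m \<otimes> tpow_pure (xs @ a # b # zs @ k # ws)) (\<Delta> h)"
      using coface_op_pure[of xs i "zs @ k # ws" q m h] 1 len by simp
    have lin: "clinear (coface_op (Suc q) j)" "clinear (coface_op (Suc q) i)"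
      using ij by (intro clinear_coface_op; simp)+
    show ?thesis
      unfolding 1(1) 2(1) E B clinear_tensor_lift_commute[OF lin(1)]
        clinear_tensor_lift_commute[OF lin(2)] A C
      by (rule tensor_lift_swap)
  qed
qed (use ij in \<open>intro linear_intros; simp\<close>)+

lemma codeg_codeg:
  assumes ij: "i \<le> j" "j + 2 \<le> q" and y: "y \<in> chain_space (Suc q)"
  shows "codeg_op (q - 1) j (codeg_op q i y) = codeg_op (q - 1) i (codeg_op q (Suc j) y)"
proof (rule chain_space_eqI[OF _ _ y])
  fix m :: 'n and hs :: "'h list"
  assume hs: "length hs = Suc q"
  obtain xs h ys where 1: "hs = xs @ h # ys" "length xs = Suc i"
    using split_at_nth[of "Suc i" hs] ij hs by auto
  obtain zs k ws where 2: "ys = zs @ k # ws" "length zs = j - i"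
    by (rule split_at_nth[of "j - i" ys]) (use ij hs 1 that in auto)
  have len: "j = i + length zs" "q = Suc (Suc (i + length zs + length ws))"
    using 1 2 ij hs by auto
  have A: "codeg_op (q - 1) j (m \<otimes> tpow_pure (xs @ zs @ k # ws)) = \<epsilon> k *\<^sub>C (m \<otimes> tpow_pure (xs @ zs @ ws))"
    using codeg_op_pure[of "xs @ zs" j ws "q - 1" m k] 1 len by simp
  have B: "codeg_op q (Suc j) (m \<otimes> tpow_pure (xs @ h # zs @ k # ws))
    = \<epsilon> k *\<^sub>C (m \<otimes> tpow_pure (xs @ h # zs @ ws))"
    using codeg_op_pure[of "xs @ h # zs" "Suc j" ws q m k] 1 len by simp
  have C: "codeg_op q i (m \<otimes> tpow_pure (xs @ h # zs @ k # ws)) = \<epsilon> h *\<^sub>C (m \<otimes> tpow_pure (xs @ zs @ k # ws))"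
    using 1 len by (intro codeg_op_pure) simp_all
  have E: "codeg_op (q - 1) i (m \<otimes> tpow_pure (xs @ h # zs @ ws)) = \<epsilon> h *\<^sub>C (m \<otimes> tpow_pure (xs @ zs @ ws))"
    using 1 len by (intro codeg_op_pure) simp_all
  have lin: "clinear (codeg_op (q - 1) j)" "clinear (codeg_op (q - 1) i)"
    using ij by (intro clinear_codeg_op; simp)+
  show "codeg_op (q - 1) j (codeg_op q i (m \<otimes> tpow_pure hs))
    = codeg_op (q - 1) i (codeg_op q (Suc j) (m \<otimes> tpow_pure hs))"
    unfolding 1(1) 2(1) B C clinear_scaleC[OF lin(1)] clinear_scaleC[OF lin(2)] A E
    by (simp add: scaleC_scaleC mult.commute)
qed (use ij in \<open>intro linear_intros; simp\<close>)+

lemma codeg_coface_less: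
  assumes ij: "i < j" "j \<le> q" and y: "y \<in> chain_space (Suc q)"
  shows "codeg_op (Suc q) j (coface_op q i y) = coface_op (q - 1) i (codeg_op q (j - 1) y)"
proof (rule chain_space_eqI[OF _ _ y])
  fix m :: 'n and hs :: "'h list"
  assume hs: "length hs = Suc q"
  obtain xs h ys where 1: "hs = xs @ h # ys" "length xs = i"
    using split_at_nth[of i hs] ij hs by auto
  obtain zs k ws where 2: "ys = zs @ k # ws" "length zs = j - Suc i"
    by (rule split_at_nth[of "j - Suc i" ys]) (use ij hs 1 that in auto)
  have len: "j = Suc (i + length zs)" "q = Suc (i + length zs + length ws)"
    using 1 2 ij hs by auto
  have A: "codeg_op (Suc q) j (m \<otimes> tpow_pure (xs @ a # b # zs @ k # ws))
    = \<epsilon> k *\<^sub>C (m \<otimes> tpow_pure (xs @ a # b # zs @ ws))" for a b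
    using codeg_op_pure[of "xs @ a # b # zs" j ws "Suc q" m k] 1 len by simp
  have B: "codeg_op q (j - 1) (m \<otimes> tpow_pure (xs @ h # zs @ k # ws))
    = \<epsilon> k *\<^sub>C (m \<otimes> tpow_pure (xs @ h # zs @ ws))"
    using codeg_op_pure[of "xs @ h # zs" "j - 1" ws q m k] 1 len by simp
  have C: "coface_op q i (m \<otimes> tpow_pure (xs @ h # zs @ k # ws))
    = tensor_lift (\<lambda>a b. m \<otimes> tpow_pure (xs @ a # b # zs @ k # ws)) (\<Delta> h)"
    using 1 len by (intro coface_op_pure) simp_all
  have E: "coface_op (q - 1) i (m \<otimes> tpow_pure (xs @ h # zs @ ws))
    = tensor_lift (\<lambda>a b. m \<otimes> tpow_pure (xs @ a # b # zs @ ws)) (\<Delta> h)"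
    using 1 len by (intro coface_op_pure) simp_all
  have lin: "clinear (codeg_op (Suc q) j)" "clinear (coface_op (q - 1) i)"
    using ij by (intro clinear_codeg_op clinear_coface_op; simp)+
  show "codeg_op (Suc q) j (coface_op q i (m \<otimes> tpow_pure hs))
    = coface_op (q - 1) i (codeg_op q (j - 1) (m \<otimes> tpow_pure hs))"
    unfolding 1(1) 2(1) B C clinear_scaleC[OF lin(2)] clinear_tensor_lift_commute[OF lin(1)] A E
    by (rule tensor_lift_scaleC)
qed (use ij in \<open>intro linear_intros; simp\<close>)+

text \<open>The coface fills positions j and j + 1, and the codegeneracy with index j removes
  position j + 1, the right component: this is the right counit axiom.\<close>

lemma codeg_coface_same:
  assumes j: "j \<le> q" and y: "y \<in> chain_space (Suc q)"
  shows "codeg_op (Suc q) j (coface_op q j y) = y"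
proof (rule chain_space_eqI[OF _ _ y])
  fix m :: 'n and hs :: "'h list"
  assume hs: "length hs = Suc q"
  obtain xs h ys where 1: "hs = xs @ h # ys" "length xs = j"
    using split_at_nth[of j hs] j hs by auto
  have len: "j + length ys = q" using 1 hs by auto
  have A: "codeg_op (Suc q) j (m \<otimes> tpow_pure (xs @ a # b # ys))
    = \<epsilon> b *\<^sub>C (m \<otimes> tpow_pure (xs @ a # ys))" for a b
    using codeg_op_pure[of "xs @ [a]" j ys "Suc q" m b] 1 len by simp
  have lin: "clinear (codeg_op (Suc q) j)"
    using j by (intro clinear_codeg_op; simp)
  show "codeg_op (Suc q) j (coface_op q j (m \<otimes> tpow_pure hs)) = m \<otimes> tpow_pure hs"
    using 1 len unfolding 1(1)
    by (simp add: coface_op_pure clinear_tensor_lift_commute[OF lin] A)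
      (rule comult_counit_right, intro linear_intros)
qed (use j in \<open>intro linear_intros; simp\<close>)+

text \<open>The coface fills positions j + 1 and j + 2, so position j + 1 holds the left component
  and the left counit axiom applies.\<close>

lemma codeg_coface_Suc:
  assumes j: "Suc j \<le> q" and y: "y \<in> chain_space (Suc q)"
  shows "codeg_op (Suc q) j (coface_op q (Suc j) y) = y"
proof (rule chain_space_eqI[OF _ _ y])
  fix m :: 'n and hs :: "'h list"
  assume hs: "length hs = Suc q"
  obtain xs h ys where 1: "hs = xs @ h # ys" "length xs = Suc j"
    using split_at_nth[of "Suc j" hs] j hs by auto
  have len: "Suc (j + length ys) = q" using 1 hs by auto
  have lin: "clinear (codeg_op (Suc q) j)"
    using j by (intro clinear_codeg_op; simp)
  show "codeg_op (Suc q) j (coface_op q (Suc j) (m \<otimes> tpow_pure hs)) = m \<otimes> tpow_pure hs"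
    using 1 len unfolding 1(1)
    by (simp add: coface_op_pure clinear_tensor_lift_commute[OF lin] codeg_op_pure)
      (rule comult_counit_left, intro linear_intros)
qed (use j in \<open>intro linear_intros; simp\<close>)+

lemma codeg_coface_greater:
  assumes ij: "Suc j < i" "i \<le> q" and y: "y \<in> chain_space (Suc q)"
  shows "codeg_op (Suc q) j (coface_op q i y) = coface_op (q - 1) (i - 1) (codeg_op q j y)"
proof (rule chain_space_eqI[OF _ _ y])
  fix m :: 'n and hs :: "'h list"
  assume hs: "length hs = Suc q"
  obtain xs h ys where 1: "hs = xs @ h # ys" "length xs = Suc j"
    using split_at_nth[of "Suc j" hs] ij hs by auto
  obtain zs k ws where 2: "ys = zs @ k # ws" "length zs = i - Suc (Suc j)"
    by (rule split_at_nth[of "i - Suc (Suc j)" ys]) (use ij hs 1 that in auto)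
  have len: "i = Suc (Suc (j + length zs))" "q = Suc (Suc (j + length zs + length ws))"
    using 1 2 ij hs by auto
  have A: "coface_op q i (m \<otimes> tpow_pure (xs @ h # zs @ k # ws))
    = tensor_lift (\<lambda>a b. m \<otimes> tpow_pure (xs @ h # zs @ a # b # ws)) (\<Delta> k)"
    using coface_op_pure[of "xs @ h # zs" i ws q m k] 1 len by simp
  have B: "coface_op (q - 1) (i - 1) (m \<otimes> tpow_pure (xs @ zs @ k # ws))
    = tensor_lift (\<lambda>a b. m \<otimes> tpow_pure (xs @ zs @ a # b # ws)) (\<Delta> k)"
    using coface_op_pure[of "xs @ zs" "i - 1" ws "q - 1" m k] 1 len by simp
  have C: "codeg_op (Suc q) j (m \<otimes> tpow_pure (xs @ h # zs @ a # b # ws))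
    = \<epsilon> h *\<^sub>C (m \<otimes> tpow_pure (xs @ zs @ a # b # ws))" for a b
    using 1 len by (intro codeg_op_pure) simp_all
  have E: "codeg_op q j (m \<otimes> tpow_pure (xs @ h # zs @ k # ws))
    = \<epsilon> h *\<^sub>C (m \<otimes> tpow_pure (xs @ zs @ k # ws))"
    using 1 len by (intro codeg_op_pure) simp_all
  have lin: "clinear (codeg_op (Suc q) j)" "clinear (coface_op (q - 1) (i - 1))"
    using ij by (intro clinear_codeg_op clinear_coface_op; simp)+
  show "codeg_op (Suc q) j (coface_op q i (m \<otimes> tpow_pure hs))
    = coface_op (q - 1) (i - 1) (codeg_op q j (m \<otimes> tpow_pure hs))"
    unfolding 1(1) 2(1) A E clinear_tensor_lift_commute[OF lin(1)] C clinear_scaleC[OF lin(2)] B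
    by (rule tensor_lift_scaleC)
qed (use ij in \<open>intro linear_intros; simp\<close>)+

text \<open>Only the factor at position 0 is rotated and twisted. The split factor merely moves one
  place forward, so the sums over the coaction and over its coproduct can be interchanged.\<close>

lemma twisted_cyc_coface:
  assumes i: "1 \<le> i" "i \<le> q" and y: "y \<in> chain_space (Suc q)"
  shows "twisted_cyc (Suc q) k (coface_op q i y) = coface_op q (i - 1) (twisted_cyc q k y)"
proof (rule chain_space_eqI[OF _ _ y])
  fix m :: 'n and hs :: "'h list"
  assume hs: "length hs = Suc q"
  obtain p where p: "i = Suc p" using i by (cases i) auto
  obtain h hs' where 0: "hs = h # hs'" using hs by (cases hs) auto
  obtain xs g ys where 1: "hs' = xs @ g # ys" "length xs = p"
    using split_at_nth[of p hs'] i hs 0 p by auto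
  have len: "q = Suc (p + length ys)"
    using 0 1 hs by simp
  have A: "coface_op q i (m \<otimes> tpow_pure hs)
    = tensor_lift (\<lambda>a b. m \<otimes> tpow_pure (h # xs @ a # b # ys)) (\<Delta> g)"
    using coface_op_pure[of "h # xs" i ys q m g] 0 1 p len by simp
  have lin: "clinear (coface_op q p)"
    using len by (intro clinear_coface_op) simp
  show "twisted_cyc (Suc q) k (coface_op q i (m \<otimes> tpow_pure hs))
    = coface_op q (i - 1) (twisted_cyc q k (m \<otimes> tpow_pure hs))"
    unfolding A clinear_tensor_lift_commute[OF clinear_twisted_cyc]
    using len 1(2)
    by (simp add: 0 1(1) p twisted_cyc_pure clinear_tensor_lift_commute[OF lin, unfolded len] coface_op_pure)
      (rule tensor_lift_swap)
qed (use i in \<open>intro linear_intros; simp\<close>)+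

lemma twisted_cyc_codeg:
  assumes i: "1 \<le> i" "i < q" and y: "y \<in> chain_space (Suc q)"
  shows "twisted_cyc (q - 1) k (codeg_op q i y) = codeg_op q (i - 1) (twisted_cyc q k y)"
proof (rule chain_space_eqI[OF _ _ y])
  fix m :: 'n and hs :: "'h list"
  assume hs: "length hs = Suc q"
  obtain p where p: "i = Suc p" using i by (cases i) auto
  obtain h hs' where 0: "hs = h # hs'" using hs by (cases hs) auto
  obtain xs g ys where 1: "hs' = xs @ g # ys" "length xs = Suc p"
    using split_at_nth[of "Suc p" hs'] i hs 0 p by auto
  have len: "q = Suc (Suc (p + length ys))"
    using 0 1 hs by simp
  have A: "codeg_op q i (m \<otimes> tpow_pure hs) = \<epsilon> g *\<^sub>C (m \<otimes> tpow_pure (h # xs @ ys))"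
    using codeg_op_pure[of "h # xs" i ys q m g] 0 1 p len by simp
  have lin: "clinear (codeg_op q p)"
    using len by (intro clinear_codeg_op) simp
  show "twisted_cyc (q - 1) k (codeg_op q i (m \<otimes> tpow_pure hs))
    = codeg_op q (i - 1) (twisted_cyc q k (m \<otimes> tpow_pure hs))"
    unfolding A clinear_scaleC[OF clinear_twisted_cyc]
    using len 1(2)
    by (simp add: 0 1(1) p twisted_cyc_pure clinear_tensor_lift_commute[OF lin, unfolded len] codeg_op_pure
        tensor_lift_scaleC)
qed (use i in \<open>intro linear_intros; simp\<close>)+

text \<open>
  The last coface is \<open>t \<circ> d\<^sub>0\<close>. The next two lemmas are the relations \<open>t\<^sub>q\<^sub>+\<^sub>1 d\<^sub>q\<^sub>+\<^sub>1 = d\<^sub>q t\<^sub>q\<close>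
  and \<open>s\<^sub>q d\<^sub>q\<^sub>+\<^sub>1 = id\<close> after this substitution; the sum over \<open>\<Delta> k\<close> accounts for the coaction of
  the source of the cochains.
\<close>

lemma twisted_cyc_twisted_cyc_coface_0:
  assumes y: "y \<in> chain_space (Suc q)"
  shows "tensor_lift (\<lambda>k1 k2. twisted_cyc (Suc q) k1 (twisted_cyc (Suc q) k2 (coface_op q 0 y))) (\<Delta> k)
    = coface_op q q (twisted_cyc q k y)"
proof (rule chain_space_eqI[OF _ _ y])
  fix m :: 'n and hs' :: "'h list"
  assume "length hs' = Suc q"
  then obtain h hs where hs': "hs' = h # hs" and hs: "length hs = q"
    by (cases hs') auto
  define F where "F x y m'' = tensor_lift (\<lambda>a b. tensor_lift (\<lambda>k1 k2.
      m'' \<otimes> tpow_pure (hs @ [x * a * S k2, y * b * S k1])) (\<Delta> k)) (\<Delta> h)" for x y and m'' :: 'n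
  have A: "coface_op q 0 (m \<otimes> tpow_pure hs') = tensor_lift (\<lambda>a b. m \<otimes> tpow_pure (a # b # hs)) (\<Delta> h)"
    using coface_op_pure[of "[]" 0 hs q m h] hs hs' by simp
  have lin: "clinear (coface_op q q)" by (intro clinear_coface_op) simp
  have "twisted_cyc (Suc q) k1 (twisted_cyc (Suc q) k2 (coface_op q 0 (m \<otimes> tpow_pure hs')))
    = tensor_lift (\<lambda>x m'. tensor_lift (\<lambda>y m''. tensor_lift (\<lambda>a b.
        m'' \<otimes> tpow_pure (hs @ [x * a * S k2, y * b * S k1])) (\<Delta> h)) (coact m')) (coact m)" for k1 k2
  proof -
    have "twisted_cyc (Suc q) k1 (twisted_cyc (Suc q) k2 (coface_op q 0 (m \<otimes> tpow_pure hs')))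
      = tensor_lift (\<lambda>a b. tensor_lift (\<lambda>x m'. tensor_lift (\<lambda>y m''.
        m'' \<otimes> tpow_pure (hs @ [x * a * S k2, y * b * S k1])) (coact m')) (coact m)) (\<Delta> h)"
      unfolding A clinear_tensor_lift_commute[OF clinear_twisted_cyc]
      using hs by (simp add: twisted_cyc_pure clinear_tensor_lift_commute[OF clinear_twisted_cyc])
    also have "\<dots> = tensor_lift (\<lambda>x m'. tensor_lift (\<lambda>a b. tensor_lift (\<lambda>y m''.
        m'' \<otimes> tpow_pure (hs @ [x * a * S k2, y * b * S k1])) (coact m')) (\<Delta> h)) (coact m)"
      by (rule tensor_lift_swap)
    also have "\<dots> = tensor_lift (\<lambda>x m'. tensor_lift (\<lambda>y m''. tensor_lift (\<lambda>a b.
        m'' \<otimes> tpow_pure (hs @ [x * a * S k2, y * b * S k1])) (\<Delta> h)) (coact m')) (coact m)"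
      by (intro tensor_lift_cong) (rule tensor_lift_swap)
    finally show ?thesis .
  qed
  then have "tensor_lift (\<lambda>k1 k2. twisted_cyc (Suc q) k1 (twisted_cyc (Suc q) k2
      (coface_op q 0 (m \<otimes> tpow_pure hs')))) (\<Delta> k)
    = tensor_lift (\<lambda>k1 k2. tensor_lift (\<lambda>x m'. tensor_lift (\<lambda>y m''. tensor_lift (\<lambda>a b.
        m'' \<otimes> tpow_pure (hs @ [x * a * S k2, y * b * S k1])) (\<Delta> h)) (coact m')) (coact m)) (\<Delta> k)"
    by simp
  also have "\<dots> = tensor_lift (\<lambda>x m'. tensor_lift (\<lambda>k1 k2. tensor_lift (\<lambda>y m''. tensor_lift (\<lambda>a b.
        m'' \<otimes> tpow_pure (hs @ [x * a * S k2, y * b * S k1])) (\<Delta> h)) (coact m')) (\<Delta> k)) (coact m)"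
    by (rule tensor_lift_swap)
  also have "\<dots> = tensor_lift (\<lambda>x m'. tensor_lift (\<lambda>y m''. F x y m'') (coact m')) (coact m)"
    unfolding F_def
    by (intro tensor_lift_cong, subst tensor_lift_swap, intro tensor_lift_cong, rule tensor_lift_swap)
  \<comment> \<open>Coassociativity makes the two coaction terms the components of one x. The
    entries are now the components of x h S(k): since S reverses coproducts, the first one carries
    S(k2), which is why k2 belongs to the inner operator.\<close>
  also have "\<dots> = tensor_lift (\<lambda>x m'. tensor_lift (\<lambda>x1 x2. F x1 x2 m') (\<Delta> x)) (coact m)"
    unfolding F_def by (rule coact_coassoc[symmetric]; intro linear_intros)
  also have "\<dots> = tensor_lift (\<lambda>x m'. tensor_lift (\<lambda>c d. m' \<otimes> tpow_pure (hs @ [c, d]))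
      (\<Delta> (x * h * S k))) (coact m)"
  proof (rule tensor_lift_cong)
    fix x and m' :: 'n
    have bil: "bilinear (\<lambda>c d. m' \<otimes> tpow_pure (hs @ [c, d]))" by (intro linear_intros)
    have bil2: "bilinear (\<lambda>a b. tensor_lift (\<lambda>k1 k2. m' \<otimes> tpow_pure (hs @ [a * S k2, b * S k1])) (\<Delta> k))"
      by (intro linear_intros)
    have bil3: "bilinear (\<lambda>c d. m' \<otimes> tpow_pure (hs @ [a * c, b * d]))" for a b
      by (intro linear_intros)
    show "tensor_lift (\<lambda>x1 x2. F x1 x2 m') (\<Delta> x)
      = tensor_lift (\<lambda>c d. m' \<otimes> tpow_pure (hs @ [c, d])) (\<Delta> (x * h * S k))"
      unfolding comult_mult_lift[OF bil] comult_antipode_lift[OF bil3] comult_mult_lift[OF bil2] F_def ..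
  qed
  also have "\<dots> = coface_op q q (twisted_cyc q k (m \<otimes> tpow_pure hs'))"
    using hs coface_op_pure[of hs q "[]" q]
    by (simp add: hs' twisted_cyc_pure clinear_tensor_lift_commute[OF lin])
  finally show "tensor_lift (\<lambda>k1 k2. twisted_cyc (Suc q) k1 (twisted_cyc (Suc q) k2
      (coface_op q 0 (m \<otimes> tpow_pure hs')))) (\<Delta> k)
    = coface_op q q (twisted_cyc q k (m \<otimes> tpow_pure hs'))" .
qed (intro linear_intros; simp)+

lemma codeg_twisted_cyc_coface_0:
  assumes y: "y \<in> chain_space (Suc q)"
  shows "codeg_op (Suc q) q (twisted_cyc (Suc q) k (coface_op q 0 y)) = \<epsilon> k *\<^sub>C y"
proof (rule chain_space_eqI[OF _ _ y])
  fix m :: 'n and hs' :: "'h list"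
  assume "length hs' = Suc q"
  then obtain h hs where hs': "hs' = h # hs" and hs: "length hs = q"
    by (cases hs') auto
  have A: "coface_op q 0 (m \<otimes> tpow_pure hs') = tensor_lift (\<lambda>a b. m \<otimes> tpow_pure (a # b # hs)) (\<Delta> h)"
    using coface_op_pure[of "[]" 0 hs q m h] hs hs' by simp
  have lin: "clinear (codeg_op (Suc q) q)" by (intro clinear_codeg_op) simp
  have B: "codeg_op (Suc q) q (m' \<otimes> tpow_pure (b # hs @ [x]))
    = \<epsilon> x *\<^sub>C (m' \<otimes> tpow_pure (b # hs))" for b x m'
    using codeg_op_pure[of "b # hs" q "[]" "Suc q" m' x] hs by simp
  have "codeg_op (Suc q) q (twisted_cyc (Suc q) k (coface_op q 0 (m \<otimes> tpow_pure hs')))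
    = tensor_lift (\<lambda>a b. tensor_lift (\<lambda>x m'. \<epsilon> x *\<^sub>C (\<epsilon> a *\<^sub>C \<epsilon> k *\<^sub>C (m' \<otimes> tpow_pure (b # hs))))
        (coact m)) (\<Delta> h)"
    unfolding A clinear_tensor_lift_commute[OF clinear_twisted_cyc] using hs
    by (simp add: twisted_cyc_pure clinear_tensor_lift_commute[OF lin] B counit_mult counit_antipode
        scaleC_scaleC mult.assoc)
  also have "\<dots> = tensor_lift (\<lambda>a b. \<epsilon> a *\<^sub>C (\<epsilon> k *\<^sub>C (m \<otimes> tpow_pure (b # hs)))) (\<Delta> h)"
    by (intro tensor_lift_cong coact_counit linear_intros)
  also have "\<dots> = \<epsilon> k *\<^sub>C (m \<otimes> tpow_pure (h # hs))"
    by (intro comult_counit_left linear_intros)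
  finally show "codeg_op (Suc q) q (twisted_cyc (Suc q) k (coface_op q 0 (m \<otimes> tpow_pure hs')))
    = \<epsilon> k *\<^sub>C (m \<otimes> tpow_pure hs')" by (simp add: hs')
qed (intro linear_intros; simp)+

text \<open>After two rotations the factor g that s_0 would remove stands last, as y g S(k1). Its
  counit is \<epsilon>(y) \<epsilon>(g) \<epsilon>(k1); the counit axioms of the coaction and of
  \<open>\<Delta> k\<close> absorb \<epsilon>(y) and \<epsilon>(k1).\<close>

lemma twisted_cyc_codeg_0:
  assumes q: "1 \<le> q" and y: "y \<in> chain_space (Suc q)"
  shows "tensor_lift (\<lambda>k1 k2. codeg_op q (q - 1) (twisted_cyc q k1 (twisted_cyc q k2 y))) (\<Delta> k)
    = twisted_cyc (q - 1) k (codeg_op q 0 y)"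
proof (rule chain_space_eqI[OF _ _ y])
  fix m :: 'n and hs' :: "'h list"
  assume "length hs' = Suc q"
  then obtain h g hs where hs': "hs' = h # g # hs" and hs: "q = Suc (length hs)"
    using q by (cases hs'; cases "tl hs'") auto
  have lin: "clinear (codeg_op q (length hs))" using hs by (intro clinear_codeg_op) simp
  have A: "codeg_op q 0 (m \<otimes> tpow_pure (h # g # hs)) = \<epsilon> g *\<^sub>C (m \<otimes> tpow_pure (h # hs))"
    using codeg_op_pure[of "[h]" 0 hs q m g] hs by simp
  have B: "codeg_op q (length hs) (m' \<otimes> tpow_pure (hs @ [x, y])) = \<epsilon> y *\<^sub>C (m' \<otimes> tpow_pure (hs @ [x]))"
    for x y m'
    using codeg_op_pure[of "hs @ [x]" "length hs" "[]" q m' y] hs by simp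
  have "codeg_op q (length hs) (twisted_cyc q k1 (twisted_cyc q k2 (m \<otimes> tpow_pure hs')))
    = tensor_lift (\<lambda>x m'. tensor_lift (\<lambda>y m''. \<epsilon> y *\<^sub>C (\<epsilon> g *\<^sub>C \<epsilon> k1 *\<^sub>C (m'' \<otimes> tpow_pure (hs @ [x * h * S k2]))))
        (coact m')) (coact m)" for k1 k2
    unfolding hs' using hs
    by (simp add: twisted_cyc_pure clinear_tensor_lift_commute[OF clinear_twisted_cyc]
        clinear_tensor_lift_commute[OF lin, unfolded hs] B[unfolded hs] counit_mult counit_antipode
        scaleC_scaleC mult.assoc)
  also have "\<dots> k1 k2 = tensor_lift (\<lambda>x m'. \<epsilon> g *\<^sub>C \<epsilon> k1 *\<^sub>C (m' \<otimes> tpow_pure (hs @ [x * h * S k2]))) (coact m)"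
    for k1 k2
    by (intro tensor_lift_cong coact_counit linear_intros)
  also have "\<dots> k1 k2 = \<epsilon> k1 *\<^sub>C \<epsilon> g *\<^sub>C tensor_lift (\<lambda>x m'. m' \<otimes> tpow_pure (hs @ [x * h * S k2])) (coact m)"
    for k1 k2
    by (simp add: tensor_lift_scaleC scaleC_scaleC mult.commute)
  finally have "tensor_lift (\<lambda>k1 k2. codeg_op q (length hs) (twisted_cyc q k1 (twisted_cyc q k2
      (m \<otimes> tpow_pure hs')))) (\<Delta> k)
    = tensor_lift (\<lambda>k1 k2. \<epsilon> k1 *\<^sub>C \<epsilon> g *\<^sub>C
        tensor_lift (\<lambda>x m'. m' \<otimes> tpow_pure (hs @ [x * h * S k2])) (coact m)) (\<Delta> k)"
    by simp
  also have "\<dots> = \<epsilon> g *\<^sub>C tensor_lift (\<lambda>x m'. m' \<otimes> tpow_pure (hs @ [x * h * S k])) (coact m)"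
    by (intro comult_counit_left linear_intros)
  also have "\<dots> = \<epsilon> g *\<^sub>C twisted_cyc (length hs) k (m \<otimes> tpow_pure (h # hs))"
    by (simp add: twisted_cyc_pure)
  finally show "tensor_lift (\<lambda>k1 k2. codeg_op q (q - 1) (twisted_cyc q k1 (twisted_cyc q k2
      (m \<otimes> tpow_pure hs')))) (\<Delta> k) = twisted_cyc (q - 1) k (codeg_op q 0 (m \<otimes> tpow_pure hs'))"
    unfolding hs' A clinear_scaleC[OF clinear_twisted_cyc] by (simp add: hs)
qed (use q in \<open>intro linear_intros; simp\<close>)+

section \<open>The last coface on chains\<close>

lemma
  shows clinear_last_coface: "clinear (last_coface_pre \<Delta> coact q)"
    and last_coface_pure: "length hs = q \<Longrightarrow> last_coface_pre \<Delta> coact q (m \<otimes> tpow_pure (h # hs))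
      = tensor_lift (\<lambda>a b. tensor_lift (\<lambda>x m'. m' \<otimes> tpow_pure (b # hs @ [x * a])) (coact m)) (\<Delta> h)"
proof -
  have 1: "multilinear_upon (Suc q) (\<lambda>hs. tensor_lift (\<lambda>a b. tensor_lift (\<lambda>x m'.
    m' \<otimes> tpow_pure (b # drop (Suc 0) hs @ [x * a])) (coact m)) (\<Delta> (hs ! 0)))" for m :: 'n
    using multilinear_upon_nth[where i = 0 and n = "Suc q" and G = "\<lambda>xs h ys.
      tensor_lift (\<lambda>a b. tensor_lift (\<lambda>x m'. m' \<otimes> tpow_pure (b # ys @ [x * a])) (coact m)) (\<Delta> h)"]
    by (simp add: linear_intros)
  have ml: "multilinear_upon (Suc q) (\<lambda>hs. tensor_lift (\<lambda>a b. tensor_lift (\<lambda>x m'.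
    m' \<otimes> tpow_pure (b # tl hs @ [x * a])) (coact m)) (\<Delta> (hd hs)))" for m :: 'n
    by (rule multilinear_upon_cong[OF 1[of m]]) (auto simp: length_Suc_conv)
  show "clinear (last_coface_pre \<Delta> coact q)"
    unfolding last_coface_pre_def by (rule clinear_degree_lift, intro linear_intros, rule ml)
  show "length hs = q \<Longrightarrow> last_coface_pre \<Delta> coact q (m \<otimes> tpow_pure (h # hs))
      = tensor_lift (\<lambda>a b. tensor_lift (\<lambda>x m'. m' \<otimes> tpow_pure (b # hs @ [x * a])) (coact m)) (\<Delta> h)"
    unfolding last_coface_pre_def
    by (subst degree_lift_pure, intro linear_intros, rule ml) simp_all
qed

lemma last_coface_eq_cyc_coface_0:
  assumes y: "y \<in> chain_space (Suc q)"
  shows "last_coface_pre \<Delta> coact q y = cyc (Suc q) (coface_op q 0 y)"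
proof (rule chain_space_eqI[OF clinear_last_coface _ y])
  show "clinear (\<lambda>y. cyc (Suc q) (coface_op q 0 y))" by (intro linear_intros) simp_all
  fix m :: 'n and hs' :: "'h list"
  assume "length hs' = Suc q"
  then obtain h hs where hs': "hs' = h # hs" and hs: "length hs = q"
    by (cases hs') auto
  then show "last_coface_pre \<Delta> coact q (m \<otimes> tpow_pure hs') = cyc (Suc q) (coface_op q 0 (m \<otimes> tpow_pure hs'))"
    using coface_op_pure[of "[]" 0 hs q m h]
    by (simp add: last_coface_pure clinear_tensor_lift_commute[OF clinear_cyc] cyc_pure)
qed

subsection \<open>Powers of the cyclic operator\<close>

text \<open>Rotating \<open>as\<close> past \<open>bs\<close> one factor at a time; the general
  \<open>bs\<close> is required by the induction, although the full rotation has \<open>bs\<close>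
  empty. The coactions of N are merged by coassociativity, so each rotated factor receives one
  component of a single x.\<close>

lemma foldr_twisted_cyc:
  "length ks = length as \<Longrightarrow> length as + length bs = Suc q \<Longrightarrow>
    foldr (twisted_cyc q) ks (m \<otimes> tpow_pure (as @ bs))
    = tensor_lift (\<lambda>x m'. sw (length as) (\<lambda>xs.
        m' \<otimes> tpow_pure (bs @ map2 (*) xs (map2 (*) as (map S (rev ks))))) x) (coact m)"
proof (induction ks arbitrary: as bs)
  case Nil
  then show ?case by (simp add: coact_counit linear_intros)
next
  case (Cons k ks)
  \<comment> \<open>\<open>foldr\<close> applies the head k last, so k meets the last entry of
    \<open>as\<close>. This is the origin of \<open>rev\<close> in the statement.\<close>
  then obtain as' a where as: "as = as' @ [a]" and len: "length as' = length ks"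
    by (metis length_Suc_conv_rev length_Cons)
  define zs where "zs = map2 (*) as' (map S (rev ks))"
  have zs: "length zs = length as'" using len by (simp add: zs_def)
  have "foldr (twisted_cyc q) (k # ks) (m \<otimes> tpow_pure (as @ bs))
    = twisted_cyc q k (foldr (twisted_cyc q) ks (m \<otimes> tpow_pure (as' @ a # bs)))"
    by (simp add: as)
  also have "\<dots> = twisted_cyc q k (tensor_lift (\<lambda>x m'. sw (length as') (\<lambda>xs.
      m' \<otimes> tpow_pure (a # bs @ map2 (*) xs zs)) x) (coact m))"
    using Cons.IH[of as' "a # bs"] Cons.prems len by (simp add: as zs_def)
  also have "\<dots> = tensor_lift (\<lambda>x m'. sw (length as') (\<lambda>xs. tensor_lift (\<lambda>y m''.
      m'' \<otimes> tpow_pure (bs @ map2 (*) xs zs @ [y * a * S k])) (coact m')) x) (coact m)"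
    unfolding clinear_tensor_lift_commute[OF clinear_twisted_cyc]
      clinear_iter_sweedler_commute[OF clinear_twisted_cyc]
    using Cons.prems zs
    by (intro tensor_lift_cong iter_sweedler_cong) (simp add: twisted_cyc_pure as)
  also have "\<dots> = tensor_lift (\<lambda>x m'. tensor_lift (\<lambda>y m''. sw (length as') (\<lambda>xs.
      m'' \<otimes> tpow_pure (bs @ map2 (*) xs zs @ [y * a * S k])) x) (coact m')) (coact m)"
    by (simp add: tensor_lift_iter_sweedler_swap)
  also have "\<dots> = tensor_lift (\<lambda>x m'. tensor_lift (\<lambda>x1 x2. sw (length as') (\<lambda>xs.
      m' \<otimes> tpow_pure (bs @ map2 (*) xs zs @ [x2 * a * S k])) x1) (\<Delta> x)) (coact m)"
    using zs by (intro coact_coassoc[symmetric] linear_intros; simp)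
  also have "\<dots> = tensor_lift (\<lambda>x m'. sw (length as) (\<lambda>xs.
      m' \<otimes> tpow_pure (bs @ map2 (*) xs (map2 (*) as (map S (rev (k # ks)))))) x) (coact m)"
  proof (rule tensor_lift_cong)
    fix x m'
    have length_as: "length as = Suc (length as')" by (simp add: as)
    have as_zs: "map2 (*) as (map S (rev (k # ks))) = zs @ [a * S k]"
      using len by (simp add: as zs_def)
    have "multilinear_upon (Suc (length as')) (\<lambda>xs. m' \<otimes> tpow_pure (bs @ map2 (*) xs (zs @ [a * S k])))"
      using zs by (intro linear_intros) simp
    from sw_snoc[OF this, of x]
    show "tensor_lift (\<lambda>x1 x2. sw (length as') (\<lambda>xs.
      m' \<otimes> tpow_pure (bs @ map2 (*) xs zs @ [x2 * a * S k])) x1) (\<Delta> x)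
      = sw (length as) (\<lambda>xs.
      m' \<otimes> tpow_pure (bs @ map2 (*) xs (map2 (*) as (map S (rev (k # ks)))))) x"
      unfolding as_zs length_as using zs by (simp add: mult.assoc del: iter_sweedler.simps cong: iter_sweedler_cong)
  qed
  finally show ?case .
qed

lemma sw_foldr_twisted_cyc:
  assumes y: "y \<in> chain_space (Suc q)"
  shows "sw (Suc q) (\<lambda>ks. foldr (twisted_cyc q) ks y) k - diag q (S k) y \<in> bal (Suc q)"
proof (rule chain_space_in_subspaceI[OF _ csubspace_bal y])
  have "clinear (\<lambda>y. foldr (twisted_cyc q) ks y)" for ks
    by (induction ks) (simp_all add: linear_intros)
  then show "clinear (\<lambda>y. sw (Suc q) (\<lambda>ks. foldr (twisted_cyc q) ks y) k - diag q (S k) y)"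
    by (intro clinear_minus clinear_iter_sweedler_param clinear_diag)
  fix m :: 'n and as :: "'h list"
  assume as: "length as = Suc q"
  \<comment> \<open>The components of S k are the antipodes of the components of k in reverse order,
    the very order that the iterated rotation produces.\<close>
  have "multilinear_upon (Suc q) (\<lambda>xs. m \<otimes> tpow_pure (map2 (*) as xs))"
    using as by (intro linear_intros) simp
  then have "diag q (S k) (m \<otimes> tpow_pure as)
    = sw (Suc q) (\<lambda>ks. m \<otimes> tpow_pure (map2 (*) as (map S (rev ks)))) k"
    unfolding diag_pure[OF as] by (rule sw_antipode)
  moreover have "foldr (twisted_cyc q) ks (m \<otimes> tpow_pure as)
    - m \<otimes> tpow_pure (map2 (*) as (map S (rev ks))) \<in> bal (Suc q)" if ks: "length ks = Suc q" for ks
  proof -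
    define zs where "zs = map2 (*) as (map S (rev ks))"
    have zs: "length zs = Suc q" using as ks by (simp add: zs_def)
    have "foldr (twisted_cyc q) ks (m \<otimes> tpow_pure as)
      = tensor_lift (\<lambda>x m'. sw (Suc q) (\<lambda>xs. m' \<otimes> tpow_pure (map2 (*) xs zs)) x) (coact m)"
      using foldr_twisted_cyc[of ks as "[]" q m] as ks by (simp add: zs_def del: iter_sweedler.simps foldr.simps)
    \<comment> \<open>Stability of N is read backwards to insert the action of x, so that the
      difference becomes a sum of balancing relations.\<close>
    moreover have "m \<otimes> tpow_pure zs = tensor_lift (\<lambda>x m'. act m' x \<otimes> tpow_pure zs) (coact m)"
      by (rule coact_stable[symmetric]) (intro linear_intros)
    moreover have "tensor_lift (\<lambda>x m'. act m' x \<otimes> tpow_pure zs) (coact m)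
      - tensor_lift (\<lambda>x m'. sw (Suc q) (\<lambda>xs. m' \<otimes> tpow_pure (map2 (*) xs zs)) x) (coact m) \<in> bal (Suc q)"
      by (intro tensor_lift_sub_in csubspace_bal balancing_pure zs)
    ultimately show ?thesis
      using complex_vector.subspace_neg[OF csubspace_bal] by (fastforce simp: zs_def[symmetric])
  qed
  ultimately show "sw (Suc q) (\<lambda>ks. foldr (twisted_cyc q) ks (m \<otimes> tpow_pure as)) k
    - diag q (S k) (m \<otimes> tpow_pure as) \<in> bal (Suc q)"
    by (simp add: iter_sweedler_diff[symmetric] iter_sweedler_in_subspace[OF csubspace_bal]
        del: iter_sweedler.simps foldr.simps)
qed

subsection \<open>Preservation of degrees\<close>

lemma coface_op_closed:
  assumes "i \<le> q" "y \<in> chain_space (Suc q)"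
  shows "coface_op q i y \<in> chain_space (Suc (Suc q))"
  using assms
  by (intro chain_space_in_subspaceI[OF clinear_coface_op csubspace_tensor_space assms(2)])
    (auto simp: coface_op_nth intro!: tensor_lift_in_subspace csubspace_tensor_space
      pure_in_chain_space)

lemma codeg_op_closed:
  assumes "j < q" "y \<in> chain_space (Suc q)"
  shows "codeg_op q j y \<in> chain_space q"
  using assms
  by (intro chain_space_in_subspaceI[OF clinear_codeg_op csubspace_tensor_space assms(2)])
    (auto simp: codeg_op_nth intro!: complex_vector.subspace_scale csubspace_tensor_space
      pure_in_chain_space)

lemma twisted_cyc_closed:
  assumes "y \<in> chain_space (Suc q)"
  shows "twisted_cyc q k y \<in> chain_space (Suc q)"
proof (rule chain_space_in_subspaceI[OF clinear_twisted_cyc csubspace_tensor_space assms])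
  fix m :: 'n and hs :: "'h list"
  assume "length hs = Suc q"
  then show "twisted_cyc q k (m \<otimes> tpow_pure hs) \<in> chain_space (Suc q)"
    by (cases hs) (auto simp: twisted_cyc_pure intro!: tensor_lift_in_subspace
        csubspace_tensor_space pure_in_chain_space)
qed

lemma cyc_closed:
  assumes "y \<in> chain_space (Suc q)"
  shows "cyc q y \<in> chain_space (Suc q)"
proof (rule chain_space_in_subspaceI[OF clinear_cyc csubspace_tensor_space assms])
  fix m :: 'n and hs :: "'h list"
  assume "length hs = Suc q"
  then show "cyc q (m \<otimes> tpow_pure hs) \<in> chain_space (Suc q)"
    by (cases hs) (auto simp: cyc_pure intro!: tensor_lift_in_subspace
        csubspace_tensor_space pure_in_chain_space)
qed

lemma bal_subset_chain_space: "bal n \<subseteq> chain_space n"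
proof
  fix y :: "('n, 'h tpow) tensor"
  assume "y \<in> bal n"
  then show "y \<in> chain_space n"
    by (rule balancing_map_into[OF clinear_id csubspace_tensor_space])
      (intro complex_vector.subspace_diff csubspace_tensor_space iter_sweedler_in_subspace
        pure_in_chain_space; simp)
qed

lemma clinear_diag_param [linear_intros]: "clinear g \<Longrightarrow> clinear (\<lambda>x. diag q (g x) y)"
proof -
  have iter: "clinear (iter_comult \<Delta> \<epsilon> n)" for n
  proof -
    have "multilinear_upon n (tpow_pure :: 'h list \<Rightarrow> _)" by (intro linear_intros)
    then show ?thesis
      using clinear_sw_compose[OF _ clinear_id] by (simp add: iter_comult_eq_sw[abs_def])
  qed
  have "clinear (\<lambda>u. if length hs = Suc q
      then m \<otimes> tpow_mult (tpow_pure hs) (iter_comult \<Delta> \<epsilon> (Suc q) u) else 0)"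
    for m :: 'n and hs :: "'h list"
  proof (cases "length hs = Suc q")
    case True
    then show ?thesis
      by (simp del: iter_comult.simps) (intro linear_intros iter)
  qed (simp add: clinear_iff)
  then have "clinear (\<lambda>u. diag q u y)"
    unfolding diag_right_pre_def degree_lift_def by (intro linear_intros)
  then show "clinear g \<Longrightarrow> clinear (\<lambda>x. diag q (g x) y)" by (rule clinear_compose)
qed

lemma multilinear_upon_foldr_twisted_cyc:
  "multilinear_upon n (\<lambda>ks. foldr (twisted_cyc q) ks y)"
proof (rule multilinear_uponI)
  fix as bs :: "'h list"
  have "clinear (foldr (twisted_cyc q) as)"
    by (induction as) (simp_all add: linear_intros id_def comp_def)
  then show "clinear (\<lambda>a. foldr (twisted_cyc q) (as @ a # bs) y)"
    by simp (rule clinear_compose, assumption, intro linear_intros)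
qed

end

section \<open>The cocommutative Hopf subalgebra\<close>

locale hopf_sayd_pair =
  hopf_sayd_module \<Delta> \<epsilon> S act coact + hopf_subalgebra \<Delta> \<epsilon> S K
  for \<Delta> :: "'h::complex_algebra_1 \<Rightarrow> ('h, 'h) tensor"
    and \<epsilon> :: "'h \<Rightarrow> complex"
    and S :: "'h \<Rightarrow> 'h"
    and act :: "'n::complex_vector \<Rightarrow> 'h \<Rightarrow> 'n"
    and coact :: "'n \<Rightarrow> ('h, 'n) tensor"
    and K :: "'h set" +
  fixes actV :: "'v::complex_vector \<Rightarrow> 'h \<Rightarrow> 'v"
    and coactV :: "'v \<Rightarrow> ('h, 'v) tensor"
  assumes cocommutative: "cocommutative_on \<Delta> K"
    and saydV: "sayd_module_on K \<Delta> \<epsilon> S actV coactV"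
begin

lemma comult_cocommutative:
  assumes F: "bilinear F" and u: "u \<in> K"
  shows "tensor_lift (\<lambda>a b. F b a) (\<Delta> u) = tensor_lift F (\<Delta> u)"
proof -
  have "tensor_lift (\<lambda>a b. b \<otimes> a) (\<Delta> u) = \<Delta> u"
    using cocommutative u by (simp add: cocommutative_on_def)
  from arg_cong[OF this, of "tensor_lift F"] show ?thesis
    by (simp add: clinear_tensor_lift_commute[OF clinear_tensor_lift[OF F]] tensor_lift_pure[OF F])
qed

text \<open>One use of cocommutativity suffices, on the split of u into one component and the
  remaining n: the recursion of \<open>sw\<close> peels off the front component and
  \<open>sw_snoc\<close> the back one.\<close>

lemma sw_rotate1:
  assumes F: "multilinear_upon (Suc n) F" and u: "u \<in> K"
  shows "sw (Suc n) (\<lambda>xs. F (rotate1 xs)) u = sw (Suc n) F u"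
proof -
  have "bilinear (\<lambda>a b. sw n (\<lambda>xs. F (xs @ [b])) a)"
    by (intro linear_intros clinear_multilinear[OF F]; simp)
  from comult_cocommutative[OF this u] show ?thesis
    unfolding sw_snoc[OF F] by simp
qed

text \<open>Evaluate S(S(c_1)) S(c_2) c_3 in two ways. The last two factors cancel to leave S(S(c));
  the first two equal S(c_2 S(c_1)), which cocommutativity turns into S(c_1 S(c_2)), so that they
  cancel and leave c.\<close>

lemma antipode_antipode:
  assumes c: "c \<in> K"
  shows "S (S c) = c"
proof -
  define G where "G c1 c2 c3 = S (S c1) * (S c2 * c3)" for c1 c2 c3
  have G: "clinear (\<lambda>x. G x b d)" "clinear (\<lambda>x. G a x d)" "clinear (\<lambda>x. G a b x)" for a b d
    unfolding G_def by (intro linear_intros)+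
  have inner: "tensor_lift (\<lambda>c1 c2. G c1 c2 c3) (\<Delta> p) = \<epsilon> p *\<^sub>C c3" if p: "p \<in> K" for p c3
  proof -
    have G': "G c1 c2 c3 = S (c2 * S c1) * c3" for c1 c2
      by (simp add: G_def antipode_mult mult.assoc)
    have bil: "bilinear (\<lambda>a b. S (a * S b) * c3)" by (intro linear_intros)
    have "tensor_lift (\<lambda>c1 c2. G c1 c2 c3) (\<Delta> p) = tensor_lift (\<lambda>a b. S (a * S b) * c3) (\<Delta> p)"
      unfolding G' by (rule comult_cocommutative[OF bil p])
    also have "\<dots> = \<epsilon> p *\<^sub>C (S 1 * c3)"
      by (rule comult_antipode_right) (intro linear_intros)
    finally show ?thesis by (simp add: antipode_one)
  qed
  have "tensor_lift (\<lambda>p c3. tensor_lift (\<lambda>c1 c2. G c1 c2 c3) (\<Delta> p)) (\<Delta> c)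
    = tensor_lift (\<lambda>p c3. \<epsilon> p *\<^sub>C c3) (\<Delta> c)"
    \<comment> \<open>\<open>inner\<close> uses cocommutativity at p and holds only for p in K;
      closure of K under the coproduct supplies such p.\<close>
    by (rule tensor_lift_cong_on[OF comult_closed[OF c]]) (intro linear_intros G, intro linear_intros, rule inner)
  also have "\<dots> = c"
    by (rule comult_counit_left) (intro linear_intros)
  finally have "c = tensor_lift (\<lambda>p c3. tensor_lift (\<lambda>c1 c2. G c1 c2 c3) (\<Delta> p)) (\<Delta> c)" by simp
  also have "\<dots> = tensor_lift (\<lambda>c1 z. tensor_lift (\<lambda>c2 c3. G c1 c2 c3) (\<Delta> z)) (\<Delta> c)"
    by (rule comult_coassoc; intro G)
  also have "\<dots> = tensor_lift (\<lambda>c1 z. \<epsilon> z *\<^sub>C (S (S c1) * 1)) (\<Delta> c)"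
    unfolding G_def by (intro tensor_lift_cong comult_antipode_left linear_intros)
  also have "\<dots> = S (S c)"
    by (subst comult_counit_right) (intro linear_intros, simp)
  finally show ?thesis by simp
qed

text \<open>Each component of u stays attached to its factor, so rotating the factors rotates the
  components, and \<open>sw_rotate1\<close> undoes this for u in K. The coaction multiplies on the
  left and does not interfere.\<close>

lemma cyc_diag:
  assumes u: "u \<in> K" and y: "y \<in> chain_space (Suc q)"
  shows "cyc q (diag q u y) = diag q u (cyc q y)"
proof (rule chain_space_eqI[OF _ _ y])
  fix m :: 'n and hs' :: "'h list"
  assume len: "length hs' = Suc q"
  then obtain h hs where hs': "hs' = h # hs" and hs: "length hs = q"
    by (cases hs') auto
  define F where "F zs = tensor_lift (\<lambda>z m'. m' \<otimes> tpow_pure (map2 (*) (hs @ [z * h]) zs)) (coact m)" for zs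
  have F: "multilinear_upon (Suc q) F"
    unfolding F_def using hs by (intro linear_intros) simp
  have "cyc q (diag q u (m \<otimes> tpow_pure hs'))
    = sw (Suc q) (\<lambda>xs. cyc q (m \<otimes> tpow_pure (map2 (*) hs' xs))) u"
    unfolding diag_pure[OF len] by (rule clinear_iter_sweedler_commute[OF clinear_cyc])
  also have "\<dots> = sw (Suc q) (\<lambda>xs. F (rotate1 xs)) u"
  proof (rule iter_sweedler_cong)
    fix xs :: "'h list" assume "length xs = Suc q"
    then obtain x xs' where "xs = x # xs'" "length xs' = q" by (cases xs) auto
    then show "cyc q (m \<otimes> tpow_pure (map2 (*) hs' xs)) = F (rotate1 xs)"
      using hs by (simp add: hs' cyc_pure F_def mult.assoc)
  qed
  also have "\<dots> = sw (Suc q) F u"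
    by (rule sw_rotate1[OF F u])
  also have "\<dots> = tensor_lift (\<lambda>z m'. diag q u (m' \<otimes> tpow_pure (hs @ [z * h]))) (coact m)"
    unfolding F_def using hs
    by (simp add: diag_pure tensor_lift_iter_sweedler_swap[symmetric] del: iter_sweedler.simps)
  also have "\<dots> = diag q u (cyc q (m \<otimes> tpow_pure hs'))"
    unfolding hs' cyc_pure[OF hs] by (rule clinear_tensor_lift_commute[OF clinear_diag, symmetric])
  finally show "cyc q (diag q u (m \<otimes> tpow_pure hs')) = diag q u (cyc q (m \<otimes> tpow_pure hs'))" .
qed (intro linear_intros)+

text \<open>
  In Sweedler notation the summand is \<open>\<dots> \<otimes> w u\<^sub>(\<^sub>2\<^sub>) S(u\<^sub>(\<^sub>1\<^sub>)) S(x) S\<^sup>2(u\<^sub>(\<^sub>3\<^sub>))\<close>; on \<open>K\<close> the square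
  of \<open>S\<close> is the identity and cocommutativity cancels the two middle factors.
\<close>

lemma lastr_diag:
  assumes u: "u \<in> K" and y: "y \<in> chain_space (Suc q)"
  shows "tensor_lift (\<lambda>g u3. tensor_lift (\<lambda>u1 u2. lastr q (S (S u3 * x * u1)) (diag q u2 y)) (\<Delta> g)) (\<Delta> u)
    = diag q u (lastr q (S x) y)"
proof (rule chain_space_eqI[OF _ _ y])
  fix m :: 'n and ws' :: "'h list"
  assume len: "length ws' = Suc q"
  then obtain ws w where ws': "ws' = ws @ [w]" and ws: "length ws = q"
    by (metis length_Suc_conv_rev)
  define H where "H a b = sw q (\<lambda>xs. m \<otimes> tpow_pure (map2 (*) ws xs @ [w * b])) a" for a b
  have H: "clinear (\<lambda>a. H a b)" "clinear (H a)" for a b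
    unfolding H_def using ws by (intro linear_intros; simp)+
  have H' [linear_intros]: "clinear g \<Longrightarrow> clinear (\<lambda>x. H (g x) b)" "clinear g \<Longrightarrow> clinear (\<lambda>x. H a (g x))"
    for a b and g :: "'h \<Rightarrow> 'h"
    using clinear_compose H by blast+
  have left: "lastr q z (diag q u2 (m \<otimes> tpow_pure ws')) = tensor_lift (\<lambda>a b. H a (b * z)) (\<Delta> u2)" for z u2
  proof -
    have ml: "multilinear_upon (Suc q) (\<lambda>xs. lastr q z (m \<otimes> tpow_pure (map2 (*) ws' xs)))"
      using len by (intro linear_intros) simp
    show ?thesis
      unfolding diag_pure[OF len] clinear_iter_sweedler_commute[OF clinear_lastr] sw_snoc[OF ml] H_def
      using ws by (simp add: ws' lastr_pure mult.assoc cong: iter_sweedler_cong)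
  qed
  have right: "diag q u (lastr q z (m \<otimes> tpow_pure ws')) = tensor_lift (\<lambda>a b. H a (z * b)) (\<Delta> u)" for z
  proof -
    have len': "length (ws @ [w * z]) = Suc q" using ws by simp
    have ml: "multilinear_upon (Suc q) (\<lambda>xs. m \<otimes> tpow_pure (map2 (*) (ws @ [w * z]) xs))"
      using ws by (intro linear_intros) simp
    show ?thesis
      unfolding ws' lastr_pure[OF ws] diag_pure[OF len'] sw_snoc[OF ml] H_def
      using ws by (simp add: mult.assoc cong: iter_sweedler_cong)
  qed
  have inner: "tensor_lift (\<lambda>u1 u2. tensor_lift (\<lambda>a b. H a (b * S (S u3 * x * u1))) (\<Delta> u2)) (\<Delta> g)
    = H g (S x * S (S u3))" if g: "g \<in> K" for g u3
  proof -
    have bil: "bilinear (\<lambda>u2 u1. tensor_lift (\<lambda>a b. H a (b * S (S u3 * x * u1))) (\<Delta> u2))"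
      by (intro linear_intros)
    have "tensor_lift (\<lambda>u1 u2. tensor_lift (\<lambda>a b. H a (b * S (S u3 * x * u1))) (\<Delta> u2)) (\<Delta> g)
      = tensor_lift (\<lambda>u2 u1. tensor_lift (\<lambda>a b. H a (b * S (S u3 * x * u1))) (\<Delta> u2)) (\<Delta> g)"
      by (rule comult_cocommutative[OF bil g])
    also have "\<dots> = tensor_lift (\<lambda>a z. tensor_lift (\<lambda>b u1. H a (b * S (S u3 * x * u1))) (\<Delta> z)) (\<Delta> g)"
      by (rule comult_coassoc; intro linear_intros)
    also have "\<dots> = tensor_lift (\<lambda>a z. tensor_lift (\<lambda>b u1. H a (b * S u1 * (S x * S (S u3)))) (\<Delta> z)) (\<Delta> g)"
      by (simp add: antipode_mult mult.assoc)
    also have "\<dots> = tensor_lift (\<lambda>a z. \<epsilon> z *\<^sub>C H a (1 * (S x * S (S u3)))) (\<Delta> g)"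
      by (intro tensor_lift_cong comult_antipode_right linear_intros)
    also have "\<dots> = H g (1 * (S x * S (S u3)))"
      by (intro comult_counit_right linear_intros)
    finally show ?thesis by simp
  qed
  have "tensor_lift (\<lambda>g u3. tensor_lift (\<lambda>u1 u2.
      tensor_lift (\<lambda>a b. H a (b * S (S u3 * x * u1))) (\<Delta> u2)) (\<Delta> g)) (\<Delta> u)
    = tensor_lift (\<lambda>g u3. H g (S x * u3)) (\<Delta> u)"
    by (rule tensor_lift_cong_on[OF comult_closed[OF u]])
      (intro linear_intros, intro linear_intros, simp add: inner antipode_antipode)
  then show "tensor_lift (\<lambda>g u3. tensor_lift (\<lambda>u1 u2.
      lastr q (S (S u3 * x * u1)) (diag q u2 (m \<otimes> tpow_pure ws'))) (\<Delta> g)) (\<Delta> u)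
    = diag q u (lastr q (S x) (m \<otimes> tpow_pure ws'))"
    unfolding left right .
qed (intro linear_intros)+

subsection \<open>The coefficient module\<close>

text \<open>
  Only \<open>actV v u\<close> with \<open>u \<in> K\<close> matters. Precomposing with a projection onto \<open>K\<close> makes the
  action bilinear on the whole Hopf algebra.
\<close>

definition proj_K :: "'h \<Rightarrow> 'h"
  where "proj_K = (SOME \<pi>. clinear \<pi> \<and> (\<forall>x. \<pi> x \<in> K) \<and> (\<forall>x\<in>K. \<pi> x = x))"

definition actK :: "'v \<Rightarrow> 'h \<Rightarrow> 'v"
  where "actK v u = actV v (proj_K u)"

lemma proj_K: "clinear proj_K" "proj_K x \<in> K" "x \<in> K \<Longrightarrow> proj_K x = x"
proof -
  obtain \<pi> :: "'h \<Rightarrow> 'h" where "clinear \<pi>" "\<And>x. \<pi> x \<in> K" "\<And>x. x \<in> K \<Longrightarrow> \<pi> x = x"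
    using exists_projection[OF subspace] by metis
  then have "\<exists>\<pi> :: 'h \<Rightarrow> 'h. clinear \<pi> \<and> (\<forall>x. \<pi> x \<in> K) \<and> (\<forall>x\<in>K. \<pi> x = x)" by blast
  from someI_ex[OF this]
  show "clinear proj_K" "proj_K x \<in> K" "x \<in> K \<Longrightarrow> proj_K x = x"
    unfolding proj_K_def by blast+
qed

lemma actK_eq: "u \<in> K \<Longrightarrow> actK v u = actV v u"
  by (simp add: actK_def proj_K)

lemma bilinear_actK: "bilinear actK"
proof -
  have "bilinear_on UNIV K actV"
    using saydV by (simp add: sayd_module_on_def right_module_on_def)
  then show ?thesis
    using proj_K(2) clinear_add[OF proj_K(1)] clinear_scaleC[OF proj_K(1)]
    by (simp add: bilinear_on_def actK_def)
qed

lemma clinear_actK_left [linear_intros]: "clinear g \<Longrightarrow> clinear (\<lambda>x. actK (g x) h)"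
  and clinear_actK_right [linear_intros]: "clinear g' \<Longrightarrow> clinear (\<lambda>x. actK m (g' x))"
  using bilinear_actK clinear_compose unfolding bilinear_iff by blast+

lemma actK_one: "actK v 1 = v"
  using saydV one_closed by (simp add: actK_eq sayd_module_on_def right_module_on_def)

lemma actK_mult: "g \<in> K \<Longrightarrow> h \<in> K \<Longrightarrow> actK v (g * h) = actK (actK v g) h"
  using saydV mult_closed by (simp add: actK_eq sayd_module_on_def right_module_on_def)

lemma comoduleV: "left_comodule_on K \<Delta> \<epsilon> coactV"
  using saydV by (simp add: sayd_module_on_def)

lemma clinear_coactV_compose [linear_intros]: "clinear g \<Longrightarrow> clinear (\<lambda>x. coactV (g x))"
  using comoduleV clinear_compose[of coactV g] by (simp add: left_comodule_on_def)

lemma coactV_in: "coactV v \<in> tensor_space K UNIV"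
  using comoduleV by (simp add: left_comodule_on_def)

lemma coactV_coassoc:
  assumes "\<And>b c. clinear (\<lambda>a. F a b c)" "\<And>a c. clinear (\<lambda>b. F a b c)" "\<And>a b. clinear (F a b)"
  shows "tensor_lift (\<lambda>x v'. tensor_lift (\<lambda>y v''. F x y v'') (coactV v')) (coactV v)
    = tensor_lift (\<lambda>x v'. tensor_lift (\<lambda>a b. F a b v') (\<Delta> x)) (coactV v)"
proof -
  have bil: "bilinear (F a)" for a
    using assms by (intro linear_intros)
  have L: "bilinear (\<lambda>a t. tensor_lift (F a) t)"
    by (intro linear_intros assms bil)
  have "tensor_lift (\<lambda>h m'. tensor_lift (\<lambda>a b. a \<otimes> (b \<otimes> m')) (\<Delta> h)) (coactV v)
      = tensor_lift (\<lambda>h m'. h \<otimes> coactV m') (coactV v)"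
    using comoduleV by (simp add: left_comodule_on_def)
  from arg_cong[OF this, of "tensor_lift (\<lambda>a t. tensor_lift (F a) t)"]
  show ?thesis
    by (simp add: clinear_tensor_lift_commute[OF clinear_tensor_lift[OF L]] tensor_lift_pure[OF L]
        tensor_lift_pure[OF bil])
qed

lemma coactV_counit: "clinear F \<Longrightarrow> tensor_lift (\<lambda>x v'. \<epsilon> x *\<^sub>C F v') (coactV v) = F v"
proof -
  assume F: "clinear F"
  have "tensor_lift (\<lambda>x v'. \<epsilon> x *\<^sub>C v') (coactV v) = v"
    using comoduleV by (simp add: left_comodule_on_def)
  from arg_cong[OF this, of F] show ?thesis
    by (simp add: clinear_tensor_lift_commute[OF F] clinear_scaleC[OF F])
qed

lemma csubspace_UNIV: "csubspace UNIV"
  by simp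

lemma coactV_stable: "tensor_lift (\<lambda>x v'. actK v' x) (coactV v) = v"
proof -
  have "tensor_lift_on K UNIV (\<lambda>x v'. actV v' x) (coactV v) = v"
    using saydV by (simp add: sayd_module_on_def)
  moreover have "tensor_lift_on K UNIV (\<lambda>x v'. actV v' x) (coactV v)
    = tensor_lift (\<lambda>x v'. actK v' x) (coactV v)"
    by (intro tensor_lift_on_eq_tensor_lift[OF subspace csubspace_UNIV coactV_in] linear_intros)
      (simp add: actK_eq)
  ultimately show ?thesis by simp
qed

text \<open>Stability replaces v' by v'' y, and coassociativity turns the sum into v_0 x_2 S(x_1).
  Cocommutativity of K exchanges the components, and x_1 S(x_2) contracts by the antipode
  axiom.\<close>

lemma coactV_stable_antipode: "tensor_lift (\<lambda>x v'. actK v' (S x)) (coactV v) = v"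
proof -
  have "actK v' (S x) = tensor_lift (\<lambda>y v''. actK (actK v'' y) (S x)) (coactV v')" for x v'
  proof -
    have "clinear (\<lambda>v. actK v (S x))" by (intro linear_intros)
    from clinear_tensor_lift_commute[OF this, of "\<lambda>y v''. actK v'' y" "coactV v'"]
    show ?thesis by (simp add: coactV_stable)
  qed
  then have "tensor_lift (\<lambda>x v'. actK v' (S x)) (coactV v)
    = tensor_lift (\<lambda>x v'. tensor_lift (\<lambda>y v''. actK (actK v'' y) (S x)) (coactV v')) (coactV v)"
    by (intro tensor_lift_cong)
  also have "\<dots> = tensor_lift (\<lambda>x v'. tensor_lift (\<lambda>a b. actK (actK v' b) (S a)) (\<Delta> x)) (coactV v)"
    by (rule coactV_coassoc; intro linear_intros)
  also have "\<dots> = tensor_lift (\<lambda>x v'. \<epsilon> x *\<^sub>C v') (coactV v)"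
  proof (rule tensor_lift_cong_on[OF coactV_in])
    fix x v' assume x: "x \<in> K"
    have bil: "bilinear (\<lambda>a b. actK v' (a * S b))" by (intro linear_intros)
    have "tensor_lift (\<lambda>a b. actK (actK v' b) (S a)) (\<Delta> x)
      = tensor_lift (\<lambda>a b. actK v' (b * S a)) (\<Delta> x)"
      by (rule tensor_lift_cong_on[OF comult_closed[OF x]])
        (intro linear_intros, intro linear_intros, simp add: actK_mult antipode_closed)
    also have "\<dots> = tensor_lift (\<lambda>a b. actK v' (a * S b)) (\<Delta> x)"
      by (rule comult_cocommutative[OF bil x])
    also have "\<dots> = \<epsilon> x *\<^sub>C actK v' 1"
      by (intro comult_antipode_right linear_intros)
    finally show "tensor_lift (\<lambda>a b. actK (actK v' b) (S a)) (\<Delta> x) = \<epsilon> x *\<^sub>C v'"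
      by (simp add: actK_one)
  qed (intro linear_intros)+
  also have "\<dots> = v"
    by (rule coactV_counit) (rule clinear_id)
  finally show ?thesis .
qed

text \<open>The nested relative lifts of the anti-Yetter-Drinfeld condition are replaced from the
  inside out, since at each level \<open>actV\<close> and \<open>actK\<close> agree only for
  arguments in K.\<close>

lemma coactV_actV:
  assumes F: "bilinear F" and u: "u \<in> K"
  shows "tensor_lift F (coactV (actV v u)) = tensor_lift (\<lambda>g u3. tensor_lift (\<lambda>u1 u2.
    tensor_lift (\<lambda>x v'. F (S u3 * x * u1) (actK v' u2)) (coactV v)) (\<Delta> g)) (\<Delta> u)"
proof -
  have 1: "tensor_lift_on K UNIV (\<lambda>x m'. (S u3 * x * u1) \<otimes> actV m' u2) (coactV v)
    = tensor_lift (\<lambda>x m'. (S u3 * x * u1) \<otimes> actK m' u2) (coactV v)" if "u2 \<in> K" for u1 u2 u3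
    using that
    by (intro tensor_lift_on_eq_tensor_lift[OF subspace csubspace_UNIV coactV_in] linear_intros)
      (simp add: actK_eq)
  have 2: "tensor_lift_on K K (\<lambda>u1 u2.
      tensor_lift_on K UNIV (\<lambda>x m'. (S u3 * x * u1) \<otimes> actV m' u2) (coactV v)) (\<Delta> g)
    = tensor_lift (\<lambda>u1 u2. tensor_lift (\<lambda>x m'. (S u3 * x * u1) \<otimes> actK m' u2) (coactV v)) (\<Delta> g)"
    if "g \<in> K" for g u3
    by (intro tensor_lift_on_eq_tensor_lift[OF subspace subspace comult_closed[OF that]]
        linear_intros 1)
  have "coactV (actV v u) = tensor_lift_on K K (\<lambda>g u3. tensor_lift_on K K (\<lambda>u1 u2.
      tensor_lift_on K UNIV (\<lambda>x m'. (S u3 * x * u1) \<otimes> actV m' u2) (coactV v)) (\<Delta> g)) (\<Delta> u)"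
    using saydV u by (simp add: sayd_module_on_def)
  also have "\<dots> = tensor_lift (\<lambda>g u3. tensor_lift (\<lambda>u1 u2.
      tensor_lift (\<lambda>x m'. (S u3 * x * u1) \<otimes> actK m' u2) (coactV v)) (\<Delta> g)) (\<Delta> u)"
    by (intro tensor_lift_on_eq_tensor_lift[OF subspace subspace comult_closed[OF u]]
        linear_intros 2)
  finally show ?thesis
    by (simp add: clinear_tensor_lift_commute[OF clinear_tensor_lift[OF F]] tensor_lift_pure[OF F])
qed

end

section \<open>Cosets\<close>

lemma elt_set_plus_eq_iff:
  fixes x y :: "'a::complex_vector"
  assumes U: "csubspace U"
  shows "x +o U = y +o U \<longleftrightarrow> x - y \<in> U"
proof
  assume "x +o U = y +o U"
  moreover have "x \<in> x +o U"
    using complex_vector.subspace_0[OF U] by (force simp: elt_set_plus_def)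
  ultimately obtain u where "u \<in> U" "x = y + u" by (auto simp: elt_set_plus_def)
  then show "x - y \<in> U" by simp
next
  have sub: "x +o U \<subseteq> y +o U" if "x - y \<in> U" for x y
  proof
    fix z assume "z \<in> x +o U"
    then obtain u where u: "u \<in> U" "z = x + u" by (auto simp: elt_set_plus_def)
    then have "z = y + ((x - y) + u)" by simp
    then show "z \<in> y +o U"
      using complex_vector.subspace_add[OF U that u(1)] unfolding elt_set_plus_def by blast
  qed
  assume *: "x - y \<in> U"
  then have "y - x \<in> U" using complex_vector.subspace_neg[OF U, of "x - y"] by simp
  with * show "x +o U = y +o U" using sub by blast
qed

lemma subspace_plus_self: "csubspace U \<Longrightarrow> U + U = U"
  using complex_vector.subspace_add complex_vector.subspace_0
  by (force simp: set_plus_def)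

lemma coset_plus:
  "csubspace U \<Longrightarrow> (x +o U) + (y +o U) = (x + y) +o U"
  by (simp add: set_plus_rearrange subspace_plus_self)

lemma induced_coset:
  assumes D: "clinear D" and U: "csubspace U" and U': "csubspace U'"
    and DU: "\<And>u. u \<in> U \<Longrightarrow> D u \<in> U'"
  shows "induced U' D (x +o U) = D x +o U'"
proof -
  have "D ` (x +o U) + U' \<subseteq> D x +o U'"
  proof
    fix z assume "z \<in> D ` (x +o U) + U'"
    then obtain u w where "u \<in> U" "w \<in> U'" "z = D (x + u) + w"
      by (auto simp: set_plus_def elt_set_plus_def)
    then have "z = D x + (D u + w)" "D u + w \<in> U'"
      using complex_vector.subspace_add[OF U'] DU by (simp_all add: clinear_add[OF D] add.assoc)
    then show "z \<in> D x +o U'" unfolding elt_set_plus_def by blast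
  qed
  moreover have "D x +o U' \<subseteq> D ` (x +o U) + U'"
  proof
    fix z assume "z \<in> D x +o U'"
    then obtain w where "w \<in> U'" "z = D x + w" by (auto simp: elt_set_plus_def)
    moreover have "x \<in> x +o U"
      using complex_vector.subspace_0[OF U] by (force simp: elt_set_plus_def)
    ultimately show "z \<in> D ` (x +o U) + U'" by (auto simp: set_plus_def)
  qed
  ultimately show ?thesis unfolding induced_def by blast
qed

lemma coset_scale_coset:
  assumes U: "csubspace U"
  shows "coset_scale U c (x +o U) = (c *\<^sub>C x) +o U"
proof -
  have "clinear (scaleC c :: 'a \<Rightarrow> 'a)" by (intro linear_intros)
  then show ?thesis
    unfolding coset_scale_def
    by (rule induced_coset[OF _ U U]) (rule complex_vector.subspace_scale[OF U])
qed

text \<open>A bilinear choice G of representatives forces all decompositions of t into pure tensors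
  to give the same coset, so the union in \<open>coset_tensor_lift\<close> collapses to it.\<close>

lemma coset_tensor_lift_coset:
  fixes G :: "'a::complex_vector \<Rightarrow> 'b::complex_vector \<Rightarrow> 'c::complex_vector"
  assumes U: "csubspace U" and G: "bilinear G" and f: "\<And>a b. f a b = G a b +o U"
  shows "coset_tensor_lift U f t = tensor_lift G t +o U"
proof -
  \<comment> \<open>The empty sum of sets is {0} rather than the zero coset U; the added U corrects
    this.\<close>
  have sum: "(\<Sum>k\<in>A. x k +o U) + U = (\<Sum>k\<in>A. x k) +o U" if "finite A"
    for A :: "('a \<times> 'b) set" and x
    using that
  proof (induction A rule: finite_induct)
    case empty
    show ?case by simp
  next
    case (insert k A)
    then show ?case by (simp add: add.assoc coset_plus[OF U])
  qed
  have "(\<Sum>(a, b)\<in>Poly_Mapping.keys p. coset_scale U (Poly_Mapping.lookup p (a, b)) (f a b)) + U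
    = tensor_lift G t +o U" if "abs_tensor p = t" for p
    unfolding that[symmetric] tensor_lift_abs[OF G] free_lift_def
    by (simp add: f coset_scale_coset[OF U] case_prod_unfold)
      (rule sum[OF Poly_Mapping.finite_keys])
  moreover have "\<exists>p. abs_tensor p = t" by (metis tensor_cases)
  ultimately show ?thesis unfolding coset_tensor_lift_def by auto
qed

section \<open>Cochains\<close>

context hopf_sayd_pair
begin

text \<open>
  A cochain is represented by a linear map into the tensor product over the complex numbers that
  is equivariant modulo the balancing relations.
\<close>

definition equivariant :: "nat \<Rightarrow> ('v \<Rightarrow> ('n, 'h tpow) tensor) \<Rightarrow> bool"
  where "equivariant q r \<longleftrightarrow> clinear r \<and> (\<forall>v. r v \<in> chain_space (Suc q)) \<and>
    (\<forall>v. \<forall>u\<in>K. r (actV v u) - diag q u (r v) \<in> bal (Suc q))"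

definition cls :: "nat \<Rightarrow> ('v \<Rightarrow> ('n, 'h tpow) tensor) \<Rightarrow> 'v \<Rightarrow> ('n, 'h tpow) tensor set"
  where "cls q r = (\<lambda>v. r v +o bal (Suc q))"

lemma equivariantD:
  assumes "equivariant q r"
  shows "clinear r" "r v \<in> chain_space (Suc q)"
    "u \<in> K \<Longrightarrow> r (actV v u) - diag q u (r v) \<in> bal (Suc q)"
  using assms by (auto simp: equivariant_def)

lemma clinear_equivariant_compose: "equivariant q r \<Longrightarrow> clinear g \<Longrightarrow> clinear (\<lambda>x. r (g x))"
  using clinear_compose equivariantD(1) by blast

lemma cls_eqI: "(\<And>v. r v - r' v \<in> bal (Suc q)) \<Longrightarrow> cls q r = cls q r'"
  unfolding cls_def by (intro ext) (simp add: elt_set_plus_eq_iff[OF csubspace_bal])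

lemma cls_in_cochains:
  assumes r: "equivariant q r"
  shows "cls q r \<in> cochains \<Delta> \<epsilon> K actV act q"
proof -
  have "cls q r v \<in> balanced_tensor \<Delta> \<epsilon> act (Suc q)" for v
    unfolding cls_def balanced_tensor_def quotient_space_def using equivariantD(2)[OF r] by blast
  moreover have "cls q r (actV v u) = induced (bal (Suc q)) (diag q u) (cls q r v)" if "u \<in> K" for v u
    unfolding cls_def
    by (subst induced_coset[OF clinear_diag csubspace_bal csubspace_bal diag_balancing])
      (simp_all add: elt_set_plus_eq_iff[OF csubspace_bal] equivariantD(3)[OF r that])
  ultimately show ?thesis
    using clinear_add[OF equivariantD(1)[OF r]] clinear_scaleC[OF equivariantD(1)[OF r]]
    unfolding cochains_def
    by (simp add: cls_def coset_plus[OF csubspace_bal] coset_scale_coset[OF csubspace_bal])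
qed

text \<open>Arbitrary choices x v of representatives need not be linear in v. Subtracting a
  projection onto \<open>bal (Suc q)\<close> moves them into a fixed complement, where each coset
  has exactly one representative, and linearity of \<phi> then passes to r.\<close>

lemma cochain_cases:
  assumes \<phi>: "\<phi> \<in> cochains \<Delta> \<epsilon> K actV act q"
  obtains r where "equivariant q r" "\<phi> = cls q r"
proof -
  let ?U = "bal (Suc q)"
  have U: "csubspace ?U" by (rule csubspace_bal)
  obtain \<pi> where \<pi>: "clinear \<pi>" "\<And>x. \<pi> x \<in> ?U" "\<And>x. x \<in> ?U \<Longrightarrow> \<pi> x = x"
    using exists_projection[OF U] by metis
  have "\<forall>v. \<exists>x\<in>chain_space (Suc q). \<phi> v = x +o ?U"
    using \<phi> unfolding cochains_def balanced_tensor_def quotient_space_def by blast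
  then obtain x where x: "\<And>v. x v \<in> chain_space (Suc q)" "\<And>v. \<phi> v = x v +o ?U"
    by metis
  define r where "r v = x v - \<pi> (x v)" for v
  \<comment> \<open>The corrected representative depends only on the coset.\<close>
  have r_eq: "a - b \<in> ?U \<Longrightarrow> a - \<pi> a = b - \<pi> b" for a b
    using \<pi>(3)[of "a - b"] by (simp add: clinear_diff[OF \<pi>(1)] algebra_simps)
  have \<phi>r: "\<phi> v = r v +o ?U" for v
    unfolding x(2) elt_set_plus_eq_iff[OF U] r_def using \<pi>(2) by simp
  have "clinear r"
    unfolding clinear_iff
  proof (intro conjI allI)
    fix v w c
    have "\<phi> (v + w) = \<phi> v + \<phi> w" "\<phi> (c *\<^sub>C v) = coset_scale ?U c (\<phi> v)"
      using \<phi> by (simp_all add: cochains_def)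
    then have "x (v + w) - (x v + x w) \<in> ?U" "x (c *\<^sub>C v) - c *\<^sub>C x v \<in> ?U"
      by (simp_all add: x(2) coset_plus[OF U] coset_scale_coset[OF U] elt_set_plus_eq_iff[OF U])
    from this[THEN r_eq] show "r (v + w) = r v + r w" "r (c *\<^sub>C v) = c *\<^sub>C r v"
      by (simp_all add: r_def clinear_add[OF \<pi>(1)] clinear_scaleC[OF \<pi>(1)]
          complex_vector.scale_right_diff_distrib)
  qed
  moreover have "r v \<in> chain_space (Suc q)" for v
    unfolding r_def using x(1) \<pi>(2) bal_subset_chain_space
    by (intro complex_vector.subspace_diff csubspace_tensor_space) auto
  moreover have "r (actV v u) - diag q u (r v) \<in> ?U" if "u \<in> K" for v u
  proof -
    have "\<phi> (actV v u) = induced ?U (diag q u) (\<phi> v)"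
      using \<phi> that by (simp add: cochains_def)
    also have "\<dots> = diag q u (r v) +o ?U"
      unfolding \<phi>r by (intro induced_coset clinear_diag U diag_balancing)
    finally show ?thesis
      by (simp add: \<phi>r elt_set_plus_eq_iff[OF U])
  qed
  ultimately have "equivariant q r" by (simp add: equivariant_def)
  moreover have "\<phi> = cls q r" by (simp add: fun_eq_iff cls_def \<phi>r)
  ultimately show ?thesis by (rule that)
qed

section \<open>The operators on representatives\<close>

definition cyc_rep :: "nat \<Rightarrow> ('v \<Rightarrow> ('n, 'h tpow) tensor) \<Rightarrow> 'v \<Rightarrow> ('n, 'h tpow) tensor"
  where "cyc_rep q r v = tensor_lift (\<lambda>k v'. twisted_cyc q k (r v')) (coactV v)"

lemma equivariant_coface:
  assumes i: "i \<le> q" and r: "equivariant q r"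
  shows "equivariant (Suc q) (\<lambda>v. coface_op q i (r v))"
  unfolding equivariant_def
proof (intro conjI allI ballI)
  show "clinear (\<lambda>v. coface_op q i (r v))"
    by (intro linear_intros i equivariantD(1)[OF r])
  show "coface_op q i (r v) \<in> chain_space (Suc (Suc q))" for v
    by (intro coface_op_closed i equivariantD(2)[OF r])
  fix v u assume u: "u \<in> K"
  have "coface_op q i (r (actV v u) - diag q u (r v)) \<in> bal (Suc (Suc q))"
    by (intro coface_op_balancing i equivariantD(3)[OF r u])
  then show "coface_op q i (r (actV v u)) - diag (Suc q) u (coface_op q i (r v)) \<in> bal (Suc (Suc q))"
    by (simp add: clinear_diff[OF clinear_coface_op[OF i]] coface_op_diag[OF i equivariantD(2)[OF r]])
qed

lemma equivariant_codeg:
  assumes j: "j < q" and r: "equivariant q r"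
  shows "equivariant (q - 1) (\<lambda>v. codeg_op q j (r v))"
  unfolding equivariant_def
proof (intro conjI allI ballI)
  have q: "Suc (q - 1) = q" using j by simp
  show "clinear (\<lambda>v. codeg_op q j (r v))"
    by (intro linear_intros j equivariantD(1)[OF r])
  show "codeg_op q j (r v) \<in> chain_space (Suc (q - 1))" for v
    unfolding q by (intro codeg_op_closed j equivariantD(2)[OF r])
  fix v u assume u: "u \<in> K"
  have "codeg_op q j (r (actV v u) - diag q u (r v)) \<in> bal q"
    by (intro codeg_op_balancing j equivariantD(3)[OF r u])
  then show "codeg_op q j (r (actV v u)) - diag (q - 1) u (codeg_op q j (r v)) \<in> bal (Suc (q - 1))"
    unfolding q
    by (simp add: clinear_diff[OF clinear_codeg_op[OF j]] codeg_op_diag[OF j equivariantD(2)[OF r]])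
qed

text \<open>The anti-Yetter-Drinfeld condition on V expands the coaction of v u into S(u_3) x u_1
  and v' u_2. Equivariance of r takes u_2 out modulo \<open>bal\<close>, \<open>cyc_diag\<close>
  moves it past the rotation, and \<open>lastr_diag\<close> then reassembles the three components of
  u.\<close>

lemma equivariant_cyc_rep:
  assumes r: "equivariant q r"
  shows "equivariant q (cyc_rep q r)"
  unfolding equivariant_def
proof (intro conjI allI ballI)
  note lin = clinear_equivariant_compose[OF r]
  show "clinear (cyc_rep q r)"
    unfolding cyc_rep_def by (intro linear_intros lin)
  show "cyc_rep q r v \<in> chain_space (Suc q)" for v
    unfolding cyc_rep_def
    by (intro tensor_lift_in_subspace csubspace_tensor_space twisted_cyc_closed equivariantD(2)[OF r])
  fix v u assume u: "u \<in> K"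
  \<comment> \<open>In A the element u2 still acts inside r; in B it acts diagonally after the
    rotation, which is the input that \<open>lastr_diag\<close> expects.\<close>
  define A where "A x v' u1 u2 u3 = twisted_cyc q (S u3 * x * u1) (r (actK v' u2))" for x v' u1 u2 u3
  define B where "B x v' u1 u2 u3 = lastr q (S (S u3 * x * u1)) (diag q u2 (cyc q (r v')))" for x v' u1 u2 u3
  have "cyc_rep q r (actV v u) = tensor_lift (\<lambda>g u3. tensor_lift (\<lambda>u1 u2.
      tensor_lift (\<lambda>x v'. A x v' u1 u2 u3) (coactV v)) (\<Delta> g)) (\<Delta> u)"
    unfolding cyc_rep_def A_def by (rule coactV_actV[OF _ u]) (intro linear_intros lin)
  also have "\<dots> = tensor_lift (\<lambda>g u3. tensor_lift (\<lambda>x v'.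
      tensor_lift (\<lambda>u1 u2. A x v' u1 u2 u3) (\<Delta> g)) (coactV v)) (\<Delta> u)"
    by (intro tensor_lift_cong) (rule tensor_lift_swap)
  also have "\<dots> = tensor_lift (\<lambda>x v'. tensor_lift (\<lambda>g u3.
      tensor_lift (\<lambda>u1 u2. A x v' u1 u2 u3) (\<Delta> g)) (\<Delta> u)) (coactV v)"
    by (rule tensor_lift_swap)
  finally have 1: "cyc_rep q r (actV v u) = \<dots>" .
  have 2: "diag q u (cyc_rep q r v) = tensor_lift (\<lambda>x v'. tensor_lift (\<lambda>g u3.
      tensor_lift (\<lambda>u1 u2. B x v' u1 u2 u3) (\<Delta> g)) (\<Delta> u)) (coactV v)"
    unfolding cyc_rep_def clinear_tensor_lift_commute[OF clinear_diag] twisted_cyc_def B_def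
    by (intro tensor_lift_cong lastr_diag[symmetric] u cyc_closed equivariantD(2)[OF r])
  have AB: "A x v' u1 u2 u3 - B x v' u1 u2 u3 \<in> bal (Suc q)" if "u2 \<in> K" for x v' u1 u2 u3
  proof -
    have "cyc q (r (actV v' u2)) - diag q u2 (cyc q (r v')) = cyc q (r (actV v' u2) - diag q u2 (r v'))"
      by (simp add: clinear_diff[OF clinear_cyc] cyc_diag[OF that equivariantD(2)[OF r]])
    then have "A x v' u1 u2 u3 - B x v' u1 u2 u3
      = lastr q (S (S u3 * x * u1)) (cyc q (r (actV v' u2) - diag q u2 (r v')))"
      by (simp add: A_def B_def twisted_cyc_def actK_eq[OF that] clinear_diff[OF clinear_lastr, symmetric])
    then show ?thesis
      by (simp add: lastr_balancing cyc_balancing equivariantD(3)[OF r that])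
  qed
  \<comment> \<open>\<open>AB\<close> is available only for u2 in K, so closure of K under the
    coproduct is applied at both levels.\<close>
  have "tensor_lift (\<lambda>g u3. tensor_lift (\<lambda>u1 u2. A x v' u1 u2 u3 - B x v' u1 u2 u3) (\<Delta> g)) (\<Delta> u)
    \<in> bal (Suc q)" for x v'
  proof (rule tensor_lift_in_subspace_on[OF comult_closed[OF u] _ csubspace_bal])
    show "bilinear (\<lambda>g u3. tensor_lift (\<lambda>u1 u2. A x v' u1 u2 u3 - B x v' u1 u2 u3) (\<Delta> g))"
      unfolding A_def B_def by (intro linear_intros lin)
    fix g u3 assume g: "g \<in> K"
    show "tensor_lift (\<lambda>u1 u2. A x v' u1 u2 u3 - B x v' u1 u2 u3) (\<Delta> g) \<in> bal (Suc q)"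
    proof (rule tensor_lift_in_subspace_on[OF comult_closed[OF g] _ csubspace_bal])
      show "bilinear (\<lambda>u1 u2. A x v' u1 u2 u3 - B x v' u1 u2 u3)"
        unfolding A_def B_def by (intro linear_intros lin)
    qed (rule AB)
  qed
  then show "cyc_rep q r (actV v u) - diag q u (cyc_rep q r v) \<in> bal (Suc q)"
    unfolding 1 2 tensor_lift_diff by (rule tensor_lift_sub_in[OF csubspace_bal])
qed

definition coface_rep :: "nat \<Rightarrow> nat \<Rightarrow> ('v \<Rightarrow> ('n, 'h tpow) tensor) \<Rightarrow> 'v \<Rightarrow> ('n, 'h tpow) tensor"
  where "coface_rep q i r = (if i \<le> q then (\<lambda>v. coface_op q i (r v))
    else cyc_rep (Suc q) (\<lambda>v. coface_op q 0 (r v)))"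

definition codeg_rep :: "nat \<Rightarrow> nat \<Rightarrow> ('v \<Rightarrow> ('n, 'h tpow) tensor) \<Rightarrow> 'v \<Rightarrow> ('n, 'h tpow) tensor"
  where "codeg_rep q j r = (\<lambda>v. codeg_op q j (r v))"

lemma equivariant_coface_rep: "equivariant q r \<Longrightarrow> equivariant (Suc q) (coface_rep q i r)"
  by (simp add: coface_rep_def equivariant_coface equivariant_cyc_rep)

lemma equivariant_codeg_rep: "j < q \<Longrightarrow> equivariant q r \<Longrightarrow> equivariant (q - 1) (codeg_rep q j r)"
  unfolding codeg_rep_def by (rule equivariant_codeg)

lemma twisted_cyc_coset:
  "clinear r \<Longrightarrow> coset_tensor_lift (bal (Suc q)) (\<lambda>k v'. induced (bal (Suc q)) (lastr q (S k))
      (cyc q (r v') +o bal (Suc q))) (coactV v) = cyc_rep q r v +o bal (Suc q)"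
  unfolding cyc_rep_def twisted_cyc_def
proof (rule coset_tensor_lift_coset[OF csubspace_bal])
  assume r: "clinear r"
  show "bilinear (\<lambda>k v'. lastr q (S k) (cyc q (r v')))"
    by (intro linear_intros r)
  show "induced (bal (Suc q)) (lastr q (S k)) (cyc q (r v') +o bal (Suc q))
    = lastr q (S k) (cyc q (r v')) +o bal (Suc q)" for k v'
    by (intro induced_coset clinear_lastr csubspace_bal lastr_balancing)
qed

lemma cyclic_op_cls:
  assumes r: "equivariant q r"
  shows "cyclic_op \<Delta> \<epsilon> S coactV act coact q (cls q r) = cls q (cyc_rep q r)"
proof -
  have "induced (bal (Suc q)) (cyc q) (r v' +o bal (Suc q)) = cyc q (r v') +o bal (Suc q)" for v'
    by (intro induced_coset clinear_cyc csubspace_bal cyc_balancing)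
  then show ?thesis
    by (simp add: cyclic_op_def cls_def twisted_cyc_coset[OF equivariantD(1)[OF r]])
qed

lemma coface_cls:
  assumes r: "equivariant q r"
  shows "coface \<Delta> \<epsilon> S coactV act coact q i (cls q r) = cls (Suc q) (coface_rep q i r)"
proof (cases "i \<le> q")
  case True
  then show ?thesis
    by (simp add: coface_def cls_def coface_rep_def induced_coset[OF clinear_coface_op csubspace_bal
          csubspace_bal coface_op_balancing])
next
  case False
  have "induced (bal (Suc (Suc q))) (last_coface_pre \<Delta> coact q) (r v' +o bal (Suc q))
    = cyc (Suc q) (coface_op q 0 (r v')) +o bal (Suc (Suc q))" for v'
  proof -
    \<comment> \<open>The factorization of the last coface through \<open>coface_op q 0\<close> is
      known on chains of the right degree, and the balancing relations are such chains.\<close>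
    have "last_coface_pre \<Delta> coact q u \<in> bal (Suc (Suc q))" if "u \<in> bal (Suc q)" for u
      using that bal_subset_chain_space[of "Suc q"]
      by (simp add: last_coface_eq_cyc_coface_0[of u q] subsetD cyc_balancing coface_op_balancing)
    then have "induced (bal (Suc (Suc q))) (last_coface_pre \<Delta> coact q) (r v' +o bal (Suc q))
      = last_coface_pre \<Delta> coact q (r v') +o bal (Suc (Suc q))"
      by (intro induced_coset clinear_last_coface csubspace_bal)
    then show ?thesis
      by (simp add: last_coface_eq_cyc_coface_0[OF equivariantD(2)[OF r]])
  qed
  moreover have "clinear (\<lambda>v. coface_op q 0 (r v))"
    by (intro linear_intros equivariantD(1)[OF r]) simp
  ultimately show ?thesis
    using False by (simp add: coface_def cls_def coface_rep_def twisted_cyc_coset Let_def)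
qed

lemma codegeneracy_cls:
  assumes j: "j < q"
  shows "codegeneracy \<Delta> \<epsilon> act q j (cls q r) = cls (q - 1) (codeg_rep q j r)"
  using j
  by (simp add: codegeneracy_def cls_def codeg_rep_def induced_coset[OF clinear_codeg_op csubspace_bal
        csubspace_bal codeg_op_balancing])

section \<open>Linear structure of the cochains\<close>

lemma cochain_add_cls: "cochain_add (cls q r) (cls q r') = cls q (\<lambda>v. r v + r' v)"
  by (simp add: cochain_add_def cls_def coset_plus[OF csubspace_bal])

lemma cochain_scale_cls: "cochain_scale \<Delta> \<epsilon> act q c (cls q r) = cls q (\<lambda>v. c *\<^sub>C r v)"
  by (simp add: cochain_scale_def cls_def coset_scale_coset[OF csubspace_bal])

lemma equivariant_add:
  assumes r: "equivariant q r" and r': "equivariant q r'"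
  shows "equivariant q (\<lambda>v. r v + r' v)"
  unfolding equivariant_def
proof (intro conjI allI ballI)
  show "clinear (\<lambda>v. r v + r' v)"
    by (intro linear_intros equivariantD(1)[OF r] equivariantD(1)[OF r'])
  show "r v + r' v \<in> chain_space (Suc q)" for v
    by (intro complex_vector.subspace_add csubspace_tensor_space equivariantD(2)[OF r]
        equivariantD(2)[OF r'])
  fix v u assume u: "u \<in> K"
  have "(r (actV v u) - diag q u (r v)) + (r' (actV v u) - diag q u (r' v)) \<in> bal (Suc q)"
    by (intro complex_vector.subspace_add csubspace_bal equivariantD(3)[OF r u]
        equivariantD(3)[OF r' u])
  then show "(r (actV v u) + r' (actV v u)) - diag q u (r v + r' v) \<in> bal (Suc q)"
    by (simp add: clinear_add[OF clinear_diag] algebra_simps)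
qed

lemma equivariant_scale:
  assumes r: "equivariant q r"
  shows "equivariant q (\<lambda>v. c *\<^sub>C r v)"
  unfolding equivariant_def
proof (intro conjI allI ballI)
  show "clinear (\<lambda>v. c *\<^sub>C r v)"
    by (intro linear_intros equivariantD(1)[OF r])
  show "c *\<^sub>C r v \<in> chain_space (Suc q)" for v
    by (intro complex_vector.subspace_scale csubspace_tensor_space equivariantD(2)[OF r])
  fix v u assume u: "u \<in> K"
  have "c *\<^sub>C (r (actV v u) - diag q u (r v)) \<in> bal (Suc q)"
    by (intro complex_vector.subspace_scale csubspace_bal equivariantD(3)[OF r u])
  then show "c *\<^sub>C r (actV v u) - diag q u (c *\<^sub>C r v) \<in> bal (Suc q)"
    by (simp add: clinear_scaleC[OF clinear_diag] complex_vector.scale_right_diff_distrib)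
qed

lemma equivariant_zero: "equivariant q (\<lambda>v. 0)"
  by (simp add: equivariant_def clinear_iff clinear_0[OF clinear_diag]
      complex_vector.subspace_0[OF csubspace_bal] complex_vector.subspace_0[OF csubspace_tensor_space])

lemma complex_space_cochains:
  "complex_space (cochains \<Delta> \<epsilon> K actV act q) cochain_add (cochain_scale \<Delta> \<epsilon> act q)"
proof -
  let ?C = "cochains \<Delta> \<epsilon> K actV act q"
  have zero: "\<exists>z\<in>?C. \<forall>x\<in>?C. cochain_add z x = x \<and> (\<exists>y\<in>?C. cochain_add x y = z)"
  proof (rule bexI[OF _ cls_in_cochains[OF equivariant_zero]], intro ballI conjI)
    fix x assume "x \<in> ?C"
    then obtain r where r: "equivariant q r" "x = cls q r" by (rule cochain_cases)
    show "cochain_add (cls q (\<lambda>v. 0)) x = x"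
      by (simp add: r(2) cochain_add_cls)
    have "cochain_add x (cls q (\<lambda>v. (-1) *\<^sub>C r v)) = cls q (\<lambda>v. 0)"
      by (simp add: r(2) cochain_add_cls)
    then show "\<exists>y\<in>?C. cochain_add x y = cls q (\<lambda>v. 0)"
      using cls_in_cochains[OF equivariant_scale[OF r(1)]] by blast
  qed
  have add: "cochain_add x y \<in> ?C" if "x \<in> ?C" "y \<in> ?C" for x y
    using that by (elim cochain_cases) (simp add: cochain_add_cls equivariant_add cls_in_cochains)
  have scale: "cochain_scale \<Delta> \<epsilon> act q c x \<in> ?C" if "x \<in> ?C" for x c
    using that by (elim cochain_cases) (simp add: cochain_scale_cls equivariant_scale cls_in_cochains)
  show ?thesis
    unfolding complex_space_def
    by (intro conjI zero; intro ballI allI add scale; assumption?;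
        (elim cochain_cases)?;
        simp add: cochain_add_cls cochain_scale_cls ac_simps scaleC_add_right
          scaleC_add_left scaleC_scaleC scaleC_one)
qed

lemma cyc_rep_linear:
  "cyc_rep q (\<lambda>v. r v + r' v) = (\<lambda>v. cyc_rep q r v + cyc_rep q r' v)"
  "cyc_rep q (\<lambda>v. c *\<^sub>C r v) = (\<lambda>v. c *\<^sub>C cyc_rep q r v)"
  by (simp_all add: cyc_rep_def fun_eq_iff clinear_add[OF clinear_twisted_cyc]
      clinear_scaleC[OF clinear_twisted_cyc] tensor_lift_scaleC tensor_lift_add)

lemma coface_rep_linear:
  "coface_rep q i (\<lambda>v. r v + r' v) = (\<lambda>v. coface_rep q i r v + coface_rep q i r' v)"
  "coface_rep q i (\<lambda>v. c *\<^sub>C r v) = (\<lambda>v. c *\<^sub>C coface_rep q i r v)"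
  by (simp_all add: coface_rep_def cyc_rep_linear clinear_add[OF clinear_coface_op] clinear_scaleC[OF clinear_coface_op])

lemma codeg_rep_linear:
  "j < q \<Longrightarrow> codeg_rep q j (\<lambda>v. r v + r' v) = (\<lambda>v. codeg_rep q j r v + codeg_rep q j r' v)"
  "j < q \<Longrightarrow> codeg_rep q j (\<lambda>v. c *\<^sub>C r v) = (\<lambda>v. c *\<^sub>C codeg_rep q j r v)"
  by (simp_all add: codeg_rep_def clinear_add[OF clinear_codeg_op] clinear_scaleC[OF clinear_codeg_op])

subsection \<open>Cocyclic identities on cochains\<close>

lemma cyc_rep_coface:
  assumes r: "equivariant q r" and i: "1 \<le> i" "i \<le> q"
  shows "cyc_rep (Suc q) (\<lambda>v. coface_op q i (r v)) = (\<lambda>v. coface_op q (i - 1) (cyc_rep q r v))"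
proof -
  have lin: "clinear (coface_op q (i - 1))" using i by (intro clinear_coface_op) simp
  show ?thesis
    by (rule ext) (simp only: cyc_rep_def clinear_tensor_lift_commute[OF lin]
        twisted_cyc_coface[OF i equivariantD(2)[OF r]])
qed

lemma cyc_rep_codeg:
  assumes r: "equivariant q r" and i: "1 \<le> i" "i < q"
  shows "cyc_rep (q - 1) (\<lambda>v. codeg_op q i (r v)) = (\<lambda>v. codeg_op q (i - 1) (cyc_rep q r v))"
proof -
  have lin: "clinear (codeg_op q (i - 1))" using i by (intro clinear_codeg_op) simp
  show ?thesis
    by (rule ext) (simp only: cyc_rep_def clinear_tensor_lift_commute[OF lin]
        twisted_cyc_codeg[OF i equivariantD(2)[OF r]])
qed

text \<open>Coassociativity of the coaction of V merges the two twists into the components of one x;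
  the outer operator receives the first component.\<close>

lemma cyc_rep_cyc_rep:
  assumes r: "clinear r"
  shows "cyc_rep q (cyc_rep q r) v = tensor_lift (\<lambda>x v'. tensor_lift (\<lambda>a b.
    twisted_cyc q a (twisted_cyc q b (r v'))) (\<Delta> x)) (coactV v)"
  unfolding cyc_rep_def clinear_tensor_lift_commute[OF clinear_twisted_cyc]
  by (rule coactV_coassoc; intro linear_intros clinear_compose[OF r])

lemma cyc_rep_cyc_rep_coface_0:
  assumes r: "equivariant q r"
  shows "cyc_rep (Suc q) (cyc_rep (Suc q) (\<lambda>v. coface_op q 0 (r v)))
    = (\<lambda>v. coface_op q q (cyc_rep q r v))"
proof
  fix v
  have "clinear (\<lambda>v. coface_op q 0 (r v))"
    by (intro linear_intros equivariantD(1)[OF r]) simp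
  from cyc_rep_cyc_rep[OF this, of "Suc q" v]
  show "cyc_rep (Suc q) (cyc_rep (Suc q) (\<lambda>v. coface_op q 0 (r v))) v
    = coface_op q q (cyc_rep q r v)"
    by (simp add: twisted_cyc_twisted_cyc_coface_0[OF equivariantD(2)[OF r]] cyc_rep_def
        clinear_tensor_lift_commute[OF clinear_coface_op[OF order_refl]])
qed

lemma cyc_rep_codeg_0:
  assumes r: "equivariant q r" and q: "1 \<le> q"
  shows "cyc_rep (q - 1) (\<lambda>v. codeg_op q 0 (r v))
    = (\<lambda>v. codeg_op q (q - 1) (cyc_rep q (cyc_rep q r) v))"
proof
  fix v
  have lin: "clinear (codeg_op q (q - 1))" using q by (intro clinear_codeg_op) simp
  show "cyc_rep (q - 1) (\<lambda>v. codeg_op q 0 (r v)) v = codeg_op q (q - 1) (cyc_rep q (cyc_rep q r) v)"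
    unfolding cyc_rep_cyc_rep[OF equivariantD(1)[OF r]] clinear_tensor_lift_commute[OF lin]
      twisted_cyc_codeg_0[OF q equivariantD(2)[OF r]] by (simp only: cyc_rep_def)
qed

lemma codeg_cyc_rep_coface_0:
  assumes r: "equivariant q r"
  shows "codeg_op (Suc q) q (cyc_rep (Suc q) (\<lambda>v. coface_op q 0 (r v)) v) = r v"
  unfolding cyc_rep_def clinear_tensor_lift_commute[OF clinear_codeg_op[OF lessI]]
    codeg_twisted_cyc_coface_0[OF equivariantD(2)[OF r]]
  by (rule coactV_counit[OF equivariantD(1)[OF r]])

text \<open>Each further application adds one coaction of V, which coassociativity turns into a new
  first component; this agrees with \<open>foldr\<close>, where the head acts last. For n = 0 the
  sum reduces to \<epsilon> and the counit axiom gives r v.\<close>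

lemma cyc_rep_power:
  assumes r: "clinear r"
  shows "(cyc_rep q ^^ n) r v
    = tensor_lift (\<lambda>k v'. sw n (\<lambda>ks. foldr (twisted_cyc q) ks (r v')) k) (coactV v)"
proof (induction n arbitrary: v)
  case 0
  show ?case using coactV_counit[OF r] by simp
next
  case (Suc n)
  define F where "F k k' v' = sw n (\<lambda>ks. twisted_cyc q k (foldr (twisted_cyc q) ks (r v'))) k'"
    for k k' v'
  have foldr: "clinear (foldr (twisted_cyc q) ks)" for ks
    by (induction ks) (simp_all add: linear_intros id_def comp_def)
  have ml: "multilinear_upon n (\<lambda>ks. twisted_cyc q k (foldr (twisted_cyc q) ks y))" for k y
    using multilinear_upon_foldr_twisted_cyc[of n q y]
    unfolding multilinear_upon_def by (auto intro: linear_intros)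
  have "(cyc_rep q ^^ Suc n) r v
    = tensor_lift (\<lambda>k v'. tensor_lift (\<lambda>k' v''. F k k' v'') (coactV v')) (coactV v)"
    by (simp add: cyc_rep_def[of q "(cyc_rep q ^^ n) r"] Suc.IH F_def
        clinear_tensor_lift_commute[OF clinear_twisted_cyc]
        clinear_iter_sweedler_commute[OF clinear_twisted_cyc])
  also have "\<dots> = tensor_lift (\<lambda>x v'. tensor_lift (\<lambda>a b. F a b v') (\<Delta> x)) (coactV v)"
    unfolding F_def
    by (rule coactV_coassoc;
        intro clinear_iter_sweedler_param clinear_sw_compose ml clinear_id
          clinear_twisted_cyc_param clinear_ops_compose(6) clinear_compose[OF foldr] r)
  finally show ?case by (simp add: F_def)
qed

lemma cyc_rep_power_Suc:
  assumes r: "equivariant q r"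
  shows "(cyc_rep q ^^ Suc q) r v - r v \<in> bal (Suc q)"
proof -
  note lin = equivariantD(1)[OF r]
  have A: "(cyc_rep q ^^ Suc q) r v - tensor_lift (\<lambda>k v'. diag q (S k) (r v')) (coactV v) \<in> bal (Suc q)"
    unfolding cyc_rep_power[OF lin]
    by (intro tensor_lift_sub_in[OF csubspace_bal] sw_foldr_twisted_cyc equivariantD(2)[OF r])
  \<comment> \<open>Equivariance may be used because the coaction takes values in the tensor product
    of K and V, and K is closed under S.\<close>
  have B: "tensor_lift (\<lambda>k v'. r (actK v' (S k)) - diag q (S k) (r v')) (coactV v) \<in> bal (Suc q)"
  proof (rule tensor_lift_in_subspace_on[OF coactV_in _ csubspace_bal])
    show "bilinear (\<lambda>k v'. r (actK v' (S k)) - diag q (S k) (r v'))"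
      by (intro linear_intros clinear_compose[OF lin])
    show "r (actK v' (S k)) - diag q (S k) (r v') \<in> bal (Suc q)" if "k \<in> K" for k v'
      using that by (simp add: actK_eq antipode_closed equivariantD(3)[OF r])
  qed
  have C: "tensor_lift (\<lambda>k v'. r (actK v' (S k))) (coactV v) = r v"
    by (simp add: clinear_tensor_lift_commute[OF lin, symmetric] coactV_stable_antipode)
  show ?thesis
    using complex_vector.subspace_diff[OF csubspace_bal A B[unfolded tensor_lift_diff C]] by simp
qed

lemma equivariant_cyc_rep_power: "equivariant q r \<Longrightarrow> equivariant q ((cyc_rep q ^^ n) r)"
  by (induction n) (simp_all add: equivariant_cyc_rep)

lemma cyclic_op_power_cls:
  "equivariant q r \<Longrightarrow> (cyclic_op \<Delta> \<epsilon> S coactV act coact q ^^ n) (cls q r) = cls q ((cyc_rep q ^^ n) r)"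
  by (induction n) (simp_all add: cyclic_op_cls equivariant_cyc_rep_power)

lemma cocyclic_module_cochains:
  "cocyclic_module (cochains \<Delta> \<epsilon> K actV act) (\<lambda>q. cochain_add) (cochain_scale \<Delta> \<epsilon> act)
    (coface \<Delta> \<epsilon> S coactV act coact) (codegeneracy \<Delta> \<epsilon> act) (cyclic_op \<Delta> \<epsilon> S coactV act coact)"
proof (rule cocyclic_module.intro)
  let ?C = "cochains \<Delta> \<epsilon> K actV act"
  let ?d = "coface \<Delta> \<epsilon> S coactV act coact"
  let ?s = "codegeneracy \<Delta> \<epsilon> act"
  let ?t = "cyclic_op \<Delta> \<epsilon> S coactV act coact"
  note reps = coface_cls codegeneracy_cls cyclic_op_cls cochain_add_cls cochain_scale_cls
    equivariant_coface_rep equivariant_codeg_rep equivariant_cyc_rep equivariant_add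
    equivariant_scale cls_in_cochains
  show "complex_space (?C q) cochain_add (cochain_scale \<Delta> \<epsilon> act q)" for q
    by (rule complex_space_cochains)
  show "complex_linear_map (?C q) cochain_add (cochain_scale \<Delta> \<epsilon> act q)
      (?C (q + 1)) cochain_add (cochain_scale \<Delta> \<epsilon> act (q + 1)) (?d q i)" for q i
    unfolding complex_linear_map_def
    by (intro conjI allI ballI; elim cochain_cases;
        simp add: reps coface_rep_linear)
  show "complex_linear_map (?C q) cochain_add (cochain_scale \<Delta> \<epsilon> act q)
      (?C (q - 1)) cochain_add (cochain_scale \<Delta> \<epsilon> act (q - 1)) (?s q j)" if "j < q" for q j
    unfolding complex_linear_map_def using that
    by (intro conjI allI ballI; elim cochain_cases;
        simp add: reps codeg_rep_linear del: One_nat_def)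
  show "complex_linear_map (?C q) cochain_add (cochain_scale \<Delta> \<epsilon> act q)
      (?C q) cochain_add (cochain_scale \<Delta> \<epsilon> act q) (?t q)" for q
    unfolding complex_linear_map_def
    by (intro conjI allI ballI; elim cochain_cases;
        simp add: reps cyc_rep_linear)
  fix x q
  assume "x \<in> ?C q"
  then obtain r where r: "equivariant q r" and x: "x = cls q r" by (rule cochain_cases)
  note chain = equivariantD(2)[OF r]
  have r0: "equivariant (Suc q) (\<lambda>v. coface_op q 0 (r v))"
    using r by (intro equivariant_coface) simp_all
  show "?d (q + 1) j (?d q i x) = ?d (q + 1) i (?d q (j - 1) x)" if ij: "i < j" "j \<le> q + 2" for i j
  proof -
    consider "j \<le> Suc q" | "j = Suc (Suc q)" "i \<le> q" | "j = Suc (Suc q)" "i = Suc q"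
      using ij by linarith
    then have "coface_rep (Suc q) j (coface_rep q i r) = coface_rep (Suc q) i (coface_rep q (j - 1) r)"
    proof cases
      case 1
      have "i \<le> q" "i \<le> Suc q" "j - 1 \<le> q" using 1 ij by simp_all
      then show ?thesis
        using 1 by (simp only: coface_rep_def coface_coface[OF ij(1) 1 chain] if_True)
    next
      case 2
      \<comment> \<open>The chain of equalities is t d_0 d_i = t d_(i+1) d_0 = d_i t d_0.\<close>
      have "coface_op (Suc q) 0 (coface_op q i (r v)) = coface_op (Suc q) (Suc i) (coface_op q 0 (r v))" for v
        using coface_coface[OF _ _ chain, of 0 "Suc i"] 2 by simp
      then show ?thesis
        using 2 cyc_rep_coface[OF r0, of "Suc i"] by (simp add: coface_rep_def)
    next
      case 3
      \<comment> \<open>Here t d_0 t d_0 = t t d_1 d_0 = t t d_0 d_0 = d_(q+1) t d_0, the last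
        equality being the relation for t t d_0 in degree q + 1.\<close>
      have "coface_op (Suc q) 0 (coface_op q 0 (r v)) = coface_op (Suc q) (Suc 0) (coface_op q 0 (r v))" for v
        using coface_coface[OF _ _ chain, of 0 "Suc 0"] by simp
      then show ?thesis
        using 3 cyc_rep_coface[OF r0, of "Suc 0"] cyc_rep_cyc_rep_coface_0[OF r0]
        by (simp add: coface_rep_def)
    qed
    then show ?thesis using r by (simp add: x reps)
  qed
  show "?s (q - 1) j (?s q i x) = ?s (q - 1) i (?s q (j + 1) x)" if "i \<le> j" "j + 2 \<le> q" for i j
  proof -
    have "codeg_rep (q - 1) j (codeg_rep q i r) = codeg_rep (q - 1) i (codeg_rep q (Suc j) r)"
      using codeg_codeg[OF that chain] by (simp add: codeg_rep_def)
    then show ?thesis using r that by (simp add: x reps)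
  qed
  show "?s (q + 1) j (?d q i x) = ?d (q - 1) i (?s q (j - 1) x)" if "i < j" "j \<le> q" for i j
  proof -
    have "i \<le> q" "i \<le> q - 1" using that by simp_all
    then have "codeg_rep (Suc q) j (coface_rep q i r) = coface_rep (q - 1) i (codeg_rep q (j - 1) r)"
      using codeg_coface_less[OF that chain] by (simp add: codeg_rep_def coface_rep_def)
    moreover have "equivariant (q - 1) (codeg_rep q (j - 1) r)" "Suc (q - 1) = q"
      using that r by (auto intro!: equivariant_codeg_rep simp del: One_nat_def)
    ultimately show ?thesis using r that by (simp add: x reps Suc_eq_plus1[symmetric] del: One_nat_def)
  qed
  show "?s (q + 1) j (?d q i x) = x" if ij: "j \<le> q" "i = j \<or> i = j + 1" for i j
  proof -
    consider "i = j" | "i = Suc j" "i \<le> q" | "i = Suc q" "j = q" using ij by linarith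
    then have "codeg_rep (Suc q) j (coface_rep q i r) = r"
      by cases (use ij in \<open>simp_all add: codeg_rep_def coface_rep_def codeg_coface_same[OF _ chain]
        codeg_coface_Suc[OF _ chain] codeg_cyc_rep_coface_0[OF r]\<close>)
    then show ?thesis using r ij by (simp add: x reps)
  qed
  show "?s (q + 1) j (?d q i x) = ?d (q - 1) (i - 1) (?s q j x)" if ij: "j + 1 < i" "i \<le> q + 1" for i j
  proof -
    have j: "j < q" using ij by simp
    consider "i \<le> q" | "i = Suc q" using ij by linarith
    then have "codeg_rep (Suc q) j (coface_rep q i r) = coface_rep (q - 1) (i - 1) (codeg_rep q j r)"
    proof cases
      case 1
      have "Suc j < i" "i - 1 \<le> q - 1" using ij 1 by simp_all
      then show ?thesis
        using codeg_coface_greater[OF _ 1 chain] 1 by (simp add: codeg_rep_def coface_rep_def)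
    next
      case 2
      \<comment> \<open>The chain is s_j t d_0 = t s_(j+1) d_0 = t d_0 s_j. The inequality proved
        after it makes \<open>coface_rep (q - 1) q\<close> take its last-coface branch.\<close>
      have "codeg_op (Suc q) (Suc j) (coface_op q 0 (r v)) = coface_op (q - 1) 0 (codeg_op q j (r v))" for v
        using codeg_coface_less[OF _ _ chain, of 0 "Suc j"] j by simp
      moreover have "\<not> q \<le> q - Suc 0" using j by simp
      ultimately show ?thesis
        using 2 j cyc_rep_codeg[OF r0, of "Suc j"] by (simp add: codeg_rep_def coface_rep_def)
    qed
    moreover have "equivariant (q - 1) (codeg_rep q j r)" "Suc (q - 1) = q"
      using j r by (auto intro!: equivariant_codeg_rep simp del: One_nat_def)
    ultimately show ?thesis using r j by (simp add: x reps Suc_eq_plus1[symmetric] del: One_nat_def)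
  qed
  show "?t (q + 1) (?d q i x) = ?d q (i - 1) (?t q x)" if "1 \<le> i" "i \<le> q + 1" for i
  proof -
    have "cyc_rep (Suc q) (coface_rep q i r) = coface_rep q (i - 1) (cyc_rep q r)"
    proof (cases "i \<le> q")
      case True
      moreover from this have "i - Suc 0 \<le> q" by simp
      ultimately show ?thesis using cyc_rep_coface[OF r that(1)] by (simp add: coface_rep_def)
    next
      case False
      then have "i = Suc q" using that by simp
      then show ?thesis using cyc_rep_cyc_rep_coface_0[OF r] by (simp add: coface_rep_def)
    qed
    then show ?thesis using r by (simp add: x reps)
  qed
  show "?t (q + 1) (?d q 0 x) = ?d q (q + 1) x"
    using r by (simp add: x reps) (simp add: coface_rep_def)
  show "?t (q - 1) (?s q i x) = ?s q (i - 1) (?t q x)" if "1 \<le> i" "i < q" for i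
  proof -
    have "cyc_rep (q - 1) (codeg_rep q i r) = codeg_rep q (i - 1) (cyc_rep q r)"
      using cyc_rep_codeg[OF r that] by (simp add: codeg_rep_def)
    moreover have "i - 1 < q" using that by simp
    ultimately show ?thesis using r that by (simp add: x reps Suc_eq_plus1[symmetric] del: One_nat_def)
  qed
  show "?t (q - 1) (?s q 0 x) = ?s q (q - 1) (?t q (?t q x))" if "1 \<le> q"
  proof -
    have "cyc_rep (q - 1) (codeg_rep q 0 r) = codeg_rep q (q - 1) (cyc_rep q (cyc_rep q r))"
      using cyc_rep_codeg_0[OF r that] by (simp add: codeg_rep_def)
    moreover have "0 < q" "q - 1 < q" using that by simp_all
    ultimately show ?thesis using r by (simp add: x reps Suc_eq_plus1[symmetric] del: One_nat_def)
  qed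
  show "(?t q ^^ (q + 1)) x = x"
    unfolding x cyclic_op_power_cls[OF r] Suc_eq_plus1[symmetric]
    by (rule cls_eqI[OF cyc_rep_power_Suc[OF r]])
qed

end

theorem theorem3p1:
  fixes \<Delta> :: "'h::complex_algebra_1 \<Rightarrow> ('h, 'h) tensor"
    and \<epsilon> :: "'h \<Rightarrow> complex"
    and S :: "'h \<Rightarrow> 'h"
    and K :: "'h set"
    and actV :: "'v::complex_vector \<Rightarrow> 'h \<Rightarrow> 'v"
    and coactV :: "'v \<Rightarrow> ('h, 'v) tensor"
    and actN :: "'n::complex_vector \<Rightarrow> 'h \<Rightarrow> 'n"
    and coactN :: "'n \<Rightarrow> ('h, 'n) tensor"
  assumes "hopf_algebra \<Delta> \<epsilon> S"
    and "hopf_subalgebra \<Delta> \<epsilon> S K"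
    and "cocommutative_on \<Delta> K"
    and "sayd_module_on K \<Delta> \<epsilon> S actV coactV"
    and "sayd_module_on UNIV \<Delta> \<epsilon> S actN coactN"
  shows "cocyclic_module
    (cochains \<Delta> \<epsilon> K actV actN)
    (\<lambda>q. cochain_add)
    (cochain_scale \<Delta> \<epsilon> actN)
    (coface \<Delta> \<epsilon> S coactV actN coactN)
    (codegeneracy \<Delta> \<epsilon> actN)
    (cyclic_op \<Delta> \<epsilon> S coactV actN coactN)"
proof -
  interpret hopf_sayd_pair \<Delta> \<epsilon> S actN coactN K actV coactV
    using assms
    by (simp add: hopf_sayd_pair_def hopf_sayd_module_def hopf_sayd_module_axioms_def
        hopf_sayd_pair_axioms_def)
  show ?thesis by (rule cocyclic_module_cochains)
qed

end
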